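(* Let $P_1,\dots,P_n$ ($n\ge 3$) be discrete probability measures in $\mathbb{R}^d$, ordered so that $P_1,P_2$ are the two measures assigned to the pricing problem, and let $U_p\,\mathbf{q}=d_p$ be the constraints associated with exactly these two measures. Then the linear program $$\min\ b^T\mathbf{q}+\sigma\quad\text{s.t.}\quad U_p\,\mathbf{q}=d_p,\ \ \mathbf{q}\ge 0$$ (with $U_p$, $d_p$, $b$, $\sigma$ as defined in the context) is a classical transportation problem, and, given its data $U_p,d_p,b,\sigma$, it can be solved in strongly polynomial time.
   Context: Measures: each $P_i$ is a probability measure on $\mathbb{R}^d$ with finite support $\operatorname{supp}(P_i)$ of size $|P_i|$; its support points $x_{i1},\dots,x_{i|P_i|}$ have masses $d_{ij}>0$ with $\sum_{j}d_{ij}=1$. Nonnegative weights $\lambda_1,\dots,\lambda_n$ with $\sum_i\lambda_i=1$ are given. Combinations: $S^*=\operatorname{supp}(P_1)\times\cdots\times\operatorname{supp}(P_n)$, with elements $s_h=(x_1^h,\dots,x_n^h)$, $h=1,\dots,\prod_{i=1}^n|P_i|$, listed in lexicographic order (the index of the last measure varies fastest). Put $x^h=\sum_i\lambda_i x_i^h$ and $c_h=\sum_{i=1}^n\lambda_i\|x^h-x_i^h\|^2$; $c=(c_h)_h$. Constraint matrix: $A$ is the $0/1$ matrix with one row for each pair $(i,j)$, $1\le i\le n$, $1\le j\le|P_i|$, and one column for each $h$; the entry in row $(i,j)$, column $h$ is $1$ if $x_i^h=x_{ij}$ and $0$ otherwise. The right-hand side $d$ has entry $d_{ij}$ in row $(i,j)$.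 Partition the rows: $A_p,d_p$ are the rows for $i=1,2$; $A_m,d_m$ are the rows for $i=3,\dots,n$. Dual values: given vertices $\mathbf{p}_1,\dots,\mathbf{p}_J$ of $\{\mathbf{p}: A_p\mathbf{p}=d_p,\ \mathbf{p}\ge0\}$, the restricted master problem is $\min\sum_{j}(c^T\mathbf{p}_j)\mu_j$ subject to $\sum_j(A_m\mathbf{p}_j)\mu_j=d_m$, $\sum_j\mu_j=1$, $\mu\ge0$. Its dual solution is $(\mathbf{y}_m,\sigma)$, where $\mathbf{y}_m$ corresponds to the constraints with right-hand side $d_m$ and $\sigma\in\mathbb{R}$ to the convexity constraint $\sum_j\mu_j=1$. Pricing data: $A_p$ has exactly $|P_1|\cdot|P_2|$ distinct columns, one for each pair $(j_1,j_2)$ with $1\le j_1\le|P_1|$, $1\le j_2\le|P_2|$ (the column with a $1$ in rows $(1,j_1)$ and $(2,j_2)$ and zeros elsewhere). $U_p$ is the matrix whose columns are these distinct columns. The best-cost vector $b\in\mathbb{R}^{|P_1||P_2|}$ has entry, for the pair $(j_1,j_2)$, equal to the minimum of $(c^T-\mathbf{y}_m^TA_m)_h$ over all $h$ such that $x_1^h=x_{1j_1}$ and $x_2^h=x_{2j_2}$. A classical transportation problem is: given supplies $a_1,\dots,a_r\ge0$, demands $e_1,\dots,e_s\ge0$ with $\sum_k a_k=\sum_l e_l$, and costs $t_{kl}\in\mathbb{R}$, minimize $\sum_{k,l}t_{kl}q_{kl}$ (up to an additive constant) subject to $\sum_l q_{kl}=a_k$ for all $k$, $\sum_k q_{kl}=e_l$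 for all $l$, and $q_{kl}\ge0$. *)

theory Defs
  imports
    "HOL-Probability.Probability_Mass_Function"
    "HOL-Library.Log_Nat"
    "HOL-Computational_Algebra.Polynomial"
    "Jordan_Normal_Form.Matrix"
begin

unbundle no inner_syntax
no_notation Finite_Cartesian_Product.vec_nth (infixl "$" 90)
hide_type (open) Finite_Cartesian_Product.vec
hide_const (open) Finite_Cartesian_Product.vec Finite_Cartesian_Product.vec_nth

section \<open>Linear programs in standard form\<close>

text \<open>\<open>LP A r c \<kappa>\<close> is the program of minimizing \<open>c \<bullet> q + \<kappa>\<close> subject to \<open>A q = r\<close>, \<open>q \<ge> 0\<close>.\<close>

datatype lp =
  LP (lp_mat: "real mat") (lp_rhs: "real vec") (lp_cost: "real vec") (lp_const: real)

definition lp_feasible :: "lp \<Rightarrow> real vec set" where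
  "lp_feasible L = {q \<in> carrier_vec (dim_col (lp_mat L)).
     lp_mat L *\<^sub>v q = lp_rhs L \<and> 0\<^sub>v (dim_col (lp_mat L)) \<le> q}"

definition lp_objective :: "lp \<Rightarrow> real vec \<Rightarrow> real" where
  "lp_objective L q = lp_cost L \<bullet> q + lp_const L"

definition lp_optimal :: "lp \<Rightarrow> real vec \<Rightarrow> bool" where
  "lp_optimal L q \<longleftrightarrow> q \<in> lp_feasible L \<and>
     (\<forall>q' \<in> lp_feasible L. lp_objective L q \<le> lp_objective L q')"

definition lp_vertex :: "lp \<Rightarrow> real vec \<Rightarrow> bool" where
  "lp_vertex L p \<longleftrightarrow> p \<in> lp_feasible L \<and>
     \<not> (\<exists>u \<in> lp_feasible L. \<exists>v \<in> lp_feasible L. \<exists>t::real.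
          u \<noteq> v \<and> 0 < t \<and> t < 1 \<and> p = t \<cdot>\<^sub>v u + (1 - t) \<cdot>\<^sub>v v)"

definition lp_dual_feasible :: "lp \<Rightarrow> real vec set" where
  "lp_dual_feasible L = {w \<in> carrier_vec (dim_row (lp_mat L)).
     transpose_mat (lp_mat L) *\<^sub>v w \<le> lp_cost L}"

definition lp_dual_optimal :: "lp \<Rightarrow> real vec \<Rightarrow> bool" where
  "lp_dual_optimal L w \<longleftrightarrow> w \<in> lp_dual_feasible L \<and>
     (\<forall>w' \<in> lp_dual_feasible L. lp_rhs L \<bullet> w' \<le> lp_rhs L \<bullet> w)"

text \<open>\<open>\<phi>\<close> names the variables \<open>q\<^sub>k\<^sub>l\<close> and \<open>\<rho>\<close> names the rows: \<open>\<rho> (Inl k)\<close> is the \<open>k\<close>-th supply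
  constraint and \<open>\<rho> (Inr l)\<close> the \<open>l\<close>-th demand constraint. Thus the constraint system itself, not
  just its solution set, is that of a transportation problem.\<close>

definition transportation_problem :: "lp \<Rightarrow> bool" where
  "transportation_problem L \<longleftrightarrow>
    (\<exists>(r::nat) (s::nat) (a :: nat \<Rightarrow> real) (e :: nat \<Rightarrow> real) (t :: nat \<Rightarrow> nat \<Rightarrow> real) (\<kappa>::real)
       (\<phi> :: nat \<times> nat \<Rightarrow> nat) (\<rho> :: nat + nat \<Rightarrow> nat).
      (\<forall>k<r. 0 \<le> a k) \<and> (\<forall>l<s. 0 \<le> e l) \<and> (\<Sum>k<r. a k) = (\<Sum>l<s. e l) \<and>
      dim_vec (lp_rhs L) = dim_row (lp_mat L) \<and> dim_vec (lp_cost L) = dim_col (lp_mat L) \<and>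
      bij_betw \<phi> ({..<r} \<times> {..<s}) {..<dim_col (lp_mat L)} \<and>
      bij_betw \<rho> ({..<r} <+> {..<s}) {..<dim_row (lp_mat L)} \<and>
      (\<forall>k<r. lp_rhs L $ \<rho> (Inl k) = a k) \<and>
      (\<forall>l<s. lp_rhs L $ \<rho> (Inr l) = e l) \<and>
      (\<forall>q \<in> carrier_vec (dim_col (lp_mat L)).
         (\<forall>k<r. (lp_mat L *\<^sub>v q) $ \<rho> (Inl k) = (\<Sum>l<s. q $ \<phi> (k, l))) \<and>
         (\<forall>l<s. (lp_mat L *\<^sub>v q) $ \<rho> (Inr l) = (\<Sum>k<r. q $ \<phi> (k, l))) \<and>
         lp_objective L q = (\<Sum>k<r. \<Sum>l<s. t k l * q $ \<phi> (k, l)) + \<kappa>))"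

section \<open>Strongly polynomial algorithms\<close>

text \<open>The machine is a random access machine with real arithmetic. Index memory holds natural
  numbers, real memory holds real numbers; both consist of named arrays with indirect addressing,
  and a scalar is cell 0 of an array. Real memory is only accessible through the four arithmetic
  operations and comparisons; in particular there is no rounding and no conversion from reals to
  indices, and the only constants are integers. There is no multiplication of indices, so after
  \<open>t\<close> steps the indices have \<open>O(t + log m)\<close> bits, \<open>m\<close> being the largest initial index.

  The expressions are part of the (fixed) program, hence one step performs a number of elementary
  operations that is bounded by a constant depending only on the program. Division by zero yields
  zero, which a program could equally obtain by a comparison.\<close>

datatype iexp = INum nat | IGet string iexp | IAdd iexp iexp | ISub iexp iexp

datatype rexp = RNum int | RGet string iexp
  | RAdd rexp rexp | RSub rexp rexp | RMul rexp rexp | RDiv rexp rexp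

datatype bexp = ILess iexp iexp | RLess rexp rexp | BNot bexp | BAnd bexp bexp

datatype com = Skip | ISet string iexp iexp | RSet string iexp rexp
  | Seq com com | Cond bexp com com | Loop bexp com

datatype state = State (imem: "string \<Rightarrow> nat \<Rightarrow> nat") (rmem: "string \<Rightarrow> nat \<Rightarrow> real")

primrec ival :: "iexp \<Rightarrow> state \<Rightarrow> nat" where
  "ival (INum k) s = k"
| "ival (IGet x i) s = imem s x (ival i s)"
| "ival (IAdd i j) s = ival i s + ival j s"
| "ival (ISub i j) s = ival i s - ival j s"

primrec rval :: "rexp \<Rightarrow> state \<Rightarrow> real" where
  "rval (RNum k) s = of_int k"
| "rval (RGet x i) s = rmem s x (ival i s)"
| "rval (RAdd e f) s = rval e s + rval f s"
| "rval (RSub e f) s = rval e s - rval f s"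
| "rval (RMul e f) s = rval e s * rval f s"
| "rval (RDiv e f) s = rval e s / rval f s"

primrec bval :: "bexp \<Rightarrow> state \<Rightarrow> bool" where
  "bval (ILess i j) s \<longleftrightarrow> ival i s < ival j s"
| "bval (RLess e f) s \<longleftrightarrow> rval e s < rval f s"
| "bval (BNot b) s \<longleftrightarrow> \<not> bval b s"
| "bval (BAnd b b') s \<longleftrightarrow> bval b s \<and> bval b' s"

primrec step :: "com \<Rightarrow> state \<Rightarrow> com \<times> state" where
  "step Skip s = (Skip, s)"
| "step (ISet x i e) s =
     (Skip, State ((imem s)(x := (imem s x)(ival i s := ival e s))) (rmem s))"
| "step (RSet x i e) s =
     (Skip, State (imem s) ((rmem s)(x := (rmem s x)(ival i s := rval e s))))"
| "step (Seq c1 c2) s =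
     (if c1 = Skip then (c2, s) else (case step c1 s of (c1', s') \<Rightarrow> (Seq c1' c2, s')))"
| "step (Cond b c1 c2) s = (if bval b s then c1 else c2, s)"
| "step (Loop b c) s = (if bval b s then Seq c (Loop b c) else Skip, s)"

definition run :: "com \<Rightarrow> nat \<Rightarrow> state \<Rightarrow> com \<times> state" where
  "run c t s = ((\<lambda>(c, s). step c s) ^^ t) (c, s)"

definition lp_input :: "lp \<Rightarrow> state" where
  "lp_input L = (let A = lp_mat L; nr = dim_row A; nc = dim_col A in
     State
       (\<lambda>x i. if x = ''rows'' \<and> i = 0 then nr else if x = ''cols'' \<and> i = 0 then nc else 0)
       (\<lambda>x i. if x = ''mat'' \<and> i < nr * nc then A $$ (i div nc, i mod nc)
              else if x = ''rhs'' \<and> i < nr then lp_rhs L $ i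
              else if x = ''cost'' \<and> i < nc then lp_cost L $ i
              else if x = ''const'' \<and> i = 0 then lp_const L
              else 0))"

definition lp_entries :: "lp \<Rightarrow> real list" where
  "lp_entries L = concat (map list_of_vec (rows (lp_mat L)))
     @ list_of_vec (lp_rhs L) @ list_of_vec (lp_cost L) @ [lp_const L]"

text \<open>The encoding length of a rational number; the value at irrational numbers is irrelevant.\<close>

definition bits :: "real \<Rightarrow> nat" where
  "bits x = (case quotient_of (THE q. x = of_rat q) of
     (a, b) \<Rightarrow> 1 + floorlog 2 (nat \<bar>a\<bar>) + floorlog 2 (nat b))"

text \<open>A class of linear programs (each having an optimal solution) is solvable in strongly
  polynomial time if there is one program that, for every member of the class, computes an optimal
  solution and the optimal value in a number of steps polynomial in the number of input numbers,
  whatever the magnitudes of these (real) numbers are, and such that, moreover, for rational data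
  the encoding lengths of all numbers that occur stay polynomial in the encoding length of the
  data.\<close>

definition strongly_polynomially_solvable :: "lp set \<Rightarrow> bool" where
  "strongly_polynomially_solvable \<L> \<longleftrightarrow>
    (\<exists>(c :: com) (time :: nat poly) (space :: nat poly). \<forall>L \<in> \<L>.
      (\<exists>t s. t \<le> poly time (length (lp_entries L)) \<and> run c t (lp_input L) = (Skip, s) \<and>
         (let q = vec (dim_col (lp_mat L)) (rmem s ''sol'') in
            lp_optimal L q \<and> rmem s ''val'' 0 = lp_objective L q)) \<and>
      (set (lp_entries L) \<subseteq> \<rat> \<longrightarrow>
         (\<forall>t x i. let z = rmem (snd (run c t (lp_input L))) x i in
            z \<in> \<rat> \<and> bits z \<le> poly space (sum_list (map bits (lp_entries L))))))"

section \<open>The barycenter program and its pricing problem\<close>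

text \<open>Vectors of \<open>\<real>\<^sup>d\<close> are elements of \<open>carrier_vec d\<close>, so that a single algorithm can be required for
  all \<open>d\<close>. Everything is indexed from 0: the measures are \<open>P 0, \<dots>, P (n - 1)\<close>, those of the pricing
  problem being \<open>P 0\<close> and \<open>P 1\<close>, and the list \<open>x i\<close> enumerates the support of \<open>P i\<close>.\<close>

type_synonym points = "nat \<Rightarrow> real vec list"

text \<open>\<^const>\<open>product_lists\<close> enumerates lexicographically, with the last component varying fastest.\<close>

definition combos :: "nat \<Rightarrow> points \<Rightarrow> real vec list list" where
  "combos n x = product_lists (map x [0..<n])"

definition weighted_mean :: "nat \<Rightarrow> nat \<Rightarrow> (nat \<Rightarrow> real) \<Rightarrow> real vec list \<Rightarrow> real vec" where
  "weighted_mean n d lam s = vec d (\<lambda>k. \<Sum>i<n. lam i * (s ! i) $ k)"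

definition combo_cost :: "nat \<Rightarrow> nat \<Rightarrow> (nat \<Rightarrow> real) \<Rightarrow> real vec list \<Rightarrow> real" where
  "combo_cost n d lam s =
     (\<Sum>i<n. lam i * (let v = weighted_mean n d lam s - s ! i in v \<bullet> v))"

definition cost_vec :: "nat \<Rightarrow> nat \<Rightarrow> points \<Rightarrow> (nat \<Rightarrow> real) \<Rightarrow> real vec" where
  "cost_vec n d x lam = vec (length (combos n x)) (\<lambda>h. combo_cost n d lam (combos n x ! h))"

text \<open>The rows belonging to the measures \<open>i\<close> with \<open>lo \<le> i < hi\<close>; so \<open>A\<^sub>p, d\<^sub>p\<close> arise for \<open>lo = 0\<close>,
  \<open>hi = 2\<close>, and \<open>A\<^sub>m, d\<^sub>m\<close> for \<open>lo = 2\<close>, \<open>hi = n\<close>.\<close>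

definition row_ids :: "points \<Rightarrow> nat \<Rightarrow> nat \<Rightarrow> (nat \<times> nat) list" where
  "row_ids x lo hi = concat (map (\<lambda>i. map (Pair i) [0..<length (x i)]) [lo..<hi])"

definition constraint_mat :: "nat \<Rightarrow> points \<Rightarrow> nat \<Rightarrow> nat \<Rightarrow> real mat" where
  "constraint_mat n x lo hi =
     mat (length (row_ids x lo hi)) (length (combos n x))
       (\<lambda>(r, h). case row_ids x lo hi ! r of (i, j) \<Rightarrow> if combos n x ! h ! i = x i ! j then 1 else 0)"

definition constraint_rhs :: "(nat \<Rightarrow> real vec pmf) \<Rightarrow> points \<Rightarrow> nat \<Rightarrow> nat \<Rightarrow> real vec" where
  "constraint_rhs P x lo hi =
     vec (length (row_ids x lo hi)) (\<lambda>r. case row_ids x lo hi ! r of (i, j) \<Rightarrow> pmf (P i) (x i ! j))"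

definition pricing_polyhedron ::
  "nat \<Rightarrow> nat \<Rightarrow> (nat \<Rightarrow> real vec pmf) \<Rightarrow> points \<Rightarrow> (nat \<Rightarrow> real) \<Rightarrow> lp" where
  "pricing_polyhedron n d P x lam =
     LP (constraint_mat n x 0 2) (constraint_rhs P x 0 2) (cost_vec n d x lam) 0"

text \<open>The last row is the convexity constraint.\<close>

definition restricted_master ::
  "nat \<Rightarrow> nat \<Rightarrow> (nat \<Rightarrow> real vec pmf) \<Rightarrow> points \<Rightarrow> (nat \<Rightarrow> real) \<Rightarrow> real vec list \<Rightarrow> lp" where
  "restricted_master n d P x lam ps =
     LP (mat_of_cols (length (row_ids x 2 n) + 1)
           (map (\<lambda>p. (constraint_mat n x 2 n *\<^sub>v p) @\<^sub>v vec 1 (\<lambda>_. 1)) ps))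
        (constraint_rhs P x 2 n @\<^sub>v vec 1 (\<lambda>_. 1))
        (vec (length ps) (\<lambda>j. cost_vec n d x lam \<bullet> (ps ! j)))
        0"

definition col_ids :: "points \<Rightarrow> (nat \<times> nat) list" where
  "col_ids x = List.product [0..<length (x 0)] [0..<length (x 1)]"

definition pricing_mat :: "points \<Rightarrow> real mat" where
  "pricing_mat x =
     mat (length (row_ids x 0 2)) (length (col_ids x))
       (\<lambda>(r, k). case col_ids x ! k of (j1, j2) \<Rightarrow>
          if row_ids x 0 2 ! r = (0, j1) \<or> row_ids x 0 2 ! r = (1, j2) then 1 else 0)"

definition reduced_cost ::
  "nat \<Rightarrow> nat \<Rightarrow> points \<Rightarrow> (nat \<Rightarrow> real) \<Rightarrow> real vec \<Rightarrow> real vec" where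
  "reduced_cost n d x lam y =
     cost_vec n d x lam - transpose_mat (constraint_mat n x 2 n) *\<^sub>v y"

definition best_cost ::
  "nat \<Rightarrow> nat \<Rightarrow> points \<Rightarrow> (nat \<Rightarrow> real) \<Rightarrow> real vec \<Rightarrow> real vec" where
  "best_cost n d x lam y =
     vec (length (col_ids x)) (\<lambda>k. case col_ids x ! k of (j1, j2) \<Rightarrow>
       Min {reduced_cost n d x lam y $ h | h. h < length (combos n x) \<and>
              combos n x ! h ! 0 = x 0 ! j1 \<and> combos n x ! h ! 1 = x 1 ! j2})"

definition pricing_lp ::
  "nat \<Rightarrow> nat \<Rightarrow> (nat \<Rightarrow> real vec pmf) \<Rightarrow> points \<Rightarrow> (nat \<Rightarrow> real) \<Rightarrow> real vec \<Rightarrow> real \<Rightarrow> lp" where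
  "pricing_lp n d P x lam y \<sigma> =
     LP (pricing_mat x) (constraint_rhs P x 0 2) (best_cost n d x lam y) \<sigma>"

definition barycenter_data ::
  "nat \<Rightarrow> nat \<Rightarrow> (nat \<Rightarrow> real vec pmf) \<Rightarrow> points \<Rightarrow> (nat \<Rightarrow> real) \<Rightarrow> bool" where
  "barycenter_data n d P x lam \<longleftrightarrow>
     (\<forall>i<n. set_pmf (P i) \<subseteq> carrier_vec d \<and> distinct (x i) \<and> set (x i) = set_pmf (P i)) \<and>
     (\<forall>i<n. 0 \<le> lam i) \<and> (\<Sum>i<n. lam i) = 1"

definition master_dual ::
  "nat \<Rightarrow> nat \<Rightarrow> (nat \<Rightarrow> real vec pmf) \<Rightarrow> points \<Rightarrow> (nat \<Rightarrow> real) \<Rightarrow> real vec list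
     \<Rightarrow> real vec \<Rightarrow> real \<Rightarrow> bool" where
  "master_dual n d P x lam ps y \<sigma> \<longleftrightarrow>
     (\<forall>p \<in> set ps. lp_vertex (pricing_polyhedron n d P x lam) p) \<and>
     dim_vec y = length (row_ids x 2 n) \<and>
     lp_dual_optimal (restricted_master n d P x lam ps) (y @\<^sub>v vec 1 (\<lambda>_. \<sigma>))"

end

theory Submission
  imports Defs
begin

text \<open>The program is minimum mean cycle cancelling. In the residual graph of a feasible flow, let
  \<open>- 2 \<epsilon>\<close> be the least mean weight of a pair of consecutive edges (forward, backward) on a cycle; then
  there are potentials for which all residual reduced costs are at least \<open>- \<epsilon>\<close>, and the edges of a
  minimum mean cycle have reduced cost exactly \<open>- \<epsilon>\<close>. Hence cancelling such a cycle never increases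
  \<open>\<epsilon>\<close>, and \<open>r s + 1\<close> cancellations decrease it by a factor \<open>1 - 1 / (2 r)\<close>. Once \<open>\<epsilon>\<close> has dropped by a
  factor \<open>4 r + 1\<close>, some cell used by the flow has a reduced cost so large that it carries no flow ever
  again, so the number of cancellations is polynomial in \<open>r s\<close> regardless of the costs. The cycles are found
  by a Bellman-Ford recursion from each row. All flows are integer combinations of products of two
  marginals and lie in \<open>[0, 1]\<close> between cancellations, and all other numbers are short sums of costs, possibly
  divided by a walk length, whence the bound on the encoding lengths.\<close>

section \<open>Cancelling minimum mean cycles\<close>

text \<open>Cells have no upper bound and all masses are positive, so every row-to-column edge is
  residual and every row and column carries flow. Hence any walk returns to its start row within one
  further pair of edges, which keeps all distances finite. Walks are counted in pairs of edges,
  whence means \<open>- 2 * \<epsilon>\<close> and simple cycles of at most \<open>r\<close> pairs.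

  The factor \<open>1 - 1 / (2 * r)\<close>: a cycle with an edge of nonnegative reduced cost loses
  one of the up to \<open>2 * r\<close> summands \<open>\<epsilon>\<close> of its weight. The factor
  \<open>4 * r + 1\<close>: among \<open>r\<close> row potentials there is a gap of width
  \<open>4 * \<epsilon>\<close> within a range of \<open>4 * r * \<epsilon>\<close>, and a used cell
  accounts for one more \<open>\<epsilon>\<close>.

  Running time and encoding length are two claims about the same run, one for arbitrary reals and
  one for rationals. Both come from a single correctness proof over an abstract ring
  \<open>Z\<close> of scaled numbers, instantiated once with all reals and once with the
  integers.\<close>

locale transport =
  fixes r s :: nat and t :: "nat \<Rightarrow> nat \<Rightarrow> real" and a e :: "nat \<Rightarrow> real"
  assumes a_pos: "k < r \<Longrightarrow> 0 < a k" and e_pos: "l < s \<Longrightarrow> 0 < e l"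
    and r_pos: "0 < r"
begin

section \<open>Feasible flows, residual walks and weak duality for potentials\<close>

definition feas :: "(nat \<Rightarrow> nat \<Rightarrow> real) \<Rightarrow> bool" where
  "feas q \<longleftrightarrow> (\<forall>k<r. \<forall>l<s. 0 \<le> q k l) \<and> (\<forall>k<r. (\<Sum>l<s. q k l) = a k) \<and> (\<forall>l<s. (\<Sum>k<r. q k l) = e l)"

text \<open>Step \<open>n\<close> of a walk follows the residual edge from row \<open>f n\<close> to column \<open>g n\<close>, which always exists,
  and then the edge from that column to row \<open>f (n + 1)\<close>, which requires positive flow.\<close>

definition walk :: "(nat \<Rightarrow> nat \<Rightarrow> real) \<Rightarrow> (nat \<Rightarrow> nat) \<Rightarrow> (nat \<Rightarrow> nat) \<Rightarrow> nat \<Rightarrow> bool" where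
  "walk q f g p \<longleftrightarrow> (\<forall>n\<le>p. f n < r) \<and> (\<forall>n<p. g n < s \<and> 0 < q (f (Suc n)) (g n))"

definition weight :: "(nat \<Rightarrow> nat) \<Rightarrow> (nat \<Rightarrow> nat) \<Rightarrow> nat \<Rightarrow> real" where
  "weight f g p = (\<Sum>n<p. t (f n) (g n) - t (f (Suc n)) (g n))"

text \<open>\<open>\<epsilon>\<close>-optimality in the sense of Goldberg and Tarjan.\<close>

definition near_opt :: "(nat \<Rightarrow> nat \<Rightarrow> real) \<Rightarrow> real \<Rightarrow> (nat \<Rightarrow> real) \<Rightarrow> (nat \<Rightarrow> real) \<Rightarrow> bool" where
  "near_opt q \<epsilon> u v \<longleftrightarrow> (\<forall>k<r. \<forall>l<s. - \<epsilon> \<le> t k l - u k - v l \<and> (0 < q k l \<longrightarrow> t k l - u k - v l \<le> \<epsilon>))"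

lemma near_opt_mono: "near_opt q \<epsilon> u v \<Longrightarrow> \<epsilon> \<le> \<delta> \<Longrightarrow> near_opt q \<delta> u v"
  unfolding near_opt_def by (smt (verit))

lemma row_support: "feas q \<Longrightarrow> k < r \<Longrightarrow> \<exists>l<s. 0 < q k l"
proof (rule ccontr)
  assume *: "feas q" "k < r" and "\<not> (\<exists>l<s. 0 < q k l)"
  then have "(\<Sum>l<s. q k l) \<le> 0" by (intro sum_nonpos) (metis lessThan_iff not_less)
  with * a_pos[of k] show False by (auto simp: feas_def)
qed

lemma col_support: "feas q \<Longrightarrow> l < s \<Longrightarrow> \<exists>k<r. 0 < q k l"
proof (rule ccontr)
  assume *: "feas q" "l < s" and "\<not> (\<exists>k<r. 0 < q k l)"
  then have "(\<Sum>k<r. q k l) \<le> 0" by (intro sum_nonpos) (metis lessThan_iff not_less)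
  with * e_pos[of l] show False by (auto simp: feas_def)
qed

text \<open>Row potentials telescope along a closed walk and column potentials cancel within each
  pair, so weights may be computed from reduced costs.\<close>

lemma weight_reduced:
  assumes "f p = f 0"
  shows "weight f g p = (\<Sum>n<p. (t (f n) (g n) - u (f n) - v (g n)) - (t (f (Suc n)) (g n) - u (f (Suc n)) - v (g n)))"
proof -
  have "(\<Sum>n<p. u (f (Suc n)) - u (f n)) = 0"
    by (subst sum_lessThan_telescope) (simp add: assms)
  then have "weight f g p = weight f g p - (\<Sum>n<p. u (f n) - u (f (Suc n)))"
    by (simp add: sum_subtractf)
  also have "\<dots> = (\<Sum>n<p. (t (f n) (g n) - u (f n) - v (g n)) - (t (f (Suc n)) (g n) - u (f (Suc n)) - v (g n)))"
    unfolding weight_def sum_subtractf[symmetric] by (rule sum.cong) auto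
  finally show ?thesis .
qed

text \<open>Weak duality: each pair of residual edges has reduced weight at least
  \<open>- 2 * \<epsilon>\<close>, so potentials certify a lower bound on all cycle means.\<close>

lemma near_opt_weight:
  assumes n: "near_opt q \<epsilon> u v" and w: "walk q f g p" "f p = f 0"
  shows "- 2 * \<epsilon> * p \<le> weight f g p"
proof -
  have "- \<epsilon> - \<epsilon> \<le> (t (f n) (g n) - u (f n) - v (g n)) - (t (f (Suc n)) (g n) - u (f (Suc n)) - v (g n))" if "n < p" for n
  proof -
    have "f n < r" "f (Suc n) < r" "g n < s" "0 < q (f (Suc n)) (g n)" using w that unfolding walk_def by auto
    then show ?thesis using n unfolding near_opt_def by (smt (verit))
  qed
  then have "(\<Sum>n<p. - \<epsilon> - \<epsilon>) \<le> weight f g p"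
    unfolding weight_reduced[OF w(2), of g u v] by (intro sum_mono) auto
  then show ?thesis by (simp add: algebra_simps)
qed

section \<open>Decomposition of closed walks and existence of potentials\<close>

lemma walk_split:
  assumes w: "walk q f g p" and ab: "b < c" "c \<le> p" "f b = f c"
  defines "f' \<equiv> \<lambda>n. if n < b then f n else f (n + (c - b))"
    and "g' \<equiv> \<lambda>n. if n < b then g n else g (n + (c - b))"
  shows "walk q f' g' (p - (c - b))" "walk q (\<lambda>n. f (b + n)) (\<lambda>n. g (b + n)) (c - b)"
    "weight f g p = weight f' g' (p - (c - b)) + weight (\<lambda>n. f (b + n)) (\<lambda>n. g (b + n)) (c - b)"
    "f' 0 = f 0" "f' (p - (c - b)) = f p"
proof -
  \<comment> \<open>At the seam \<open>Suc n = b\<close> the two branches of \<open>f'\<close> meet;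
    they agree because \<open>f b = f c\<close>.\<close>
  have f'S: "f' (Suc n) = (if n < b then f (Suc n) else f (Suc n + (c - b)))" for n
  proof (cases "Suc n = b")
    case True
    then have "f (Suc n + (c - b)) = f b" using ab by simp
    then show ?thesis using True by (simp add: f'_def)
  qed (auto simp: f'_def)
  show "walk q f' g' (p - (c - b))"
    unfolding walk_def
  proof safe
    fix n assume "n \<le> p - (c - b)"
    then show "f' n < r" using w ab by (auto simp: walk_def f'_def)
  next
    fix n assume "n < p - (c - b)"
    then show "g' n < s" "0 < q (f' (Suc n)) (g' n)" using w ab unfolding f'S by (auto simp: walk_def g'_def)
  qed
  show "walk q (\<lambda>n. f (b + n)) (\<lambda>n. g (b + n)) (c - b)"
    using w ab by (auto simp: walk_def)
  let ?h = "\<lambda>n. t (f n) (g n) - t (f (Suc n)) (g n)"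
  let ?h' = "\<lambda>n. t (f' n) (g' n) - t (f' (Suc n)) (g' n)"
  have 1: "weight f g p = sum ?h {0..<b} + sum ?h {b..<c} + sum ?h {c..<p}"
    unfolding weight_def lessThan_atLeast0 using ab by (simp add: sum.atLeastLessThan_concat)
  have 2: "weight f' g' (p - (c - b)) = sum ?h' {0..<b} + sum ?h' {b..<p - (c - b)}"
    unfolding weight_def lessThan_atLeast0 using ab by (simp add: sum.atLeastLessThan_concat)
  have 3: "sum ?h' {0..<b} = sum ?h {0..<b}"
    unfolding f'S by (rule sum.cong) (auto simp: f'_def g'_def)
  have 4: "sum ?h' {b..<p - (c - b)} = sum ?h {c..<p}"
  proof -
    have "sum ?h' {b..<p - (c - b)} = sum (\<lambda>n. ?h (n + (c - b))) {b..<p - (c - b)}"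
      unfolding f'S by (rule sum.cong) (auto simp: f'_def g'_def)
    also have "\<dots> = sum ?h {b + (c - b)..<p - (c - b) + (c - b)}"
      by (rule sum.shift_bounds_nat_ivl[symmetric])
    finally show ?thesis using ab by simp
  qed
  have 5: "sum ?h {b..<c} = weight (\<lambda>n. f (b + n)) (\<lambda>n. g (b + n)) (c - b)"
    unfolding weight_def lessThan_atLeast0
    using sum.shift_bounds_nat_ivl[of ?h 0 b "c - b"] ab by (simp add: add.commute)
  show "weight f g p = weight f' g' (p - (c - b)) + weight (\<lambda>n. f (b + n)) (\<lambda>n. g (b + n)) (c - b)"
    unfolding 1 2 3 4 5[symmetric] by simp
  show "f' 0 = f 0" using ab by (auto simp: f'_def)
  show "f' (p - (c - b)) = f p" using ab by (auto simp: f'_def)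
qed

text \<open>More than \<open>r\<close> steps repeat a row, and cutting there leaves two strictly
  shorter closed walks whose lengths and weights add up.\<close>

lemma closed_walk_weight_ge:
  assumes short: "\<And>f g p. 0 < p \<Longrightarrow> p \<le> r \<Longrightarrow> walk q f g p \<Longrightarrow> f p = f 0 \<Longrightarrow> \<mu> * p \<le> weight f g p"
  shows "walk q f g p \<Longrightarrow> f p = f 0 \<Longrightarrow> \<mu> * p \<le> weight f g p"
proof (induction p arbitrary: f g rule: less_induct)
  case (less p)
  consider "p = 0" | "0 < p" "p \<le> r" | "r < p" by linarith
  then show ?case
  proof cases
    case 1 then show ?thesis by (simp add: weight_def)
  next
    case 2 then show ?thesis using short less.prems by blast
  next
    case 3
    have "f ` {..<p} \<subseteq> {..<r}" using less.prems by (auto simp: walk_def)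
    then have "\<not> inj_on f {..<p}" using 3
      by (metis card_inj_on_le card_lessThan finite_lessThan not_le)
    then obtain b c where bc: "b < c" "c < p" "f b = f c"
      unfolding inj_on_def by (metis lessThan_iff linorder_neqE_nat)
    note sp = walk_split[OF less.prems(1) bc(1) less_imp_le[OF bc(2)] bc(3)]
    have 1: "\<mu> * real (p - (c - b)) \<le> weight (\<lambda>n. if n < b then f n else f (n + (c - b)))
      (\<lambda>n. if n < b then g n else g (n + (c - b))) (p - (c - b))"
      by (rule less.IH[OF _ sp(1)]) (use bc less.prems in auto)
    have 2: "\<mu> * real (c - b) \<le> weight (\<lambda>n. f (b + n)) (\<lambda>n. g (b + n)) (c - b)"
      by (rule less.IH[OF _ sp(2)]) (use bc in auto)
    have "\<mu> * p = \<mu> * real (p - (c - b)) + \<mu> * real (c - b)"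
      using bc by (simp add: of_nat_diff algebra_simps)
    also have "\<dots> \<le> weight f g p" unfolding sp(3) by (intro add_mono 1 2)
    finally show ?thesis .
  qed
qed

text \<open>Converse of weak duality. Adding \<open>2 * \<epsilon>\<close> to each pair removes the
  negative cycles, so shortest distances \<open>D\<close> from row 0 exist and \<open>- D\<close>
  serves as row potential. Taking infima over walks of any length avoids restricting to simple
  walks.\<close>

lemma near_opt_exists:
  assumes q: "feas q"
    and short: "\<And>f g p. 0 < p \<Longrightarrow> p \<le> r \<Longrightarrow> walk q f g p \<Longrightarrow> f p = f 0 \<Longrightarrow> - 2 * \<epsilon> * p \<le> weight f g p"
  shows "\<exists>u v. near_opt q \<epsilon> u v"
proof -
  have long: "- 2 * \<epsilon> * real p \<le> weight f g p" if w: "walk q f g p" and c: "f p = f 0" for f g p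
  proof (rule closed_walk_weight_ge[OF _ w c, of "- 2 * \<epsilon>"])
    fix f g p assume "0 < p" "p \<le> r" "walk q f g p" "f p = f 0"
    then show "- 2 * \<epsilon> * real p \<le> weight f g p" by (rule short)
  qed
  define X where "X j = {weight f g p + 2 * \<epsilon> * p | f g p. walk q f g p \<and> f 0 = 0 \<and> f p = j}" for j
  define D where "D j = Inf (X j)" for j
  have ext: "x + (t j l - t j' l + 2 * \<epsilon>) \<in> X j'" if "x \<in> X j" "j < r" "j' < r" "l < s" "0 < q j' l" for x j j' l
  proof -
    obtain f g p where x: "x = weight f g p + 2 * \<epsilon> * p" "walk q f g p" "f 0 = 0" "f p = j"
      using \<open>x \<in> X j\<close> unfolding X_def by blast
    let ?f = "f(Suc p := j')" and ?g = "g(p := l)"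
    have "walk q ?f ?g (Suc p)"
      unfolding walk_def
    proof safe
      fix n assume "n \<le> Suc p" then show "?f n < r" using x that by (cases "n = Suc p") (auto simp: walk_def)
    next
      fix n assume "n < Suc p"
      then show "?g n < s" "0 < q (?f (Suc n)) (?g n)" using x that by (cases "n = p"; auto simp: walk_def)+
    qed
    moreover have "weight ?f ?g (Suc p) = weight f g p + (t j l - t j' l)"
    proof -
      have "(\<Sum>n<p. t (?f n) (?g n) - t (?f (Suc n)) (?g n)) = weight f g p"
        unfolding weight_def by (rule sum.cong) auto
      then show ?thesis unfolding weight_def[of ?f] using x by simp
    qed
    ultimately have "weight ?f ?g (Suc p) + 2 * \<epsilon> * Suc p \<in> X j'" unfolding X_def using x(3) by fastforce
    then show ?thesis using \<open>weight ?f ?g (Suc p) = _\<close> x(1) by (simp add: algebra_simps)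
  qed
  have X0: "0 \<in> X 0" unfolding X_def
    by (intro CollectI exI[of _ "\<lambda>_. 0"] exI[of _ 0]) (auto simp: walk_def weight_def r_pos)
  have ne: "X j \<noteq> {}" if j: "j < r" for j
  proof -
    obtain l where l: "l < s" "0 < q j l" using row_support[OF q j] by auto
    show ?thesis using ext[OF X0 r_pos j l] by auto
  qed
  \<comment> \<open>A column used by row 0. Every row has an edge to it, so it closes any walk back
    to row 0, which bounds the distances from below.\<close>
  obtain l0 where l0: "l0 < s" "0 < q 0 l0" using row_support[OF q r_pos] by blast
  have closed0: "0 \<le> x" if x: "x \<in> X 0" for x
  proof -
    obtain f g p where "x = weight f g p + 2 * \<epsilon> * p" "walk q f g p" "f 0 = 0" "f p = 0"
      using x unfolding X_def by blast
    with long[of f g p] show ?thesis by linarith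
  qed
  have bdd: "bdd_below (X j)" if "j < r" for j
  proof (rule bdd_belowI)
    fix x assume "x \<in> X j"
    from closed0[OF ext[OF this that r_pos l0]]
    show "- (t j l0 - t 0 l0 + 2 * \<epsilon>) \<le> x" by linarith
  qed
  have tri: "D j' \<le> D j + (t j l - t j' l + 2 * \<epsilon>)" if "j < r" "j' < r" "l < s" "0 < q j' l" for j j' l
  proof -
    have "D j' - (t j l - t j' l + 2 * \<epsilon>) \<le> x" if "x \<in> X j" for x
      using cInf_lower[OF ext[OF that \<open>j < r\<close> \<open>j' < r\<close> \<open>l < s\<close> \<open>0 < q j' l\<close>] bdd[OF \<open>j' < r\<close>]]
      by (simp add: D_def)
    then have "D j' - (t j l - t j' l + 2 * \<epsilon>) \<le> D j"
      unfolding D_def[of j] using ne[OF \<open>j < r\<close>] by (intro cInf_greatest)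
    then show ?thesis by linarith
  qed
  \<comment> \<open>The least column potential for which all used cells of column \<open>l\<close>
    have reduced cost at most \<open>\<epsilon>\<close>. It is attained at a used cell, and the
    triangle inequality towards that row yields the lower bound \<open>- \<epsilon>\<close>.\<close>
  define v where "v l = Max ((\<lambda>k. t k l + D k - \<epsilon>) ` {k. k < r \<and> 0 < q k l})" for l
  have fin: "finite ((\<lambda>k. t k l + D k - \<epsilon>) ` {k. k < r \<and> 0 < q k l})" for l by auto
  have "near_opt q \<epsilon> (\<lambda>k. - D k) v"
    unfolding near_opt_def
  proof (intro allI impI conjI)
    fix k l assume kl: "k < r" "l < s"
    have "v l \<in> (\<lambda>k. t k l + D k - \<epsilon>) ` {k. k < r \<and> 0 < q k l}"
      unfolding v_def by (rule Max_in) (use col_support[OF q kl(2)] in auto)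
    then obtain k' where "k' < r" "0 < q k' l" "v l = t k' l + D k' - \<epsilon>" by auto
    then show "- \<epsilon> \<le> t k l - - D k - v l" using tri[of k k' l] kl by auto
    assume "0 < q k l"
    then have "t k l + D k - \<epsilon> \<le> v l" unfolding v_def by (intro Max_ge) (use kl in auto)
    then show "t k l - - D k - v l \<le> \<epsilon>" by linarith
  qed
  then show ?thesis by blast
qed

section \<open>Effect of cancelling a single minimum mean cycle\<close>

definition push :: "(nat \<Rightarrow> nat \<Rightarrow> real) \<Rightarrow> (nat \<Rightarrow> nat) \<Rightarrow> (nat \<Rightarrow> nat) \<Rightarrow> real \<Rightarrow> nat \<Rightarrow> nat \<Rightarrow> nat \<Rightarrow> real" where
  "push q f g \<theta> m k l = q k l + \<theta> * (\<Sum>n<m. of_bool (f n = k \<and> g n = l) - of_bool (f (Suc n) = k \<and> g n = l))"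

definition bottleneck :: "(nat \<Rightarrow> nat \<Rightarrow> real) \<Rightarrow> (nat \<Rightarrow> nat) \<Rightarrow> (nat \<Rightarrow> nat) \<Rightarrow> nat \<Rightarrow> real" where
  "bottleneck q f g p = Min ((\<lambda>n. q (f (Suc n)) (g n)) ` {..<p})"

text \<open>Minimality is expressed by a certificate: by \<open>near_opt_weight\<close>, potentials
  for \<open>\<epsilon>\<close> exclude closed walks of mean below
  \<open>- 2 * \<epsilon>\<close>.\<close>

definition min_mean_cycle :: "(nat \<Rightarrow> nat \<Rightarrow> real) \<Rightarrow> real \<Rightarrow> (nat \<Rightarrow> nat) \<Rightarrow> (nat \<Rightarrow> nat) \<Rightarrow> nat \<Rightarrow> bool" where
  "min_mean_cycle q \<epsilon> f g p \<longleftrightarrow> 0 < p \<and> 0 < \<epsilon> \<and> walk q f g p \<and> f p = f 0 \<and> inj_on f {..<p} \<and>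
     weight f g p = - 2 * \<epsilon> * p \<and> (\<exists>u v. near_opt q \<epsilon> u v)"

text \<open>\<open>q'\<close> is prescribed on the grid of cells only, since a flow read off from
  memory is arbitrary outside it.\<close>

definition cancels :: "(nat \<Rightarrow> nat \<Rightarrow> real) \<Rightarrow> real \<Rightarrow> (nat \<Rightarrow> nat \<Rightarrow> real) \<Rightarrow> bool" where
  "cancels q \<epsilon> q' \<longleftrightarrow> (\<exists>f g p. min_mean_cycle q \<epsilon> f g p \<and>
     (\<forall>k<r. \<forall>l<s. q' k l = push q f g (bottleneck q f g p) p k l))"

text \<open>Each pair has reduced weight at least \<open>- 2 * \<epsilon>\<close> and the total
  attains this bound, so every pair, and then each of its two edges, is tight.\<close>

lemma tight_cycle:
  assumes c: "min_mean_cycle q \<epsilon> f g p" and n: "near_opt q \<epsilon> u v" and "i < p"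
  shows "t (f i) (g i) - u (f i) - v (g i) = - \<epsilon>"
    "t (f (Suc i)) (g i) - u (f (Suc i)) - v (g i) = \<epsilon>"
proof -
  let ?A = "\<lambda>n. t (f n) (g n) - u (f n) - v (g n)"
  let ?B = "\<lambda>n. t (f (Suc n)) (g n) - u (f (Suc n)) - v (g n)"
  have AB: "- \<epsilon> \<le> ?A n" "?B n \<le> \<epsilon>" if "n < p" for n
  proof -
    have "f n < r" "f (Suc n) < r" "g n < s" "0 < q (f (Suc n)) (g n)" using c that unfolding walk_def min_mean_cycle_def by auto
    then show "- \<epsilon> \<le> ?A n" "?B n \<le> \<epsilon>" using n unfolding near_opt_def by blast+
  qed
  have "(\<Sum>n<p. ?A n - ?B n) = - 2 * \<epsilon> * p"
    using c weight_reduced[of f p g u v] by (auto simp: min_mean_cycle_def)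
  then have "(\<Sum>n<p. ?A n - ?B n + 2 * \<epsilon>) = 0"
    by (simp add: sum.distrib)
  moreover have "\<And>n. n \<in> {..<p} \<Longrightarrow> 0 \<le> ?A n - ?B n + 2 * \<epsilon>" using AB by (smt (verit) lessThan_iff)
  ultimately have "?A i - ?B i + 2 * \<epsilon> = 0"
    using \<open>i < p\<close> by (subst (asm) sum_nonneg_eq_0_iff) auto
  with AB[OF \<open>i < p\<close>] show "?A i = - \<epsilon>" "?B i = \<epsilon>" by linarith+
qed

lemma of_bool_sum_zero: "(\<And>n. n < p \<Longrightarrow> \<not> P n) \<Longrightarrow> (\<Sum>n<p. of_bool (P n)) = (0::real)"
  by simp

lemma inj_shift:
  assumes "inj_on f {..<p}" "f p = f 0"
  shows "inj_on (\<lambda>n. f (Suc n)) {..<p}"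
proof (rule linorder_inj_onI')
  fix i j assume *: "i \<in> {..<p}" "j \<in> {..<p}" "i < j"
  show "f (Suc i) \<noteq> f (Suc j)"
  proof (cases "Suc j = p")
    case True
    then show ?thesis using assms * by (auto simp: inj_on_def)
  next
    case False
    then have "Suc i \<in> {..<p}" "Suc j \<in> {..<p}" "Suc i \<noteq> Suc j" using * by auto
    then show ?thesis using assms(1) by (meson inj_onD)
  qed
qed

text \<open>Tight reduced costs keep forward and backward cells apart, so every backward cell loses
  exactly \<open>\<theta>\<close> and the bottleneck cell is emptied.\<close>

lemma min_mean_cycle_push:
  assumes c: "min_mean_cycle q \<epsilon> f g p" and q: "feas q"
    and q': "\<forall>k<r. \<forall>l<s. q' k l = push q f g \<theta> p k l" and \<theta>: "\<theta> = bottleneck q f g p"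
  shows "0 < \<theta>" "\<exists>n<p. q' (f (Suc n)) (g n) = 0"
    "\<And>k l. k < r \<Longrightarrow> l < s \<Longrightarrow> q k l < q' k l \<Longrightarrow> \<exists>n<p. f n = k \<and> g n = l"
    "feas q'"
proof -
  have w: "walk q f g p" "f p = f 0" "inj_on f {..<p}" "0 < p" "0 < \<epsilon>" using c by (auto simp: min_mean_cycle_def)
  obtain u v where n: "near_opt q \<epsilon> u v" using c by (auto simp: min_mean_cycle_def)
  \<comment> \<open>A common cell would have reduced cost both \<open>- \<epsilon>\<close> and
    \<open>\<epsilon>\<close>.\<close>
  have disj: "\<not> (f m = f (Suc n) \<and> g m = g n)" if "m < p" "n < p" for m n
    using tight_cycle(1)[OF c n that(1)] tight_cycle(2)[OF c n that(2)] w(5) by auto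
  have inj: "inj_on (\<lambda>n. f (Suc n)) {..<p}" by (rule inj_shift[OF w(3,2)])
  let ?F = "\<lambda>k l. (\<Sum>n<p. of_bool (f n = k \<and> g n = l)) :: real"
  let ?B = "\<lambda>k l. (\<Sum>n<p. of_bool (f (Suc n) = k \<and> g n = l)) :: real"
  have push: "q' k l = q k l + \<theta> * (?F k l - ?B k l)" if "k < r" "l < s" for k l
    using q' that by (simp add: push_def sum_subtractf)
  have "\<theta> \<in> (\<lambda>n. q (f (Suc n)) (g n)) ` {..<p}"
    unfolding \<theta> bottleneck_def by (rule Min_in) (use w in auto)
  then obtain m where m: "m < p" "\<theta> = q (f (Suc m)) (g m)" by auto
  have rs: "f n < r" "f (Suc n) < r" "g n < s" if "n < p" for n using w(1) that by (auto simp: walk_def)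
  show th0: "0 < \<theta>" using m w(1) by (auto simp: walk_def)
  have th_le: "\<theta> \<le> q (f (Suc n)) (g n)" if "n < p" for n
    unfolding \<theta> bottleneck_def by (rule Min_le) (use that in auto)
  have B1: "?B (f (Suc n)) (g n) = 1" if "n < p" for n
  proof -
    have "?B (f (Suc n)) (g n) = (\<Sum>n'<p. if n' = n then 1 else 0)"
      by (rule sum.cong) (use inj that in \<open>auto simp: inj_on_def\<close>)
    then show ?thesis using that by simp
  qed
  have F0: "?F (f (Suc n)) (g n) = 0" if "n < p" for n
    by (rule of_bool_sum_zero) (use disj that in auto)
  have bwd: "q' (f (Suc n)) (g n) = q (f (Suc n)) (g n) - \<theta>" if "n < p" for n
    using push[OF rs(2)[OF that] rs(3)[OF that]] B1[OF that] F0[OF that] by simp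
  then show "\<exists>n<p. q' (f (Suc n)) (g n) = 0" using m by auto
  show "\<exists>n<p. f n = k \<and> g n = l" if "k < r" "l < s" "q k l < q' k l" for k l
  proof (rule ccontr)
    assume "\<not> ?thesis"
    then have "?F k l = 0" by (intro of_bool_sum_zero) auto
    moreover have "0 \<le> ?B k l" by (intro sum_nonneg) auto
    ultimately show False using push[OF that(1,2)] th0 that(3) by (simp add: mult_less_0_iff)
  qed
  have "0 \<le> q' k l" if "k < r" "l < s" for k l
  proof (cases "\<exists>n<p. f (Suc n) = k \<and> g n = l")
    case True then show ?thesis using bwd th_le by auto
  next
    case False
    then have "?B k l = 0" by (intro of_bool_sum_zero) auto
    moreover have "0 \<le> ?F k l" by (intro sum_nonneg) auto
    ultimately show ?thesis using push[OF that] th0 q that by (auto simp: feas_def)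
  qed
  moreover have "(\<Sum>l<s. q' k l) = a k" if "k < r" for k
  proof -
    have "(\<Sum>l<s. q' k l) = (\<Sum>l<s. q k l) + \<theta> * (\<Sum>l<s. \<Sum>n<p. of_bool (f n = k \<and> g n = l) - of_bool (f (Suc n) = k \<and> g n = l))"
      using q' that by (simp add: push_def sum.distrib sum_distrib_left)
    also have "(\<Sum>l<s. \<Sum>n<p. of_bool (f n = k \<and> g n = l) - of_bool (f (Suc n) = k \<and> g n = l) :: real)
       = (\<Sum>n<p. \<Sum>l<s. of_bool (f n = k \<and> g n = l) - of_bool (f (Suc n) = k \<and> g n = l))"
      by (rule sum.swap)
    \<comment> \<open>In a fixed row the steps contribute departures minus arrivals, which telescope
      over a closed walk.\<close>
    also have "\<dots> = (\<Sum>n<p. of_bool (f n = k) - of_bool (f (Suc n) = k))"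
    proof (rule sum.cong[OF refl])
      fix n assume "n \<in> {..<p}"
      then have "g n < s" using rs by auto
      have "(\<Sum>l<s. of_bool (f n = k \<and> g n = l) - of_bool (f (Suc n) = k \<and> g n = l) :: real)
          = (\<Sum>l<s. if g n = l then of_bool (f n = k) - of_bool (f (Suc n) = k) else 0)"
        by (rule sum.cong) auto
      then show "(\<Sum>l<s. of_bool (f n = k \<and> g n = l) - of_bool (f (Suc n) = k \<and> g n = l) :: real) = of_bool (f n = k) - of_bool (f (Suc n) = k)"
        using \<open>g n < s\<close> by simp
    qed
    also have "\<dots> = 0" using w(2) sum_lessThan_telescope'[of "\<lambda>n. of_bool (f n = k) :: real" p] by simp
    finally show ?thesis using q that by (simp add: feas_def)
  qed
  moreover have "(\<Sum>k<r. q' k l) = e l" if "l < s" for l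
  proof -
    have "(\<Sum>k<r. q' k l) = (\<Sum>k<r. q k l) + \<theta> * (\<Sum>k<r. \<Sum>n<p. of_bool (f n = k \<and> g n = l) - of_bool (f (Suc n) = k \<and> g n = l))"
      using q' that by (simp add: push_def sum.distrib sum_distrib_left)
    also have "(\<Sum>k<r. \<Sum>n<p. of_bool (f n = k \<and> g n = l) - of_bool (f (Suc n) = k \<and> g n = l) :: real)
       = (\<Sum>n<p. \<Sum>k<r. of_bool (f n = k \<and> g n = l) - of_bool (f (Suc n) = k \<and> g n = l))"
      by (rule sum.swap)
    \<comment> \<open>In a fixed column each step adds and removes the same amount.\<close>
    also have "\<dots> = (\<Sum>n<p. 0)"
    proof (rule sum.cong[OF refl])
      fix n assume "n \<in> {..<p}"
      then have "f n < r" "f (Suc n) < r" using rs by auto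
      have "(\<Sum>k<r. of_bool (f n = k \<and> g n = l) - of_bool (f (Suc n) = k \<and> g n = l) :: real)
          = (\<Sum>k<r. if f n = k then of_bool (g n = l) else 0) - (\<Sum>k<r. if f (Suc n) = k then of_bool (g n = l) else 0)"
        unfolding sum_subtractf by (intro arg_cong2[where f = "(-)"] sum.cong) auto
      then show "(\<Sum>k<r. of_bool (f n = k \<and> g n = l) - of_bool (f (Suc n) = k \<and> g n = l) :: real) = 0"
        using \<open>f n < r\<close> \<open>f (Suc n) < r\<close> by simp
    qed
    finally show ?thesis using q that by (simp add: feas_def)
  qed
  ultimately show "feas q'" by (auto simp: feas_def)
qed

lemma cancels_feas: "cancels q \<epsilon> q' \<Longrightarrow> feas q \<Longrightarrow> feas q'"
  unfolding cancels_def using min_mean_cycle_push(4) by blast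

text \<open>A cell that newly carries flow lies on a forward edge of the cycle and so has reduced
  cost \<open>- \<epsilon>\<close>; its new residual edge back respects the same potentials.\<close>

lemma cancels_near_opt:
  assumes "cancels q \<epsilon> q'" "feas q" "near_opt q \<epsilon> u v"
  shows "near_opt q' \<epsilon> u v"
proof -
  obtain f g p where c: "min_mean_cycle q \<epsilon> f g p"
    and q': "\<forall>k<r. \<forall>l<s. q' k l = push q f g (bottleneck q f g p) p k l"
    using assms(1) by (auto simp: cancels_def)
  have "0 < \<epsilon>" using c by (auto simp: min_mean_cycle_def)
  have "t k l - u k - v l \<le> \<epsilon>" if kl: "k < r" "l < s" and pos: "0 < q' k l" for k l
  proof (cases "0 < q k l")
    case True then show ?thesis using assms(3) kl unfolding near_opt_def by blast
  next
    case False
    then have "q k l < q' k l" using pos by linarith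
    then obtain n where "n < p" "f n = k" "g n = l"
      using min_mean_cycle_push(3)[OF c assms(2) q' refl kl] by blast
    then have "t k l - u k - v l = - \<epsilon>" using tight_cycle(1)[OF c assms(3), of n] by simp
    then show ?thesis using \<open>0 < \<epsilon>\<close> by linarith
  qed
  then show ?thesis using assms(3) unfolding near_opt_def by blast
qed

text \<open>Weak duality for the cancelled cycle. Together with \<open>cancels_near_opt\<close> it
  makes the successive values of \<open>\<epsilon>\<close> nonincreasing.\<close>

lemma cancels_eps_le:
  assumes "cancels q \<epsilon> q'" "near_opt q \<delta> u v"
  shows "\<epsilon> \<le> \<delta>"
proof -
  obtain f g p where c: "min_mean_cycle q \<epsilon> f g p" using assms(1) by (auto simp: cancels_def)
  then have "- 2 * \<delta> * p \<le> - 2 * \<epsilon> * p"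
    using near_opt_weight[OF assms(2), of f g p] by (auto simp: min_mean_cycle_def)
  then show ?thesis using c by (simp add: min_mean_cycle_def)
qed

text \<open>The cells whose backward residual edge has negative reduced cost.\<close>

definition violating :: "(nat \<Rightarrow> nat \<Rightarrow> real) \<Rightarrow> (nat \<Rightarrow> real) \<Rightarrow> (nat \<Rightarrow> real) \<Rightarrow> (nat \<times> nat) set" where
  "violating q u v = {(k, l). k < r \<and> l < s \<and> 0 < q k l \<and> 0 < t k l - u k - v l}"

text \<open>If all edges of the cycle have negative reduced cost, cancelling empties a violating
  cell and creates no new one. Otherwise one of the \<open>p\<close> pairs weighs at least
  \<open>- \<delta>\<close> instead of \<open>- 2 * \<delta>\<close>, so
  \<open>2 * \<epsilon> * p \<le> (2 * p - 1) * \<delta>\<close>, and a simple cycle has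
  \<open>p \<le> r\<close>.\<close>

lemma cancels_progress:
  assumes "cancels q \<epsilon> q'" "feas q" and n: "near_opt q \<delta> u v"
  shows "\<epsilon> \<le> (1 - 1 / (2 * r)) * \<delta> \<or> near_opt q' \<delta> u v \<and> violating q' u v \<subset> violating q u v"
proof -
  obtain f g p where c: "min_mean_cycle q \<epsilon> f g p"
    and q': "\<forall>k<r. \<forall>l<s. q' k l = push q f g (bottleneck q f g p) p k l"
    using assms(1) by (auto simp: cancels_def)
  have \<epsilon>: "0 < \<epsilon>" "0 < p" "f p = f 0" and w: "walk q f g p" using c by (auto simp: min_mean_cycle_def)
  have \<delta>: "0 < \<delta>" using cancels_eps_le[OF assms(1) n] \<epsilon> by linarith
  have pr: "p \<le> r"
  proof -
    have "f ` {..<p} \<subseteq> {..<r}" "inj_on f {..<p}" using c by (auto simp: walk_def min_mean_cycle_def)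
    then show ?thesis by (metis card_inj_on_le card_lessThan finite_lessThan)
  qed
  let ?A = "\<lambda>n. t (f n) (g n) - u (f n) - v (g n)"
  let ?B = "\<lambda>n. t (f (Suc n)) (g n) - u (f (Suc n)) - v (g n)"
  have rs: "f n < r" "f (Suc n) < r" "g n < s" "0 < q (f (Suc n)) (g n)" if "n < p" for n
    using w that by (auto simp: walk_def)
  have AB: "- \<delta> \<le> ?A n" "?B n \<le> \<delta>" if "n < p" for n
    using n rs[OF that] unfolding near_opt_def by blast+
  note P = min_mean_cycle_push[OF c assms(2) q' refl]
  show ?thesis
  proof (cases "\<forall>n<p. ?A n < 0 \<and> 0 < ?B n")
    case True
    have "near_opt q' \<delta> u v"
      unfolding near_opt_def
    proof (intro allI impI conjI)
      fix k l assume kl: "k < r" "l < s"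
      then show "- \<delta> \<le> t k l - u k - v l" using n by (auto simp: near_opt_def)
      assume "0 < q' k l"
      show "t k l - u k - v l \<le> \<delta>"
      proof (cases "0 < q k l")
        case True then show ?thesis using n kl by (auto simp: near_opt_def)
      next
        case False
        then obtain m where "m < p" "f m = k" "g m = l" using P(3)[OF kl] \<open>0 < q' k l\<close> by auto
        then have "t k l - u k - v l < 0" using True by blast
        then show ?thesis using \<delta> by linarith
      qed
    qed
    moreover have "violating q' u v \<subseteq> violating q u v"
    proof
      fix x assume "x \<in> violating q' u v"
      then obtain k l where x: "x = (k, l)" "k < r" "l < s" "0 < q' k l" "0 < t k l - u k - v l"
        by (auto simp: violating_def)
      have "\<not> (\<exists>n<p. f n = k \<and> g n = l)" using True x(5) by (metis not_less_iff_gr_or_eq)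
      then have "\<not> q k l < q' k l" using P(3) x by blast
      then show "x \<in> violating q u v" using x by (auto simp: violating_def)
    qed
    moreover obtain m where m: "m < p" "q' (f (Suc m)) (g m) = 0" using P(2) by auto
    then have "(f (Suc m), g m) \<in> violating q u v - violating q' u v"
      using True rs[OF m(1)] by (auto simp: violating_def)
    ultimately show ?thesis by blast
  next
    case False
    then obtain m where m: "m < p" "0 \<le> ?A m \<or> ?B m \<le> 0" by (auto simp: not_less)
    then have "- \<delta> \<le> ?A m - ?B m" using AB[OF m(1)] \<delta> by linarith
    moreover have "(\<Sum>n\<in>{..<p}-{m}. - 2 * \<delta>) \<le> (\<Sum>n\<in>{..<p}-{m}. ?A n - ?B n)"
    proof (rule sum_mono)
      fix n assume "n \<in> {..<p} - {m}"
      then show "- 2 * \<delta> \<le> ?A n - ?B n" using AB[of n] by auto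
    qed
    moreover have "weight f g p = (?A m - ?B m) + (\<Sum>n\<in>{..<p}-{m}. ?A n - ?B n)"
      unfolding weight_reduced[OF \<epsilon>(3), of g u v] using m by (intro sum.remove) auto
    ultimately have "- \<delta> - 2 * \<delta> * (p - 1) \<le> - 2 * \<epsilon> * p"
      using c m by (simp add: min_mean_cycle_def of_nat_diff Suc_leI algebra_simps)
    then have "2 * \<epsilon> * p \<le> (2 * p - 1) * \<delta>" using \<epsilon>(2) by (simp add: algebra_simps of_nat_diff)
    then have "\<epsilon> \<le> (1 - 1 / (2 * p)) * \<delta>" using \<epsilon>(2) by (simp add: field_simps)
    also have "\<dots> \<le> (1 - 1 / (2 * r)) * \<delta>"
      using \<epsilon>(2) pr \<delta> by (intro mult_right_mono) (auto simp: field_simps)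
    finally show ?thesis by blast
  qed
qed


section \<open>Cells that cannot carry flow again\<close>

lemma cut_balance:
  fixes y :: "nat \<Rightarrow> nat \<Rightarrow> real"
  assumes row: "\<And>k. k < r \<Longrightarrow> (\<Sum>l<s. y k l) = 0" and col: "\<And>l. l < s \<Longrightarrow> (\<Sum>k<r. y k l) = 0"
    and R: "R \<subseteq> {..<r}" and C: "C \<subseteq> {..<s}"
  shows "(\<Sum>k\<in>{..<r} - R. \<Sum>l\<in>C. y k l) = (\<Sum>k\<in>R. \<Sum>l\<in>{..<s} - C. y k l)"
proof -
  \<comment> \<open>The block of \<open>R\<close> and \<open>C\<close> completes either side to full
    column or row sums, all of which vanish.\<close>
  have "(\<Sum>k\<in>{..<r} - R. \<Sum>l\<in>C. y k l) + (\<Sum>k\<in>R. \<Sum>l\<in>C. y k l) = (\<Sum>k<r. \<Sum>l\<in>C. y k l)"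
    using R by (simp add: sum.subset_diff)
  also have "\<dots> = (\<Sum>l\<in>C. \<Sum>k<r. y k l)" by (rule sum.swap)
  also have "\<dots> = 0" using col C by (intro sum.neutral) auto
  finally have 1: "(\<Sum>k\<in>{..<r} - R. \<Sum>l\<in>C. y k l) + (\<Sum>k\<in>R. \<Sum>l\<in>C. y k l) = 0" .
  have "(\<Sum>k\<in>R. \<Sum>l\<in>{..<s} - C. y k l) + (\<Sum>k\<in>R. \<Sum>l\<in>C. y k l) = (\<Sum>k\<in>R. \<Sum>l<s. y k l)"
    unfolding sum.distrib[symmetric] using C by (intro sum.cong[OF refl] sum.subset_diff[symmetric]) auto
  also have "\<dots> = 0" using row R by (intro sum.neutral) auto
  finally show ?thesis using 1 by linarith
qed

text \<open>Of \<open>r\<close> consecutive intervals of length \<open>\<epsilon>\<close> above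
  \<open>\<phi> k0\<close>, the other \<open>r - 1\<close> rows can occupy at most
  \<open>r - 1\<close>.\<close>

lemma gap:
  fixes \<phi> :: "nat \<Rightarrow> real" and \<epsilon> :: real
  assumes k0: "k0 < r" and \<epsilon>: "0 < \<epsilon>"
  shows "\<exists>m<r. \<forall>k<r. \<phi> k \<le> \<phi> k0 + \<epsilon> * m \<or> \<phi> k0 + \<epsilon> * (m + 1) < \<phi> k"
proof -
  \<comment> \<open>The index of the half-open interval, closed on the right, that contains
    \<open>\<phi> k\<close>. Rows at or below \<open>\<phi> k0\<close> are sent to 0 by
    \<open>nat\<close>; this may mark an empty interval as occupied but keeps the count
    valid.\<close>
  define h where "h k = nat (\<lceil>(\<phi> k - \<phi> k0) / \<epsilon>\<rceil> - 1)" for k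
  have "card (h ` ({..<r} - {k0})) \<le> card ({..<r} - {k0})" by (rule card_image_le) simp
  also have "\<dots> < card {..<r}" using k0 by (intro psubset_card_mono) auto
  finally have "\<not> {..<r} \<subseteq> h ` ({..<r} - {k0})" by (meson card_mono finite_Diff finite_imageI finite_lessThan not_le)
  then obtain m where m: "m < r" "m \<notin> h ` ({..<r} - {k0})" by auto
  have "\<phi> k \<le> \<phi> k0 + \<epsilon> * m \<or> \<phi> k0 + \<epsilon> * (m + 1) < \<phi> k" if "k < r" for k
  proof (rule ccontr)
    assume "\<not> ?thesis"
    then have *: "\<phi> k0 + \<epsilon> * m < \<phi> k" "\<phi> k \<le> \<phi> k0 + \<epsilon> * (m + 1)" by auto
    have "0 \<le> \<epsilon> * real m" using \<epsilon> by (intro mult_nonneg_nonneg) auto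
    then have "k \<noteq> k0" using *(1) by auto
    have "\<lceil>(\<phi> k - \<phi> k0) / \<epsilon>\<rceil> = int m + 1"
      by (rule ceiling_unique) (use * \<epsilon> in \<open>auto simp: field_simps\<close>)
    then have "h k = m" by (simp add: h_def)
    then show False using m(2) \<open>k \<noteq> k0\<close> that by auto
  qed
  then show ?thesis using m(1) by auto
qed

text \<open>If \<open>x'\<close> used the cell, then \<open>x' - x\<close> would be a circulation moving mass across a cut (placed in
  a gap of the row potentials) in one direction only.\<close>

lemma expensive_cell_unused:
  fixes \<epsilon> :: real
  assumes x: "feas x" "near_opt x \<epsilon> u v" and x': "feas x'" "near_opt x' \<epsilon> u' v'" and \<epsilon>: "0 < \<epsilon>"
    and kl: "k0 < r" "l0 < s" and c: "(4 * r + 1) * \<epsilon> \<le> t k0 l0 - u k0 - v l0"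
  shows "x' k0 l0 = 0"
proof (rule ccontr)
  assume "x' k0 l0 \<noteq> 0"
  then have pos: "0 < x' k0 l0" using x'(1) kl unfolding feas_def by (metis less_eq_real_def)
  define \<phi> where "\<phi> k = u k - u' k" for k
  define \<psi> where "\<psi> l = v l - v' l" for l
  obtain m where m: "m < r" "\<And>k. k < r \<Longrightarrow> \<phi> k \<le> \<phi> k0 + 4 * \<epsilon> * m \<or> \<phi> k0 + 4 * \<epsilon> * (m + 1) < \<phi> k"
    using gap[OF kl(1), of "4 * \<epsilon>" \<phi>] \<epsilon> by auto
  \<comment> \<open>The middle of the gap. Where \<open>x\<close> carries flow,
    \<open>\<phi> k + \<psi> l\<close> is at least \<open>- 2 * \<epsilon>\<close>, and where
    \<open>x'\<close> does, it is at most \<open>2 * \<epsilon>\<close>. A cell crossing the cut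
    violates one of the two bounds, which fixes the sign of \<open>y\<close> there.\<close>
  define \<tau> where "\<tau> = \<phi> k0 + 4 * \<epsilon> * m + 2 * \<epsilon>"
  define R where "R = {k. k < r \<and> \<phi> k0 + 4 * \<epsilon> * (m + 1) < \<phi> k}"
  define C where "C = {l. l < s \<and> \<tau> < - \<psi> l}"
  define y where "y k l = x' k l - x k l" for k l
  have far: "t k0 l0 - u' k0 - v' l0 \<le> \<epsilon>" using x'(2) pos kl unfolding near_opt_def by blast
  \<comment> \<open>In \<open>4 * r + 1\<close>, the part \<open>4 * r\<close> reaches beyond the
    highest possible gap, and the 1 pays for the reduced cost of the cell with respect to
    \<open>u'\<close> and \<open>v'\<close>.\<close>
  have "4 * \<epsilon> * (m + 1) \<le> 4 * \<epsilon> * r" using m(1) \<epsilon> by (intro mult_left_mono) auto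
  moreover have "\<phi> k0 + \<psi> l0 \<le> \<epsilon> - (4 * r + 1) * \<epsilon>" using c far unfolding \<phi>_def \<psi>_def by linarith
  ultimately have l0: "l0 \<in> C" using kl \<epsilon> unfolding C_def \<tau>_def by (simp add: algebra_simps)
  have k0: "k0 \<in> {..<r} - R" using kl \<epsilon> by (simp add: R_def not_less)
  have rows: "(\<Sum>l<s. y k l) = 0" if "k < r" for k
    using x(1) x'(1) that by (simp add: feas_def y_def sum_subtractf)
  have cols: "(\<Sum>k<r. y k l) = 0" if "l < s" for l
    using x(1) x'(1) that by (simp add: feas_def y_def sum_subtractf)
  have up: "0 \<le> y k l" if "k \<in> {..<r} - R" "l \<in> C" for k l
  proof (rule ccontr)
    assume neg: "\<not> ?thesis"
    have k: "k < r" "l < s" using that by (auto simp: C_def)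
    have "0 \<le> x' k l" using x'(1) k by (auto simp: feas_def)
    then have "0 < x k l" using neg by (simp add: y_def)
    then have "t k l - u k - v l \<le> \<epsilon>" "- \<epsilon> \<le> t k l - u' k - v' l" using x(2) x'(2) k unfolding near_opt_def by blast+
    then have "- 2 * \<epsilon> \<le> \<phi> k + \<psi> l" unfolding \<phi>_def \<psi>_def by linarith
    moreover have "\<phi> k \<le> \<phi> k0 + 4 * \<epsilon> * m" using m(2)[OF k(1)] that k by (auto simp: R_def)
    ultimately show False using that(2) \<epsilon> by (simp add: C_def \<tau>_def)
  qed
  have down: "y k l \<le> 0" if "k \<in> R" "l \<in> {..<s} - C" for k l
  proof (rule ccontr)
    assume neg: "\<not> ?thesis"
    have k: "k < r" "l < s" using that by (auto simp: R_def)
    have "0 \<le> x k l" using x(1) k by (auto simp: feas_def)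
    then have "0 < x' k l" using neg by (simp add: y_def)
    then have "t k l - u' k - v' l \<le> \<epsilon>" "- \<epsilon> \<le> t k l - u k - v l" using x(2) x'(2) k unfolding near_opt_def by blast+
    then have "\<phi> k + \<psi> l \<le> 2 * \<epsilon>" unfolding \<phi>_def \<psi>_def by linarith
    moreover have "\<phi> k0 + 4 * \<epsilon> * (m + 1) < \<phi> k" using that(1) by (auto simp: R_def)
    ultimately show False using that(2) \<epsilon> by (simp add: C_def \<tau>_def algebra_simps)
  qed
  have "x k0 l0 \<le> 0"
  proof (rule ccontr)
    assume "\<not> ?thesis"
    then have "t k0 l0 - u k0 - v l0 \<le> \<epsilon>" using x(2) kl by (simp add: near_opt_def)
    moreover have "0 < real r * \<epsilon>" using \<epsilon> kl by simp
    ultimately show False using c by (simp add: algebra_simps)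
  qed
  then have "0 < y k0 l0" using pos by (simp add: y_def)
  also have "y k0 l0 \<le> (\<Sum>l\<in>C. y k0 l)"
    by (rule member_le_sum) (use l0 up k0 in \<open>auto simp: C_def\<close>)
  also have "\<dots> \<le> (\<Sum>k\<in>{..<r} - R. \<Sum>l\<in>C. y k l)"
    by (rule member_le_sum[of _ _ "\<lambda>k. \<Sum>l\<in>C. y k l"]) (use k0 up in \<open>auto intro!: sum_nonneg\<close>)
  also have "\<dots> = (\<Sum>k\<in>R. \<Sum>l\<in>{..<s} - C. y k l)"
    by (rule cut_balance[OF rows cols]) (auto simp: R_def C_def)
  also have "\<dots> \<le> 0" using down by (intro sum_nonpos) auto
  finally show False by simp
qed

section \<open>Geometric decrease of \<open>\<epsilon>\<close> and the number of
  cancellations\<close>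

lemma power_small:
  assumes "0 < r"
  shows "(1 - 1 / (2 * real r)) ^ (2 * r * (4 * r + 1)) \<le> 1 / (4 * real r + 1)"
proof -
  let ?x = "1 / (2 * real r)" and ?K = "2 * r * (4 * r + 1)"
  have x: "0 \<le> 1 - ?x" "0 \<le> ?x" using assms by auto
  \<comment> \<open>Passing to a reciprocal turns Bernoulli's inequality into an upper bound; the
    exponent is chosen so that \<open>?K * ?x\<close> equals \<open>4 * r + 1\<close>.\<close>
  have "(1 - ?x) ^ ?K \<le> (1 / (1 + ?x)) ^ ?K"
  proof (intro power_mono x)
    have "(1 - ?x) * (1 + ?x) \<le> 1" by (simp add: algebra_simps)
    then show "1 - ?x \<le> 1 / (1 + ?x)" using x(2) by (simp add: pos_le_divide_eq add_pos_nonneg)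
  qed
  also have "\<dots> = 1 / (1 + ?x) ^ ?K" by (simp add: power_one_over)
  also have "\<dots> \<le> 1 / (1 + real ?K * ?x)"
    using Bernoulli_inequality[of ?x ?K] x
    by (intro divide_left_mono mult_pos_pos zero_less_power add_pos_nonneg) auto
  also have "real ?K * ?x = 4 * r + 1" using assms by (simp add: field_simps)
  also have "1 / (1 + real (4 * r + 1)) \<le> 1 / (4 * real r + 1)" by (intro divide_left_mono) auto
  finally show ?thesis .
qed

text \<open>From right to left, the factors of the bound are the length of a block, the number of
  blocks per permanently emptied cell, and one more than the number of cells.\<close>

theorem cancellations_bound:
  assumes Q0: "feas (Q 0)" and step: "\<And>j. j < T \<Longrightarrow> cancels (Q j) (E j) (Q (Suc j))"
  shows "T \<le> (r * s + 1) * (2 * r * (4 * r + 1) * (r * s + 1))"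
proof -
  define M where "M = r * s + 1"
  define K where "K = 2 * r * (4 * r + 1)"
  define \<rho> where "\<rho> = 1 - 1 / (2 * real r)"
  have \<rho>: "0 \<le> \<rho>" using r_pos by (simp add: \<rho>_def)
  have feas: "j \<le> T \<Longrightarrow> feas (Q j)" for j
  proof (induction j)
    case (Suc j)
    then show ?case using cancels_feas[OF step[of j]] by simp
  qed (use Q0 in simp)
  have Epos: "0 < E j" if "j < T" for j using step[OF that] by (auto simp: cancels_def min_mean_cycle_def)
  have opt: "\<exists>u v. near_opt (Q j) (E j) u v" if "j < T" for j
    using step[OF that] by (auto simp: cancels_def min_mean_cycle_def)
  have opt_Suc: "\<exists>u v. near_opt (Q (Suc j)) (E j) u v" if "j < T" for j
    using opt[OF that] cancels_near_opt[OF step[OF that] feas] that by fastforce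
  have anti: "E j' \<le> E j" if "j \<le> j'" "j' < T" for j j'
    using that
  proof (induction j' rule: dec_induct)
    case (step j')
    then show ?case using opt_Suc[of j'] cancels_eps_le[OF assms(2)[of "Suc j'"]] by fastforce
  qed simp
  \<comment> \<open>The last flow \<open>Q T\<close> has no cancellation of its own; its potentials
    are inherited from the one before.\<close>
  have later: "\<exists>u v. near_opt (Q j') (E j) u v" if "j \<le> j'" "j' \<le> T" "j < T" for j j'
  proof (cases "j' < T")
    case True
    then show ?thesis using opt[OF True] near_opt_mono anti[OF that(1) True] by blast
  next
    case False
    then have "j' = Suc (j' - 1)" "j' - 1 < T" "j \<le> j' - 1" using that by auto
    then show ?thesis using opt_Suc[of "j' - 1"] near_opt_mono anti[of j "j' - 1"] by metis
  qed
  \<comment> \<open>Otherwise the potentials of \<open>Q j\<close> remain valid through the block,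
    and each of its \<open>M\<close> cancellations shrinks the violating set, which has at most
    \<open>M - 1\<close> elements.\<close>
  have contract: "E (j + M) \<le> \<rho> * E j" if "j + M < T" for j
  proof (rule ccontr)
    assume neg: "\<not> E (j + M) \<le> \<rho> * E j"
    have jT: "j < T" using that by simp
    obtain u v where uv: "near_opt (Q j) (E j) u v" using opt[OF jT] by auto
    have "near_opt (Q (j + i)) (E j) u v \<and> card (violating (Q (j + i)) u v) + i \<le> r * s" if "i \<le> M" for i
      using that
    proof (induction i)
      case 0
      have "violating (Q j) u v \<subseteq> {..<r} \<times> {..<s}" by (auto simp: violating_def)
      then show ?case using uv card_mono[of "{..<r} \<times> {..<s}"] by auto
    next
      case (Suc i)
      then have i: "j + i < T" "j + i \<le> j + M" using \<open>j + M < T\<close> by auto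
      have "\<not> E (j + i) \<le> \<rho> * E j" using anti[OF i(2) \<open>j + M < T\<close>] neg by linarith
      then have n: "near_opt (Q (Suc (j + i))) (E j) u v"
          "violating (Q (Suc (j + i))) u v \<subset> violating (Q (j + i)) u v"
        using cancels_progress[OF step[OF i(1)] feas conjunct1[OF Suc.IH]] Suc.prems i by (auto simp: \<rho>_def)
      have "violating (Q (j + i)) u v \<subseteq> {..<r} \<times> {..<s}" by (auto simp: violating_def)
      then have "finite (violating (Q (j + i)) u v)" by (rule finite_subset) auto
      from psubset_card_mono[OF this n(2)] show ?case using Suc n(1) by auto
    qed
    from this[of M] show False by (simp add: M_def)
  qed
  have block: "j + i * M < T \<Longrightarrow> E (j + i * M) \<le> \<rho> ^ i * E j" for i j
  proof (induction i)
    case (Suc i)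
    have "E (j + Suc i * M) = E ((j + i * M) + M)" by (simp add: algebra_simps)
    also have "\<dots> \<le> \<rho> * E (j + i * M)" by (rule contract) (use Suc.prems in \<open>simp add: algebra_simps\<close>)
    also have "\<dots> \<le> \<rho> * (\<rho> ^ i * E j)" by (intro mult_left_mono Suc.IH \<rho>) (use Suc.prems in simp)
    finally show ?case by simp
  qed simp
  define L where "L = K * M"
  have small: "(4 * r + 1) * E (j + L) \<le> E j" if "j + L < T" for j
  proof -
    have "E (j + L) \<le> \<rho> ^ K * E j" using block[of j K] that by (simp add: L_def)
    also have "\<dots> \<le> 1 / (4 * real r + 1) * E j"
      using power_small[OF r_pos] Epos[of j] that by (intro mult_right_mono) (auto simp: \<rho>_def K_def)
    finally show ?thesis by (simp add: field_simps)
  qed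
  define Z where "Z j = {(k, l). k < r \<and> l < s \<and> (\<forall>j'. j \<le> j' \<longrightarrow> j' \<le> T \<longrightarrow> Q j' k l = 0)}" for j
  have finZ: "finite (Z j)" "card (Z j) \<le> r * s" for j
  proof -
    have "Z j \<subseteq> {..<r} \<times> {..<s}" by (auto simp: Z_def)
    then show "finite (Z j)" "card (Z j) \<le> r * s"
      using card_mono[of "{..<r} \<times> {..<s}" "Z j"] by (auto intro: finite_subset)
  qed
  have Zgrow: "Z j \<subset> Z (j + L)" if jL: "j + L < T" for j
  proof -
    obtain f g p where c: "min_mean_cycle (Q j) (E j) f g p"
      using step[of j] jL by (auto simp: cancels_def)
    let ?e = "E (j + L)"
    obtain u v where uv: "near_opt (Q (j + L)) ?e u v" using opt[OF jL] by auto
    have e0: "0 < ?e" using Epos[OF jL] .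
    have w: "0 < p" "walk (Q j) f g p" "f p = f 0" using c by (auto simp: min_mean_cycle_def)
    \<comment> \<open>The cycle cancelled at time \<open>j\<close> is measured with the potentials
      of time \<open>j + L\<close>. Its forward edges cost at least \<open>- E (j + L)\<close>,
      hence at least \<open>- E j\<close>, so a mean of \<open>- 2 * E j\<close> forces an expensive
      backward cell. That cell carries flow at time \<open>j\<close>.\<close>
    have "\<exists>n<p. E j \<le> t (f (Suc n)) (g n) - u (f (Suc n)) - v (g n)"
    proof (rule ccontr)
      assume neg: "\<not> ?thesis"
      have "(\<Sum>n<p. - E j - E j) < weight f g p"
        unfolding weight_reduced[OF w(3), of g u v]
      proof (rule sum_strict_mono)
        fix n assume "n \<in> {..<p}"
        then have n: "n < p" by simp
        then have "f n < r" "g n < s" using w(2) by (auto simp: walk_def)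
        then have "- ?e \<le> t (f n) (g n) - u (f n) - v (g n)" using uv by (simp add: near_opt_def)
        moreover have "t (f (Suc n)) (g n) - u (f (Suc n)) - v (g n) < E j" using neg n by (simp add: not_le)
        moreover have "?e \<le> E j" using anti[of j "j + L"] jL by simp
        ultimately show "- E j - E j < t (f n) (g n) - u (f n) - v (g n) - (t (f (Suc n)) (g n) - u (f (Suc n)) - v (g n))"
          by linarith
      qed (use w in auto)
      then show False using c by (simp add: min_mean_cycle_def algebra_simps)
    qed
    then obtain n where n: "n < p" "E j \<le> t (f (Suc n)) (g n) - u (f (Suc n)) - v (g n)" by auto
    let ?k = "f (Suc n)" and ?l = "g n"
    have kl: "?k < r" "?l < s" "0 < Q j ?k ?l" using w n by (auto simp: walk_def)
    have "Q j' ?k ?l = 0" if j': "j + L \<le> j'" "j' \<le> T" for j'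
    proof -
      obtain u' v' where "near_opt (Q j') ?e u' v'" using later[OF j' jL] by auto
      from expensive_cell_unused[OF feas uv feas this e0 kl(1,2)] show ?thesis
        using n(2) small[OF jL] jL j' by auto
    qed
    then have "(?k, ?l) \<in> Z (j + L)" using kl by (auto simp: Z_def)
    moreover have "(?k, ?l) \<notin> Z j" using kl jL by (auto simp: Z_def)
    moreover have "Z j \<subseteq> Z (j + L)" by (auto simp: Z_def)
    ultimately show ?thesis by blast
  qed
  have Zcard: "i * L < T \<Longrightarrow> i \<le> card (Z (i * L))" for i
  proof (induction i)
    case (Suc i)
    have "i * L + L < T" using Suc.prems by (simp add: algebra_simps)
    from psubset_card_mono[OF finZ(1) Zgrow[OF this]] Suc show ?case by (simp add: algebra_simps)
  qed simp
  show ?thesis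
  proof (rule ccontr)
    assume "\<not> ?thesis"
    then have "M * L < T" by (simp add: M_def L_def K_def algebra_simps)
    from Zcard[OF this] finZ(2)[of "M * L"] show False by (simp add: M_def)
  qed
qed

text \<open>Complementary slackness: \<open>u\<close> and \<open>v\<close> are dual feasible and
  used cells have reduced cost 0, while potentials shift the objective by the same constant for all
  feasible flows.\<close>

lemma zero_near_opt_optimal:
  assumes "feas q" "near_opt q 0 u v" "feas q'"
  shows "(\<Sum>k<r. \<Sum>l<s. t k l * q k l) \<le> (\<Sum>k<r. \<Sum>l<s. t k l * q' k l)"
proof -
  have split: "(\<Sum>k<r. \<Sum>l<s. t k l * x k l) = (\<Sum>k<r. \<Sum>l<s. (t k l - u k - v l) * x k l) + ((\<Sum>k<r. u k * a k) + (\<Sum>l<s. v l * e l))"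
    if "feas x" for x
  proof -
    have "(\<Sum>k<r. u k * a k) = (\<Sum>k<r. \<Sum>l<s. u k * x k l)"
      using that by (intro sum.cong) (auto simp: feas_def sum_distrib_left[symmetric])
    moreover have "(\<Sum>l<s. v l * e l) = (\<Sum>k<r. \<Sum>l<s. v l * x k l)"
      using that by (subst sum.swap, intro sum.cong) (auto simp: feas_def sum_distrib_left[symmetric])
    ultimately show ?thesis by (simp add: sum.distrib[symmetric] algebra_simps)
  qed
  have "(\<Sum>k<r. \<Sum>l<s. (t k l - u k - v l) * q k l) = 0"
  proof (intro sum.neutral ballI)
    fix k l assume "k \<in> {..<r}" "l \<in> {..<s}"
    then show "(t k l - u k - v l) * q k l = 0"
      using assms(1,2) unfolding feas_def near_opt_def
      by (metis lessThan_iff less_eq_real_def minus_zero mult_eq_0_iff order_antisym)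
  qed
  moreover have "0 \<le> (\<Sum>k<r. \<Sum>l<s. (t k l - u k - v l) * q' k l)"
    using assms(2,3) by (intro sum_nonneg mult_nonneg_nonneg) (auto simp: feas_def near_opt_def)
  ultimately show ?thesis using split[OF assms(1)] split[OF assms(3)] by linarith
qed
end

section \<open>Computing a minimum mean cycle\<close>

context transport begin

text \<open>\<open>colv q i p l\<close> is the least value of \<open>weight f g p + t (f p) l\<close> over the walks from row \<open>i\<close>, and
  \<open>rowv q i p j\<close> the least weight of a walk of length \<open>p + 1\<close> from row \<open>i\<close> to row \<open>j\<close>.\<close>

primrec colv :: "(nat \<Rightarrow> nat \<Rightarrow> real) \<Rightarrow> nat \<Rightarrow> nat \<Rightarrow> nat \<Rightarrow> real" where
  "colv q i 0 l = t i l"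
| "colv q i (Suc p) l =
     Min ((\<lambda>j. Min ((\<lambda>l'. colv q i p l' - t j l') ` {l'. l' < s \<and> 0 < q j l'}) + t j l) ` {..<r})"

definition rowv :: "(nat \<Rightarrow> nat \<Rightarrow> real) \<Rightarrow> nat \<Rightarrow> nat \<Rightarrow> nat \<Rightarrow> real" where
  "rowv q i p j = Min ((\<lambda>l. colv q i p l - t j l) ` {l. l < s \<and> 0 < q j l})"

text \<open>A relation rather than a function, since the minimum may be attained several times and
  the program stores one of the choices.\<close>

definition row_pred :: "(nat \<Rightarrow> nat \<Rightarrow> real) \<Rightarrow> nat \<Rightarrow> nat \<Rightarrow> nat \<Rightarrow> nat \<Rightarrow> bool" where
  "row_pred q i p j l \<longleftrightarrow> l < s \<and> 0 < q j l \<and> rowv q i p j = colv q i p l - t j l"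

text \<open>In layer 0 the predecessor is by convention the source row, so that tracing back ends at
  \<open>i\<close>.\<close>

definition col_pred :: "(nat \<Rightarrow> nat \<Rightarrow> real) \<Rightarrow> nat \<Rightarrow> nat \<Rightarrow> nat \<Rightarrow> nat \<Rightarrow> bool" where
  "col_pred q i p l j \<longleftrightarrow> j < r \<and> (if p = 0 then j = i else colv q i p l = rowv q i (p - 1) j + t j l)"

lemma colv_Suc: "colv q i (Suc p) l = Min ((\<lambda>j. rowv q i p j + t j l) ` {..<r})"
  by (simp add: rowv_def)

declare colv.simps(2) [simp del]

lemma rowv_eqI:
  assumes "l < s" "0 < q j l" "\<And>l'. l' < s \<Longrightarrow> 0 < q j l' \<Longrightarrow> colv q i p l - t j l \<le> colv q i p l' - t j l'"
  shows "rowv q i p j = colv q i p l - t j l"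
  unfolding rowv_def using assms by (intro Min_eqI) auto

lemma colv_eqI:
  assumes "j < r" "\<And>j'. j' < r \<Longrightarrow> rowv q i p j + t j l \<le> rowv q i p j' + t j' l"
  shows "colv q i (Suc p) l = rowv q i p j + t j l"
  unfolding colv_Suc using assms by (intro Min_eqI) auto

lemma rowv_le: "l < s \<Longrightarrow> 0 < q j l \<Longrightarrow> rowv q i p j \<le> colv q i p l - t j l"
  unfolding rowv_def by (intro Min_le) auto

lemma colv_le: "j < r \<Longrightarrow> colv q i (Suc p) l \<le> rowv q i p j + t j l"
  unfolding colv_Suc by (intro Min_le) auto

lemma rowv_attained: "feas q \<Longrightarrow> j < r \<Longrightarrow> \<exists>l<s. 0 < q j l \<and> rowv q i p j = colv q i p l - t j l"
proof -
  assume "feas q" "j < r"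
  from row_support[OF this] have "rowv q i p j \<in> (\<lambda>l. colv q i p l - t j l) ` {l. l < s \<and> 0 < q j l}"
    unfolding rowv_def by (intro Min_in) auto
  then show ?thesis by auto
qed

lemma colv_attained: "\<exists>j<r. colv q i (Suc p) l = rowv q i p j + t j l"
proof -
  have "colv q i (Suc p) l \<in> (\<lambda>j. rowv q i p j + t j l) ` {..<r}"
    unfolding colv_Suc using r_pos by (intro Min_in) auto
  then show ?thesis by auto
qed

lemma colv_le_weight:
  "walk q f g p \<Longrightarrow> f 0 = i \<Longrightarrow> colv q i p l \<le> weight f g p + t (f p) l"
proof (induction p arbitrary: l)
  case 0
  then show ?case by (simp add: weight_def)
next
  case (Suc p)
  have "walk q f g p" using Suc.prems by (auto simp: walk_def)
  from Suc.IH[OF this] have "colv q i p (g p) \<le> weight f g p + t (f p) (g p)" using Suc.prems by simp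
  moreover have "rowv q i p (f (Suc p)) \<le> colv q i p (g p) - t (f (Suc p)) (g p)"
    using Suc.prems by (intro rowv_le) (auto simp: walk_def)
  moreover have "colv q i (Suc p) l \<le> rowv q i p (f (Suc p)) + t (f (Suc p)) l"
    using Suc.prems by (intro colv_le) (auto simp: walk_def)
  ultimately show ?case by (simp add: weight_def)
qed

lemma rowv_le_weight:
  assumes "walk q f g (Suc p)" "f 0 = i"
  shows "rowv q i p (f (Suc p)) \<le> weight f g (Suc p)"
proof -
  have "walk q f g p" using assms by (auto simp: walk_def)
  from colv_le_weight[OF this assms(2), of "g p"]
  have "colv q i p (g p) \<le> weight f g p + t (f p) (g p)" .
  moreover have "rowv q i p (f (Suc p)) \<le> colv q i p (g p) - t (f (Suc p)) (g p)"
    using assms by (intro rowv_le) (auto simp: walk_def)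
  ultimately show ?thesis by (simp add: weight_def)
qed

text \<open>Stored predecessors attain the minima of the recursion, so following them recovers an
  optimal walk and not merely its weight.\<close>

lemma traced_walk:
  assumes preds: "\<And>n. n \<le> p \<Longrightarrow> row_pred q i n (f (Suc n)) (g n) \<and> col_pred q i n (g n) (f n)"
    and last: "f (Suc p) < r"
  shows "walk q f g (Suc p)" "f 0 = i" "weight f g (Suc p) = rowv q i p (f (Suc p))"
proof -
  show "walk q f g (Suc p)" unfolding walk_def
  proof safe
    fix n assume "n \<le> Suc p" then show "f n < r" using preds[of n] last by (cases "n = Suc p") (auto simp: col_pred_def)
  next
    fix n assume "n < Suc p" then show "g n < s" "0 < q (f (Suc n)) (g n)" using preds[of n] by (auto simp: row_pred_def)
  qed
  show "f 0 = i" using preds[of 0] by (simp add: col_pred_def)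
  have "n \<le> p \<Longrightarrow> weight f g (Suc n) = rowv q i n (f (Suc n))" for n
  proof (induction n)
    case 0
    then show ?case using preds[of 0] by (simp add: weight_def row_pred_def col_pred_def)
  next
    case (Suc n)
    then show ?case using preds[of "Suc n"] by (simp add: weight_def row_pred_def col_pred_def)
  qed
  from this[of p] show "weight f g (Suc p) = rowv q i p (f (Suc p))" by simp
qed

text \<open>The values are signed sums of \<open>2 * p + 1\<close> or \<open>2 * p + 2\<close>
  costs. A common denominator \<open>M\<close> of the costs therefore remains one for them, and
  magnitudes grow only linearly in the layer.\<close>

lemma colv_rowv_closed:
  assumes q: "feas q" and i: "i < r"
    and sub: "\<And>x y. x \<in> Z \<Longrightarrow> y \<in> Z \<Longrightarrow> x + y \<in> Z \<and> x - y \<in> Z"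
    and tZ: "\<And>k l. k < r \<Longrightarrow> l < s \<Longrightarrow> t k l * M \<in> Z \<and> \<bar>t k l\<bar> \<le> c"
  shows "(\<forall>l<s. colv q i p l * M \<in> Z \<and> \<bar>colv q i p l\<bar> \<le> (2 * real p + 1) * c) \<and>
    (\<forall>j<r. rowv q i p j * M \<in> Z \<and> \<bar>rowv q i p j\<bar> \<le> (2 * real p + 2) * c)"
proof -
  have row: "rowv q i p j * M \<in> Z \<and> \<bar>rowv q i p j\<bar> \<le> (2 * real p + 2) * c"
    if "\<forall>l<s. colv q i p l * M \<in> Z \<and> \<bar>colv q i p l\<bar> \<le> (2 * real p + 1) * c" "j < r" for p j
  proof -
    obtain l where "l < s" "rowv q i p j = colv q i p l - t j l" using rowv_attained[OF q \<open>j < r\<close>] by blast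
    moreover have "\<bar>colv q i p l - t j l\<bar> \<le> (2 * real p + 1) * c + c"
      using that(1) tZ[OF \<open>j < r\<close> \<open>l < s\<close>] \<open>l < s\<close> by (smt (verit))
    moreover have "colv q i p l * M - t j l * M \<in> Z" using that(1) tZ[OF \<open>j < r\<close> \<open>l < s\<close>] sub \<open>l < s\<close> by blast
    moreover have "(2 * real p + 1) * c + c = (2 * real p + 2) * c" by (simp add: algebra_simps)
    ultimately show ?thesis by (simp add: left_diff_distrib)
  qed
  have "\<forall>l<s. colv q i p l * M \<in> Z \<and> \<bar>colv q i p l\<bar> \<le> (2 * real p + 1) * c"
  proof (induction p)
    case 0 then show ?case using tZ i by simp
  next
    case (Suc p)
    show ?case
    proof safe
      fix l assume l: "l < s"
      obtain j where j: "j < r" "colv q i (Suc p) l = rowv q i p j + t j l" using colv_attained by blast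
      have "\<bar>rowv q i p j + t j l\<bar> \<le> (2 * real p + 2) * c + c"
        using row[OF Suc j(1)] tZ[OF j(1) l] by (smt (verit))
      moreover have "rowv q i p j * M + t j l * M \<in> Z" using row[OF Suc j(1)] tZ[OF j(1) l] sub by blast
      moreover have "(2 * real p + 2) * c + c = (2 * real (Suc p) + 1) * c" by (simp add: algebra_simps)
      ultimately show "colv q i (Suc p) l * M \<in> Z" "\<bar>colv q i (Suc p) l\<bar> \<le> (2 * real (Suc p) + 1) * c"
        using j(2) by (simp_all add: distrib_right)
    qed
  qed
  then show ?thesis using row by blast
qed

text \<open>Strict minimality among the shorter closed walks with the same start suffices for injectivity:
  at a repetition the walk splits into such a shorter walk and another closed walk.\<close>

lemma min_mean_cycleI:
  assumes q: "feas q" and b: "b < 0" and w: "0 < p" "walk q f g p" "f p = f 0" "weight f g p = b * p"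
    and all: "\<And>f' g' p'. 0 < p' \<Longrightarrow> p' \<le> r \<Longrightarrow> walk q f' g' p' \<Longrightarrow> f' p' = f' 0 \<Longrightarrow> b * p' \<le> weight f' g' p'"
    and short: "\<And>f' g' p'. 0 < p' \<Longrightarrow> p' < p \<Longrightarrow> walk q f' g' p' \<Longrightarrow> f' 0 = f 0 \<Longrightarrow> f' p' = f 0 \<Longrightarrow> b * p' < weight f' g' p'"
  shows "min_mean_cycle q (- b / 2) f g p"
proof -
  have "\<exists>u v. near_opt q (- b / 2) u v"
    by (rule near_opt_exists[OF q]) (use all in simp)
  moreover have "inj_on f {..<p}"
  proof (rule linorder_inj_onI', rule notI)
    fix m n assume mn: "m \<in> {..<p}" "n \<in> {..<p}" "m < n" "f m = f n"
    then have "n \<le> p" by simp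
    note sp = walk_split[OF w(2) mn(3) this mn(4)]
    let ?f = "\<lambda>k. if k < m then f k else f (k + (n - m))" and ?g = "\<lambda>k. if k < m then g k else g (k + (n - m))"
    let ?f' = "\<lambda>k. f (m + k)" and ?g' = "\<lambda>k. g (m + k)"
    have 1: "b * real (p - (n - m)) < weight ?f ?g (p - (n - m))"
    proof (rule short[OF _ _ sp(1) sp(4)])
      show "?f (p - (n - m)) = f 0" using sp(5) w(3) by simp
    qed (use mn in auto)
    have "b * real (n - m) \<le> weight ?f' ?g' (n - m)"
    proof (rule closed_walk_weight_ge[OF _ sp(2)])
      fix f g p assume "0 < p" "p \<le> r" "walk q f g p" "f p = f 0"
      then show "b * real p \<le> weight f g p" by (rule all)
    qed (use mn in simp)
    then have "b * (real (p - (n - m)) + real (n - m)) < weight f g p" using 1 sp(3) by (simp add: ring_distribs)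
    moreover have "real (p - (n - m)) + real (n - m) = p" using mn by (simp add: of_nat_diff)
    ultimately show False using w(4) by simp
  qed
  ultimately show ?thesis using b w by (simp add: min_mean_cycle_def)
qed

end

section \<open>Reasoning about programs\<close>

text \<open>\<open>G\<close> is imposed on every real in memory at all times; it will express shortness of the encoding.\<close>

definition all_good :: "(real \<Rightarrow> bool) \<Rightarrow> state \<Rightarrow> bool" where
  "all_good G s \<longleftrightarrow> (\<forall>x i. G (rmem s x i))"

text \<open>\<open>G\<close> is demanded at every time, also after halting. That it holds initially
  is an assumption inside the definition, so that such statements can be nested as
  postconditions.\<close>

definition reaches :: "(real \<Rightarrow> bool) \<Rightarrow> nat \<Rightarrow> com \<Rightarrow> (state \<Rightarrow> bool) \<Rightarrow> state \<Rightarrow> bool" where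
  "reaches G T c Q s \<longleftrightarrow> (all_good G s \<longrightarrow>
     (\<exists>n s'. n \<le> T \<and> run c n s = (Skip, s') \<and> Q s' \<and> (\<forall>m. all_good G (snd (run c m s)))))"

lemma run_0 [simp]: "run c 0 s = (c, s)"
  by (simp add: run_def)

lemma run_Suc: "run c (Suc n) s = (case step c s of (c', s') \<Rightarrow> run c' n s')"
  by (simp add: run_def funpow_swap1 split: prod.split)

lemma run_add: "run c (m + n) s = (case run c m s of (c', s') \<Rightarrow> run c' n s')"
  by (induction m arbitrary: c s) (simp_all add: run_Suc split: prod.split)

lemma run_Skip [simp]: "run Skip n s = (Skip, s)"
  by (induction n) (simp_all add: run_Suc)

text \<open>\<open>m\<close> is a moment at which \<open>c1\<close> has become \<open>Skip\<close>;
  one more step discards it, whence \<open>Suc m\<close>.\<close>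

lemma run_Seq:
  "run c1 n s = (Skip, s') \<Longrightarrow>
   \<exists>m\<le>n. run (Seq c1 c2) (Suc m) s = (c2, s') \<and> (\<forall>k\<le>m. snd (run (Seq c1 c2) k s) = snd (run c1 k s))"
proof (induction n arbitrary: c1 s)
  case 0
  then show ?case by (simp add: run_Suc)
next
  case (Suc n)
  show ?case
  proof (cases "c1 = Skip")
    case True
    then show ?thesis using Suc.prems by (intro exI[of _ 0]) (simp add: run_Suc)
  next
    case False
    obtain c' t where st: "step c1 s = (c', t)" by force
    then have "run c' n t = (Skip, s')" using Suc.prems by (simp add: run_Suc)
    then obtain m where m: "m \<le> n" "run (Seq c' c2) (Suc m) t = (c2, s')"
        "\<And>k. k \<le> m \<Longrightarrow> snd (run (Seq c' c2) k t) = snd (run c' k t)"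
      using Suc.IH by blast
    have S: "run (Seq c1 c2) (Suc k) s = run (Seq c' c2) k t" for k
      using False st by (simp add: run_Suc)
    have "snd (run (Seq c1 c2) k s) = snd (run c1 k s)" if "k \<le> Suc m" for k
      using that m(3) st S by (cases k) (auto simp: run_Suc)
    then show ?thesis using m(1,2) S by (intro exI[of _ "Suc m"]) auto
  qed
qed

lemma reaches_mono: "reaches G T c P s \<Longrightarrow> T \<le> T' \<Longrightarrow> (\<And>s'. P s' \<Longrightarrow> Q s') \<Longrightarrow> reaches G T' c Q s"
  unfolding reaches_def by (meson order_trans)

lemma reaches_Skip: "Q s \<Longrightarrow> reaches G T Skip Q s"
  unfolding reaches_def by auto

lemma reaches_step:
  assumes "step c s = (c', s')" "all_good G s \<Longrightarrow> all_good G s'" "reaches G T c' Q s'"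
  shows "reaches G (Suc T) c Q s"
  unfolding reaches_def
proof
  assume good: "all_good G s"
  then obtain n t where n: "n \<le> T" "run c' n s' = (Skip, t)" "Q t" "\<And>m. all_good G (snd (run c' m s'))"
    using assms unfolding reaches_def by blast
  have "all_good G (snd (run c m s))" for m
    using n(4) assms(1) good by (cases m) (auto simp: run_Suc)
  then show "\<exists>n s'. n \<le> Suc T \<and> run c n s = (Skip, s') \<and> Q s' \<and> (\<forall>m. all_good G (snd (run c m s)))"
    using n assms(1) by (intro exI[of _ "Suc n"]) (auto simp: run_Suc)
qed

lemma reaches_Seq:
  assumes "reaches G T1 c1 (\<lambda>s'. reaches G T2 c2 Q s') s"
  shows "reaches G (T1 + T2 + 1) (Seq c1 c2) Q s"
  unfolding reaches_def
proof
  assume "all_good G s"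
  then obtain n1 s1 where 1: "n1 \<le> T1" "run c1 n1 s = (Skip, s1)" "reaches G T2 c2 Q s1" "\<And>m. all_good G (snd (run c1 m s))"
    using assms unfolding reaches_def[of _ _ c1] by blast
  have "all_good G s1" using 1(2) 1(4)[of n1] by simp
  then obtain n2 s2 where 2: "n2 \<le> T2" "run c2 n2 s1 = (Skip, s2)" "Q s2" "\<And>m. all_good G (snd (run c2 m s1))"
    using 1(3) unfolding reaches_def by blast
  obtain m where m: "m \<le> n1" "run (Seq c1 c2) (Suc m) s = (c2, s1)"
      "\<And>k. k \<le> m \<Longrightarrow> snd (run (Seq c1 c2) k s) = snd (run c1 k s)"
    using run_Seq[OF 1(2)] by blast
  have add: "run (Seq c1 c2) (Suc m + k) s = run c2 k s1" for k
    using m(2) run_add[of _ "Suc m" k s] by simp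
  have "all_good G (snd (run (Seq c1 c2) k s))" for k
  proof (cases "k \<le> m")
    case False
    then have "k = Suc m + (k - Suc m)" by simp
    then show ?thesis using add 2(4) by metis
  qed (simp add: m(3) 1(4))
  then show "\<exists>n s'. n \<le> T1 + T2 + 1 \<and> run (Seq c1 c2) n s = (Skip, s') \<and> Q s' \<and> (\<forall>m. all_good G (snd (run (Seq c1 c2) m s)))"
    using 1(1) 2 m(1) add[of n2] by (intro exI[of _ "Suc m + n2"]) auto
qed

text \<open>An upper bound on the running time, as a polynomial in a common bound on the number of iterations
  of all loops.\<close>

primrec steps :: "com \<Rightarrow> nat poly" where
  "steps Skip = 0"
| "steps (ISet x i e) = 1"
| "steps (RSet x i e) = 1"
| "steps (Seq c1 c2) = steps c1 + steps c2 + 1"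
| "steps (Cond b c1 c2) = steps c1 + steps c2 + 1"
| "steps (Loop b c) = [:0, 1:] * (steps c + 2) + 1"

text \<open>One \<open>B\<close> bounds the iterations of every loop, so the composition rules
  involve no arithmetic on running times.\<close>

definition ensures :: "(real \<Rightarrow> bool) \<Rightarrow> nat \<Rightarrow> com \<Rightarrow> (state \<Rightarrow> bool) \<Rightarrow> state \<Rightarrow> bool" where
  "ensures G B c Q s \<longleftrightarrow> reaches G (poly (steps c) B) c Q s"

section \<open>Frame conditions read off from the program text\<close>

primrec iwrites :: "com \<Rightarrow> string set" where
  "iwrites Skip = {}"
| "iwrites (ISet x i e) = {x}"
| "iwrites (RSet x i e) = {}"
| "iwrites (Seq c1 c2) = iwrites c1 \<union> iwrites c2"
| "iwrites (Cond b c1 c2) = iwrites c1 \<union> iwrites c2"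
| "iwrites (Loop b c) = iwrites c"

primrec rwrites :: "com \<Rightarrow> string set" where
  "rwrites Skip = {}"
| "rwrites (ISet x i e) = {}"
| "rwrites (RSet x i e) = {x}"
| "rwrites (Seq c1 c2) = rwrites c1 \<union> rwrites c2"
| "rwrites (Cond b c1 c2) = rwrites c1 \<union> rwrites c2"
| "rwrites (Loop b c) = rwrites c"

definition unchanged :: "com \<Rightarrow> state \<Rightarrow> state \<Rightarrow> bool" where
  "unchanged c s s' \<longleftrightarrow> (\<forall>x. x \<notin> iwrites c \<longrightarrow> imem s' x = imem s x) \<and> (\<forall>x. x \<notin> rwrites c \<longrightarrow> rmem s' x = rmem s x)"

lemma unchanged_refl [simp]: "unchanged c s s"
  by (simp add: unchanged_def)

lemma step_unchanged:
  "step c s = (c', s') \<Longrightarrow> iwrites c' \<subseteq> iwrites c \<and> rwrites c' \<subseteq> rwrites c \<and> unchanged c s s'"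
  by (induction c arbitrary: c' s') (auto simp: unchanged_def split: prod.splits if_splits)

lemma run_unchanged: "run c n s = (c', s') \<Longrightarrow> unchanged c s s'"
proof (induction n arbitrary: c s)
  case (Suc n)
  obtain c1 s1 where "step c s = (c1, s1)" by force
  with step_unchanged[OF this] Suc.IH[of c1 s1] Suc.prems show ?case
    unfolding run_Suc unchanged_def by fastforce
qed simp

text \<open>The frame condition holds for every run, so it can be added to any specification after
  the fact.\<close>

lemma ensures_unchanged:
  assumes "ensures G B c Q s"
  shows "ensures G B c (\<lambda>s'. Q s' \<and> unchanged c s s') s"
  using assms run_unchanged unfolding ensures_def reaches_def by blast

lemma ensures_conseq:
  assumes "ensures G B c P s" "\<And>s'. P s' \<Longrightarrow> unchanged c s s' \<Longrightarrow> Q s'"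
  shows "ensures G B c Q s"
  using ensures_unchanged[OF assms(1)] assms(2) unfolding ensures_def by (auto elim: reaches_mono)

lemma ensures_Skip: "Q s \<Longrightarrow> ensures G B Skip Q s"
  by (simp add: ensures_def reaches_Skip)

section \<open>Proof rules for assignments, branches and loops\<close>

definition iset :: "state \<Rightarrow> string \<Rightarrow> nat \<Rightarrow> nat \<Rightarrow> state" where
  "iset s x i v = State ((imem s)(x := (imem s x)(i := v))) (rmem s)"

definition rset :: "state \<Rightarrow> string \<Rightarrow> nat \<Rightarrow> real \<Rightarrow> state" where
  "rset s x i v = State (imem s) ((rmem s)(x := (rmem s x)(i := v)))"

lemma mem_iset [simp]:
  "imem (iset s x i v) = (imem s)(x := (imem s x)(i := v))" "rmem (iset s x i v) = rmem s"
  by (simp_all add: iset_def)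

lemma mem_rset [simp]:
  "rmem (rset s x i v) = (rmem s)(x := (rmem s x)(i := v))" "imem (rset s x i v) = imem s"
  by (simp_all add: rset_def)

lemma ensures_ISet: "Q (iset s x (ival i s) (ival e s)) \<Longrightarrow> ensures G B (ISet x i e) Q s"
  unfolding ensures_def by (auto simp: all_good_def iset_def intro!: reaches_step reaches_Skip)

lemma ensures_RSet:
  "G (rval e s) \<Longrightarrow> Q (rset s x (ival i s) (rval e s)) \<Longrightarrow> ensures G B (RSet x i e) Q s"
  unfolding ensures_def by (auto simp: all_good_def rset_def intro!: reaches_step reaches_Skip)

lemma ensures_Seq: "ensures G B c1 (ensures G B c2 Q) s \<Longrightarrow> ensures G B (Seq c1 c2) Q s"
  unfolding ensures_def using reaches_Seq by auto

lemma ensures_Cond: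
  assumes "bval b s \<Longrightarrow> ensures G B c1 Q s" "\<not> bval b s \<Longrightarrow> ensures G B c2 Q s"
  shows "ensures G B (Cond b c1 c2) Q s"
proof (cases "bval b s")
  case True
  then have "reaches G (Suc (poly (steps c1) B)) (Cond b c1 c2) Q s"
    using assms(1) unfolding ensures_def by (intro reaches_step) auto
  then show ?thesis unfolding ensures_def by (rule reaches_mono) auto
next
  case False
  then have "reaches G (Suc (poly (steps c2) B)) (Cond b c1 c2) Q s"
    using assms(2) unfolding ensures_def by (intro reaches_step) auto
  then show ?thesis unfolding ensures_def by (rule reaches_mono) auto
qed

text \<open>The invariant carries the iteration count, and \<open>j < B\<close> has to follow from
  it; this is where a combinatorial bound on the number of iterations enters. Besides its body, an
  iteration costs the test and the removal of \<open>Skip\<close>, and the failing test costs one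
  step at the end.\<close>

lemma ensures_Loop:
  assumes body: "\<And>j s. Inv j s \<Longrightarrow> bval b s \<Longrightarrow> j < B \<and> ensures G B c (Inv (Suc j)) s"
    and exit: "\<And>j s. Inv j s \<Longrightarrow> \<not> bval b s \<Longrightarrow> Q s"
    and init: "Inv 0 s"
  shows "ensures G B (Loop b c) Q s"
proof -
  have "Inv j s \<Longrightarrow> j \<le> B \<Longrightarrow> reaches G ((B - j) * (poly (steps c) B + 2) + 1) (Loop b c) Q s" for j s
  proof (induction "B - j" arbitrary: j s)
    case 0
    then have "\<not> bval b s" using body by fastforce
    then show ?case using exit[OF 0(2)] by (auto intro!: reaches_step reaches_Skip)
  next
    case (Suc k)
    show ?case
    proof (cases "bval b s")
      case False
      then show ?thesis using exit[OF Suc.prems(1)] by (auto intro!: reaches_step reaches_Skip)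
    next
      case True
      then have b: "j < B" "ensures G B c (Inv (Suc j)) s" using body[OF Suc.prems(1)] by auto
      have "reaches G ((B - Suc j) * (poly (steps c) B + 2) + 1) (Loop b c) Q s'" if "Inv (Suc j) s'" for s'
        using Suc.hyps(1)[OF _ that] Suc.hyps(2) b by auto
      then have "reaches G (poly (steps c) B) c
          (reaches G ((B - Suc j) * (poly (steps c) B + 2) + 1) (Loop b c) Q) s"
        using b(2) unfolding ensures_def by (auto elim: reaches_mono)
      from reaches_Seq[OF this]
      have "reaches G (Suc (poly (steps c) B + ((B - Suc j) * (poly (steps c) B + 2) + 1) + 1)) (Loop b c) Q s"
        using True by (intro reaches_step) auto
      moreover have "Suc (poly (steps c) B + ((B - Suc j) * (poly (steps c) B + 2) + 1) + 1) = (B - j) * (poly (steps c) B + 2) + 1"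
        using b(1) by (subst (2) Suc_diff_Suc[symmetric]) auto
      ultimately show ?thesis by metis
    qed
  qed
  from this[OF init] show ?thesis unfolding ensures_def by simp
qed

abbreviation Var :: "string \<Rightarrow> iexp" where "Var x \<equiv> IGet x (INum 0)"

definition For :: "string \<Rightarrow> string \<Rightarrow> com \<Rightarrow> com" where
  "For x y c = Seq (ISet x (INum 0) (INum 0))
     (Loop (ILess (Var x) (Var y)) (Seq c (ISet x (INum 0) (IAdd (Var x) (INum 1)))))"

lemma writes_For [simp]:
  "iwrites (For x y c) = insert x (iwrites c)" "rwrites (For x y c) = rwrites c"
  by (auto simp: For_def)

text \<open>\<open>Inv_cong\<close> carries the invariant through the reset and the increment of the
  counter. The frame relative to the initial state \<open>s\<close> spares invariants from
  mentioning what the body leaves alone.\<close>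

lemma ensures_For:
  assumes y: "imem s y 0 = n" "n \<le> B" and vars: "x \<noteq> y" "x \<notin> iwrites c" "y \<notin> iwrites c"
    and Inv_cong: "\<And>k s v. Inv k s \<Longrightarrow> Inv k (iset s x 0 v)"
    and init: "Inv 0 s"
    and body: "\<And>k s'. k < n \<Longrightarrow> imem s' x 0 = k \<Longrightarrow> unchanged (For x y c) s s' \<Longrightarrow> Inv k s' \<Longrightarrow> ensures G B c (Inv (Suc k)) s'"
    and exit: "\<And>s'. imem s' x 0 = n \<Longrightarrow> unchanged (For x y c) s s' \<Longrightarrow> Inv n s' \<Longrightarrow> Q s'"
  shows "ensures G B (For x y c) Q s"
  unfolding For_def
proof (intro ensures_Seq ensures_ISet,
    rule ensures_Loop[where Inv = "\<lambda>k s'. k \<le> n \<and> imem s' x 0 = k \<and> unchanged (For x y c) s s' \<and> Inv k s'"])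
  fix k s' assume *: "k \<le> n \<and> imem s' x 0 = k \<and> unchanged (For x y c) s s' \<and> Inv k s'"
  have ys: "imem s' y 0 = n" using * vars y by (auto simp: unchanged_def)
  {
    assume "bval (ILess (Var x) (Var y)) s'"
    then have k: "k < n" using * ys by simp
    have "ensures G B (Seq c (ISet x (INum 0) (IAdd (Var x) (INum 1))))
      (\<lambda>s'. Suc k \<le> n \<and> imem s' x 0 = Suc k \<and> unchanged (For x y c) s s' \<and> Inv (Suc k) s') s'"
    proof (intro ensures_Seq ensures_conseq[OF body[OF k]] ensures_ISet)
      fix s'' assume "Inv (Suc k) s''" "unchanged c s' s''"
      then show "Suc k \<le> n \<and>
          imem (iset s'' x (ival (INum 0) s'') (ival (IAdd (Var x) (INum 1)) s'')) x 0 = Suc k \<and>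
          unchanged (For x y c) s (iset s'' x (ival (INum 0) s'') (ival (IAdd (Var x) (INum 1)) s'')) \<and>
          Inv (Suc k) (iset s'' x (ival (INum 0) s'') (ival (IAdd (Var x) (INum 1)) s''))"
        using * k vars Inv_cong by (auto simp: unchanged_def)
    qed (use * in auto)
    then show "k < B \<and> ensures G B (Seq c (ISet x (INum 0) (IAdd (Var x) (INum 1))))
      (\<lambda>s'. Suc k \<le> n \<and> imem s' x 0 = Suc k \<and> unchanged (For x y c) s s' \<and> Inv (Suc k) s') s'"
      using k y by simp
  next
    assume "\<not> bval (ILess (Var x) (Var y)) s'"
    then show "Q s'" using * ys exit by auto
  }
next
  show "0 \<le> n \<and> imem (iset s x (ival (INum 0) s) (ival (INum 0) s)) x 0 = 0 \<and>
    unchanged (For x y c) s (iset s x (ival (INum 0) s) (ival (INum 0) s)) \<and>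
    Inv 0 (iset s x (ival (INum 0) s) (ival (INum 0) s))"
    using init Inv_cong by (auto simp: unchanged_def)
qed

section \<open>The program and its correctness\<close>

notation Seq (infixr ";;" 60)

section \<open>Program text of the cycle search\<close>

abbreviation "cell k l \<equiv> IAdd (IGet ''o'' k) l"

abbreviation "assign x e \<equiv> ISet x (INum 0) e"
abbreviation "rassign x e \<equiv> RSet x (INum 0) e"
abbreviation "RVar x \<equiv> RGet x (INum 0)"

text \<open>Indices cannot be multiplied, so \<open>o\<close> and \<open>g\<close> tabulate the multiples of the numbers \<open>S\<close> of columns and
  \<open>R\<close> of rows. For the current source row \<open>i\<close>, the arrays \<open>e\<close> and \<open>d\<close> hold one layer of column and row
  distances; \<open>pm\<close> and \<open>pl\<close> hold the predecessors in all layers. The best closed walk found so far has mean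
  \<open>b\<close>, length \<open>bp\<close>, rows \<open>cr\<close> and columns \<open>cl\<close>; \<open>P\<close> is the real copy of the number of the layer.\<close>

definition relax_row :: com where
  "relax_row = assign ''z'' (INum 0) ;;
     For ''l'' ''S''
       (Cond (BAnd (RLess (RNum 0) (RGet ''sol'' (cell (Var ''j'') (Var ''l''))))
                (BNot (BAnd (ILess (INum 0) (Var ''z''))
                  (BNot (RLess (RSub (RGet ''e'' (Var ''l'')) (RGet ''cost'' (cell (Var ''j'') (Var ''l''))))
                               (RGet ''d'' (Var ''j'')))))))
         (RSet ''d'' (Var ''j'') (RSub (RGet ''e'' (Var ''l'')) (RGet ''cost'' (cell (Var ''j'') (Var ''l'')))) ;;
          ISet ''pl'' (IAdd (IGet ''g'' (Var ''p'')) (Var ''j'')) (Var ''l'') ;;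
          assign ''z'' (INum 1))
         Skip)"

text \<open>Every row has an edge to every column, so row 0 supplies the initial candidate.\<close>

definition relax_col :: com where
  "relax_col = RSet ''e'' (Var ''l'') (RAdd (RGet ''d'' (INum 0)) (RGet ''cost'' (cell (INum 0) (Var ''l'')))) ;;
     ISet ''pm'' (cell (IAdd (Var ''p'') (INum 1)) (Var ''l'')) (INum 0) ;;
     For ''j'' ''R''
       (Cond (RLess (RAdd (RGet ''d'' (Var ''j'')) (RGet ''cost'' (cell (Var ''j'') (Var ''l'')))) (RGet ''e'' (Var ''l'')))
         (RSet ''e'' (Var ''l'') (RAdd (RGet ''d'' (Var ''j'')) (RGet ''cost'' (cell (Var ''j'') (Var ''l'')))) ;;
          ISet ''pm'' (cell (IAdd (Var ''p'') (INum 1)) (Var ''l'')) (Var ''j''))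
         Skip)"

definition relax_rows :: com where "relax_rows = For ''j'' ''R'' relax_row"

definition relax_cols :: com where "relax_cols = For ''l'' ''S'' relax_col"

text \<open>The walk is recovered backwards: while \<open>n\<close> counts up, the layer
  \<open>p - n\<close> counts down, and \<open>cr\<close> and \<open>cl\<close> are filled from
  their ends.\<close>

definition trace :: com where
  "trace = assign ''bp'' (IAdd (Var ''p'') (INum 1)) ;;
     ISet ''cr'' (IAdd (Var ''p'') (INum 1)) (Var ''i'') ;;
     assign ''j'' (Var ''i'') ;;
     For ''n'' ''bp''
       (assign ''l'' (IGet ''pl'' (IAdd (IGet ''g'' (ISub (Var ''p'') (Var ''n''))) (Var ''j''))) ;;
        ISet ''cl'' (ISub (Var ''p'') (Var ''n'')) (Var ''l'') ;;
        assign ''j'' (IGet ''pm'' (cell (ISub (Var ''p'') (Var ''n'')) (Var ''l''))) ;;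
        ISet ''cr'' (ISub (Var ''p'') (Var ''n'')) (Var ''j''))"

text \<open>The strict comparison matters: a closed walk of equal mean never replaces the recorded
  one, which makes the recorded one simple.\<close>

definition update :: com where
  "update = Cond (RLess (RDiv (RGet ''d'' (Var ''i'')) (RVar ''P'')) (RVar ''b''))
     (rassign ''b'' (RDiv (RGet ''d'' (Var ''i'')) (RVar ''P'')) ;; trace) Skip"

definition search :: com where
  "search =
     For ''l'' ''S'' (RSet ''e'' (Var ''l'') (RGet ''cost'' (cell (Var ''i'') (Var ''l''))) ;;
       ISet ''pm'' (cell (INum 0) (Var ''l'')) (Var ''i'')) ;;
     rassign ''P'' (RNum 0) ;;
     For ''p'' ''R'' (rassign ''P'' (RAdd (RNum 1) (RVar ''P'')) ;; relax_rows ;; update ;; relax_cols)"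

definition scan :: com where
  "scan = rassign ''b'' (RNum 0) ;; For ''i'' ''R'' search"

text \<open>\<open>M\<close> scales all data into the ring \<open>Z\<close>, and \<open>C\<close>
  bounds the costs. All reals with \<open>M = 1\<close> and trivial \<open>G\<close> give the
  running time; the integers with a common denominator \<open>M\<close> give the encoding lengths.
  In \<open>goodI\<close>, \<open>m\<close> is the walk length in a mean, \<open>M ^ 3\<close> the
  denominator of a cost times two marginals, \<open>r * s\<close> counts the terms of the objective,
  and \<open>4 * r + 4\<close> covers distances and flows.\<close>

locale transport_machine = transport r s t a e
  for r s :: nat and t :: "nat \<Rightarrow> nat \<Rightarrow> real" and a e :: "nat \<Rightarrow> real" +
  fixes \<kappa> M C :: real and Z :: "real set" and G :: "real \<Rightarrow> bool" and B :: nat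
  assumes s_pos: "0 < s"
    and sums: "(\<Sum>k<r. a k) = 1" "(\<Sum>l<s. e l) = 1"
    and B: "r * s \<le> B" "r + s \<le> B" "(r * s + 1) * (2 * r * (4 * r + 1) * (r * s + 1)) + 1 < B"
    and Z: "x \<in> Z \<Longrightarrow> y \<in> Z \<Longrightarrow> x + y \<in> Z \<and> x - y \<in> Z \<and> x * y \<in> Z" and M: "1 \<in> Z" "M \<in> Z"
    and tZ: "k < r \<Longrightarrow> l < s \<Longrightarrow> t k l * M \<in> Z \<and> \<bar>t k l\<bar> \<le> C"
    and aZ: "k < r \<Longrightarrow> a k * M \<in> Z" and eZ: "l < s \<Longrightarrow> e l * M \<in> Z"
    and \<kappa>Z: "\<kappa> * M \<in> Z" "\<bar>\<kappa>\<bar> \<le> C" and C: "1 \<le> C"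
    and goodI: "1 \<le> m \<Longrightarrow> m \<le> r \<Longrightarrow> z * (real m * M ^ 3) \<in> Z \<Longrightarrow> \<bar>z\<bar> \<le> (r * s + 4 * r + 4) * C \<Longrightarrow> G z"
begin

section \<open>Denominators and magnitudes of intermediate reals\<close>

lemma of_int_Z: "of_int n \<in> Z"
proof (induction n rule: int_induct[where k = 0])
  case base
  show ?case using Z[OF M(1) M(1)] by simp
qed (use Z M(1) in auto)

lemma of_nat_Z: "of_nat n \<in> Z"
  using of_int_Z[of "int n"] by simp

lemma power_Z: "x \<in> Z \<Longrightarrow> x ^ n \<in> Z"
  by (induction n) (use M(1) Z in auto)

lemma sum_Z: "(\<And>x. x \<in> A \<Longrightarrow> f x \<in> Z) \<Longrightarrow> sum f A \<in> Z"
proof (induction A rule: infinite_finite_induct)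
  case (insert x A) then show ?case using Z by auto
qed (use of_int_Z[of 0] in auto)

text \<open>For input numbers and distances, whose denominator is \<open>M\<close>.\<close>

lemma goodI1:
  assumes "z * M \<in> Z" "\<bar>z\<bar> \<le> (4 * r + 4) * C"
  shows "G z"
proof (rule goodI[of 1])
  have "z * M * (M * M) \<in> Z" using assms(1) M(2) Z by blast
  then show "z * (real 1 * M ^ 3) \<in> Z" by (simp add: power3_eq_cube mult.assoc)
  have "(4 * real r + 4) * C \<le> (r * s + 4 * r + 4) * C" using C by (intro mult_right_mono) auto
  then show "\<bar>z\<bar> \<le> (r * s + 4 * r + 4) * C" using assms(2) by simp
qed (use r_pos in auto)

text \<open>For flows, whose denominator is \<open>M\<^sup>2\<close> and whose size does not depend
  on the costs.\<close>

lemma goodI2: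
  assumes "z * M\<^sup>2 \<in> Z" "\<bar>z\<bar> \<le> (4 * r + 4)"
  shows "G z"
proof (rule goodI[of 1])
  have "z * M\<^sup>2 * M \<in> Z" using assms(1) M(2) Z by blast
  then show "z * (real 1 * M ^ 3) \<in> Z" by (simp add: power3_eq_cube power2_eq_square mult.assoc)
  have "(4 * real r + 4) * 1 \<le> (r * s + 4 * r + 4) * C" using C by (intro mult_mono) auto
  then show "\<bar>z\<bar> \<le> (r * s + 4 * r + 4) * C" using assms(2) by simp
qed (use r_pos in auto)

lemma good_of_nat: "n \<le> r \<Longrightarrow> G (real n)"
  by (rule goodI2) (use of_nat_Z M(2) Z power_Z in auto)

lemma value_closed:
  assumes "feas q" "i < r"
  shows "l < s \<Longrightarrow> colv q i p l * M \<in> Z" "l < s \<Longrightarrow> \<bar>colv q i p l\<bar> \<le> (2 * real p + 1) * C"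
    "j < r \<Longrightarrow> rowv q i p j * M \<in> Z" "j < r \<Longrightarrow> \<bar>rowv q i p j\<bar> \<le> (2 * real p + 2) * C"
  using colv_rowv_closed[OF assms, where Z = Z and M = M and c = C and p = p] Z tZ by auto

lemma good_values:
  assumes "feas q" "i < r" "p < r" "j < r" "l < s"
  shows "G (colv q i p l - t j l)" "G (rowv q i p j + t j l)" "G (rowv q i p j / (1 + real p))"
proof -
  note v = value_closed[OF assms(1,2), where p = p]
  have tb: "\<bar>t j l\<bar> \<le> C" "t j l * M \<in> Z" using tZ assms by auto
  have C': "(2 * real p + 2) * C + C \<le> (4 * r + 4) * C"
  proof -
    have "(2 * real p + 3) * C \<le> (4 * r + 4) * C" using assms C by (intro mult_right_mono) auto
    then show ?thesis by (simp add: algebra_simps)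
  qed
  have CC: "(2 * real p + 1) * C \<le> (2 * real p + 2) * C" using C by (intro mult_right_mono) auto
  show "G (colv q i p l - t j l)"
  proof (rule goodI1)
    show "(colv q i p l - t j l) * M \<in> Z" using v(1)[OF assms(5)] tb(2) Z by (simp add: left_diff_distrib)
    show "\<bar>colv q i p l - t j l\<bar> \<le> (4 * r + 4) * C" using v(2)[OF assms(5)] tb C' CC by linarith
  qed
  show "G (rowv q i p j + t j l)"
  proof (rule goodI1)
    show "(rowv q i p j + t j l) * M \<in> Z" using v(3)[OF assms(4)] tb(2) Z by (simp add: distrib_right)
    show "\<bar>rowv q i p j + t j l\<bar> \<le> (4 * r + 4) * C" using v(4)[OF assms(4)] tb C' by linarith
  qed
  show "G (rowv q i p j / (1 + real p))"
  \<comment> \<open>Means are the only quotients the program computes; the divisor is the walk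
    length \<open>Suc p\<close>, at most \<open>r\<close>.\<close>
  proof (rule goodI[of "Suc p"])
    have "rowv q i p j * M * (M * M) \<in> Z" using v(3)[OF assms(4)] M(2) Z by blast
    then show "rowv q i p j / (1 + real p) * (real (Suc p) * M ^ 3) \<in> Z"
      by (simp add: power3_eq_cube mult.assoc add.commute)
    have "\<bar>rowv q i p j / (1 + real p)\<bar> \<le> \<bar>rowv q i p j\<bar>"
      by (simp add: abs_divide divide_le_eq mult_le_cancel_left1)
    moreover have "(4 * r + 4) * C \<le> (r * s + 4 * r + 4) * C" using C by (intro mult_right_mono) auto
    ultimately show "\<bar>rowv q i p j / (1 + real p)\<bar> \<le> (r * s + 4 * r + 4) * C"
      using v(4)[OF assms(4)] C' C by linarith
  qed (use assms in auto)
qed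

section \<open>Memory layout and one layer of the Bellman-Ford recursion\<close>

definition static :: "state \<Rightarrow> bool" where
  "static \<sigma> \<longleftrightarrow> imem \<sigma> ''R'' 0 = r \<and> imem \<sigma> ''S'' 0 = s \<and> imem \<sigma> ''cols'' 0 = r * s \<and>
     (\<forall>k<r + s. imem \<sigma> ''o'' k = k * s \<and> imem \<sigma> ''g'' k = k * r) \<and>
     (\<forall>k<r. \<forall>l<s. rmem \<sigma> ''cost'' (k * s + l) = t k l) \<and> rmem \<sigma> ''const'' 0 = \<kappa>"

definition cur :: "state \<Rightarrow> nat \<Rightarrow> nat \<Rightarrow> real" where
  "cur \<sigma> k l = rmem \<sigma> ''sol'' (k * s + l)"

lemma staticD:
  assumes "static \<sigma>"
  shows "imem \<sigma> ''R'' 0 = r" "imem \<sigma> ''S'' 0 = s" "imem \<sigma> ''cols'' 0 = r * s"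
    "k < r + s \<Longrightarrow> imem \<sigma> ''o'' k = k * s" "k < r + s \<Longrightarrow> imem \<sigma> ''g'' k = k * r"
    "k < r \<Longrightarrow> l < s \<Longrightarrow> rmem \<sigma> ''cost'' (k * s + l) = t k l" "rmem \<sigma> ''const'' 0 = \<kappa>"
  using assms by (auto simp: static_def)

lemma ensures_relax_row:
  assumes st: "static \<sigma>" and q: "cur \<sigma> = q" "feas q" and i: "i < r"
    and j: "imem \<sigma> ''j'' 0 = j" "j < r" and p: "imem \<sigma> ''p'' 0 = p" "p < r"
    and e: "\<forall>l<s. rmem \<sigma> ''e'' l = colv q i p l"
  shows "ensures G B relax_row (\<lambda>\<sigma>'. rmem \<sigma>' ''d'' = (rmem \<sigma> ''d'')(j := rowv q i p j) \<and>
    (\<exists>l. row_pred q i p j l \<and> imem \<sigma>' ''pl'' = (imem \<sigma> ''pl'')(p * r + j := l))) \<sigma>"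
  unfolding relax_row_def
proof (intro ensures_Seq ensures_ISet, rule ensures_For[where n = s and Inv = "\<lambda>k \<sigma>'.
    if imem \<sigma>' ''z'' 0 = 0 then (\<forall>l<k. \<not> 0 < q j l) \<and> rmem \<sigma>' ''d'' = rmem \<sigma> ''d'' \<and> imem \<sigma>' ''pl'' = imem \<sigma> ''pl''
    else \<exists>l<k. 0 < q j l \<and> (\<forall>l'<k. 0 < q j l' \<longrightarrow> colv q i p l - t j l \<le> colv q i p l' - t j l') \<and>
      rmem \<sigma>' ''d'' = (rmem \<sigma> ''d'')(j := colv q i p l - t j l) \<and> imem \<sigma>' ''pl'' = (imem \<sigma> ''pl'')(p * r + j := l)"], goal_cases)
  \<comment> \<open>Of the premises of \<open>ensures_For\<close>, the eighth is the loop body and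
    the ninth the exit, here and in the later loops.\<close>
  case (8 k \<sigma>')
  have im: "imem \<sigma>' x = imem \<sigma> x" if "x \<noteq> ''l''" "x \<noteq> ''z''" "x \<noteq> ''pl''" for x
    using that 8(3) by (simp add: unchanged_def)
  have rm: "rmem \<sigma>' x = rmem \<sigma> x" if "x \<noteq> ''d''" for x
    using that 8(3) by (simp add: unchanged_def)
  have vars: "imem \<sigma>' ''o'' j = j * s" "imem \<sigma>' ''j'' 0 = j" "imem \<sigma>' ''p'' 0 = p" "imem \<sigma>' ''g'' p = p * r"
    "rmem \<sigma>' ''e'' k = colv q i p k" "rmem \<sigma>' ''cost'' (j * s + k) = t j k" "rmem \<sigma>' ''sol'' (j * s + k) = q j k"
    using j p e 8(1) by (simp_all add: im rm staticD[OF st] q(1)[symmetric] cur_def)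
  show ?case
  proof (intro ensures_Cond ensures_Seq ensures_ISet ensures_RSet ensures_Skip, goal_cases)
    case 1
    then show ?case using good_values(1)[OF q(2) i p(2) j(2) 8(1)] by (simp add: vars 8(2))
  next
    case 2
    have w: "0 < q j k" "imem \<sigma>' ''z'' 0 = 0 \<or> colv q i p k - t j k < rmem \<sigma>' ''d'' j"
      using 2 by (auto simp: vars 8(2))
    \<comment> \<open>Whichever candidate was stored, or none at all, the new one beats all earlier
      used columns, and the old contents at \<open>j\<close> are overwritten.\<close>
    have "\<forall>l'<Suc k. 0 < q j l' \<longrightarrow> colv q i p k - t j k \<le> colv q i p l' - t j l'"
      and "\<exists>x y. rmem \<sigma>' ''d'' = (rmem \<sigma> ''d'')(j := x) \<and> imem \<sigma>' ''pl'' = (imem \<sigma> ''pl'')(p * r + j := y)"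
    proof -
      have "(\<forall>l'<k. 0 < q j l' \<longrightarrow> colv q i p k - t j k \<le> colv q i p l' - t j l') \<and>
        (\<exists>x y. rmem \<sigma>' ''d'' = (rmem \<sigma> ''d'')(j := x) \<and> imem \<sigma>' ''pl'' = (imem \<sigma> ''pl'')(p * r + j := y))"
      proof (cases "imem \<sigma>' ''z'' 0 = 0")
        case True
        then show ?thesis using 8(4) by (metis fun_upd_triv)
      next
        case False
        then obtain l where l: "\<forall>l'<k. 0 < q j l' \<longrightarrow> colv q i p l - t j l \<le> colv q i p l' - t j l'"
          "rmem \<sigma>' ''d'' = (rmem \<sigma> ''d'')(j := colv q i p l - t j l)" "imem \<sigma>' ''pl'' = (imem \<sigma> ''pl'')(p * r + j := l)"
          using 8(4) by auto
        then have "colv q i p k - t j k < colv q i p l - t j l" using w False by simp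
        then show ?thesis using l by fastforce
      qed
      then show "\<forall>l'<Suc k. 0 < q j l' \<longrightarrow> colv q i p k - t j k \<le> colv q i p l' - t j l'"
        "\<exists>x y. rmem \<sigma>' ''d'' = (rmem \<sigma> ''d'')(j := x) \<and> imem \<sigma>' ''pl'' = (imem \<sigma> ''pl'')(p * r + j := y)"
        by (auto simp: less_Suc_eq)
    qed
    then show ?case using w(1) by (auto simp: vars 8(2))
  next
    case 3
    then have w: "\<not> 0 < q j k \<or> imem \<sigma>' ''z'' 0 \<noteq> 0 \<and> rmem \<sigma>' ''d'' j \<le> colv q i p k - t j k"
      by (simp add: vars 8(2) not_less)
    show ?case
    proof (cases "imem \<sigma>' ''z'' 0 = 0")
      case True
      then show ?thesis using 8(4) w by (auto simp: less_Suc_eq)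
    next
      case False
      then obtain l where l: "l < k" "0 < q j l" "\<forall>l'<k. 0 < q j l' \<longrightarrow> colv q i p l - t j l \<le> colv q i p l' - t j l'"
          "rmem \<sigma>' ''d'' = (rmem \<sigma> ''d'')(j := colv q i p l - t j l)" "imem \<sigma>' ''pl'' = (imem \<sigma> ''pl'')(p * r + j := l)"
        using 8(4) by auto
      then have "\<forall>l'<Suc k. 0 < q j l' \<longrightarrow> colv q i p l - t j l \<le> colv q i p l' - t j l'"
        using w by (auto simp: less_Suc_eq)
      then show ?thesis unfolding if_not_P[OF False] using l by (intro exI[of _ l]) auto
    qed
  qed
next
  case (9 \<sigma>')
  show ?case
  proof (cases "imem \<sigma>' ''z'' 0 = 0")
    case True
    \<comment> \<open>The flag cannot stay 0, because every row carries flow.\<close>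
    then show ?thesis using 9(3) row_support[OF q(2) j(2)] by auto
  next
    case False
    then obtain l where l: "l < s" "0 < q j l" "\<And>l'. l' < s \<Longrightarrow> 0 < q j l' \<Longrightarrow> colv q i p l - t j l \<le> colv q i p l' - t j l'"
      "rmem \<sigma>' ''d'' = (rmem \<sigma> ''d'')(j := colv q i p l - t j l)" "imem \<sigma>' ''pl'' = (imem \<sigma> ''pl'')(p * r + j := l)"
      using 9(3) by auto
    have v: "rowv q i p j = colv q i p l - t j l" by (rule rowv_eqI[OF l(1-3)])
    then show ?thesis using l by (auto simp: row_pred_def)
  qed
qed (use st B(2) in \<open>auto simp: static_def\<close>)

lemma unchanged_imem: "unchanged c \<sigma> \<sigma>' \<Longrightarrow> x \<notin> iwrites c \<Longrightarrow> imem \<sigma>' x = imem \<sigma> x"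
  by (simp add: unchanged_def)

lemma unchanged_rmem: "unchanged c \<sigma> \<sigma>' \<Longrightarrow> x \<notin> rwrites c \<Longrightarrow> rmem \<sigma>' x = rmem \<sigma> x"
  by (simp add: unchanged_def)

lemma static_unchanged:
  assumes "unchanged c \<sigma> \<sigma>'" "static \<sigma>"
    "''R'' \<notin> iwrites c" "''S'' \<notin> iwrites c" "''cols'' \<notin> iwrites c" "''o'' \<notin> iwrites c" "''g'' \<notin> iwrites c"
    "''cost'' \<notin> rwrites c" "''const'' \<notin> rwrites c"
  shows "static \<sigma>'"
  using assms(2) by (simp add: static_def unchanged_imem[OF assms(1)] unchanged_rmem[OF assms(1)] assms(3-))

lemma ensures_relax_col:
  assumes st: "static \<sigma>" and q: "feas q" and i: "i < r"
    and l: "imem \<sigma> ''l'' 0 = l" "l < s" and p: "imem \<sigma> ''p'' 0 = p" "p < r"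
    and d: "\<forall>j<r. rmem \<sigma> ''d'' j = rowv q i p j"
  shows "ensures G B relax_col (\<lambda>\<sigma>'. rmem \<sigma>' ''e'' = (rmem \<sigma> ''e'')(l := colv q i (Suc p) l) \<and>
    (\<exists>j. col_pred q i (Suc p) l j \<and> imem \<sigma>' ''pm'' = (imem \<sigma> ''pm'')(Suc p * s + l := j))) \<sigma>"
  unfolding relax_col_def
proof (intro ensures_Seq ensures_ISet ensures_RSet, goal_cases)
  case 1
  then show ?case using good_values(2)[OF q i p(2) r_pos l(2)] staticD(4)[OF st, of 0] staticD(6)[OF st r_pos l(2)] r_pos d by (simp add: l)
next
  case 2
  \<comment> \<open>The table \<open>o\<close> is read up to index \<open>r\<close>, one past the
    rows; this index is below \<open>r + s\<close> because \<open>s\<close> is positive.\<close>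
  have o: "imem \<sigma> ''o'' 0 = 0" "imem \<sigma> ''o'' (Suc p) = Suc p * s" using staticD(4)[OF st] p s_pos by auto
  show ?case
  proof (rule ensures_For[where n = r and Inv = "\<lambda>k \<sigma>'. \<exists>j<r. (\<forall>j'<k. rowv q i p j + t j l \<le> rowv q i p j' + t j' l) \<and>
      rmem \<sigma>' ''e'' = (rmem \<sigma> ''e'')(l := rowv q i p j + t j l) \<and> imem \<sigma>' ''pm'' = (imem \<sigma> ''pm'')(Suc p * s + l := j)"], goal_cases)
    case 7
    have "rmem \<sigma> ''d'' 0 + rmem \<sigma> ''cost'' l = rowv q i p 0 + t 0 l" using d r_pos staticD(6)[OF st r_pos l(2)] by simp
    then show ?case using r_pos by (intro exI[of _ 0]) (simp add: p l o)
  next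
    case (8 k \<sigma>')
    have im: "imem \<sigma>' x = imem \<sigma> x" if "x \<noteq> ''j''" "x \<noteq> ''pm''" for x
      using that 8(3) by (simp add: unchanged_def)
    have rm: "rmem \<sigma>' x = rmem \<sigma> x" if "x \<noteq> ''e''" for x
      using that 8(3) by (simp add: unchanged_def)
    have vars: "imem \<sigma>' ''o'' k = k * s" "imem \<sigma>' ''o'' (Suc p) = Suc p * s" "imem \<sigma>' ''l'' 0 = l" "imem \<sigma>' ''p'' 0 = p"
      "rmem \<sigma>' ''d'' k = rowv q i p k" "rmem \<sigma>' ''cost'' (k * s + l) = t k l"
      using l p d 8(1) o by (simp_all add: im rm staticD[OF st])
    obtain j where j: "j < r" "\<forall>j'<k. rowv q i p j + t j l \<le> rowv q i p j' + t j' l"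
        "rmem \<sigma>' ''e'' = (rmem \<sigma> ''e'')(l := rowv q i p j + t j l)" "imem \<sigma>' ''pm'' = (imem \<sigma> ''pm'')(Suc p * s + l := j)"
      using 8(4) by blast
    show ?case
    proof (intro ensures_Cond ensures_Seq ensures_ISet ensures_RSet ensures_Skip, goal_cases)
      case 1
      then show ?case using good_values(2)[OF q i p(2) 8(1) l(2)] by (simp add: vars 8(2))
    next
      case 2
      then have "rowv q i p k + t k l < rowv q i p j + t j l" by (simp add: vars 8(2) j)
      then have "\<forall>j'<Suc k. rowv q i p k + t k l \<le> rowv q i p j' + t j' l" using j(2) by (auto simp: less_Suc_eq)
      then show ?case using 8(1) by (intro exI[of _ k]) (simp add: vars 8(2) j(3,4))
    next
      case 3
      then have "rowv q i p j + t j l \<le> rowv q i p k + t k l" by (simp add: vars 8(2) j)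
      then have "\<forall>j'<Suc k. rowv q i p j + t j l \<le> rowv q i p j' + t j' l" using j(2) by (auto simp: less_Suc_eq)
      then show ?case using j by blast
    qed
  next
    case (9 \<sigma>')
    then obtain j where j: "j < r" "\<forall>j'<r. rowv q i p j + t j l \<le> rowv q i p j' + t j' l"
        "rmem \<sigma>' ''e'' = (rmem \<sigma> ''e'')(l := rowv q i p j + t j l)" "imem \<sigma>' ''pm'' = (imem \<sigma> ''pm'')(Suc p * s + l := j)"
      by blast
    have "colv q i (Suc p) l = rowv q i p j + t j l" by (rule colv_eqI) (use j in auto)
    then show ?case using j by (auto simp: col_pred_def)
  qed (use st B(2) in \<open>auto simp: static_def\<close>)
qed

text \<open>The last clause protects the predecessors of earlier layers, which tracing reads
  later.\<close>

lemma ensures_relax_rows: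
  assumes st: "static \<sigma>" and q: "cur \<sigma> = q" "feas q" and i: "i < r"
    and p: "imem \<sigma> ''p'' 0 = p" "p < r"
    and e: "\<forall>l<s. rmem \<sigma> ''e'' l = colv q i p l"
  shows "ensures G B relax_rows (\<lambda>\<sigma>'. (\<forall>j<r. rmem \<sigma>' ''d'' j = rowv q i p j) \<and>
    (\<forall>j<r. row_pred q i p j (imem \<sigma>' ''pl'' (p * r + j))) \<and>
    (\<forall>x<p * r. imem \<sigma>' ''pl'' x = imem \<sigma> ''pl'' x)) \<sigma>"
  unfolding relax_rows_def
proof (rule ensures_For[where n = r and Inv = "\<lambda>k \<sigma>'. (\<forall>j<k. rmem \<sigma>' ''d'' j = rowv q i p j) \<and>
    (\<forall>j<k. row_pred q i p j (imem \<sigma>' ''pl'' (p * r + j))) \<and>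
    (\<forall>x<p * r. imem \<sigma>' ''pl'' x = imem \<sigma> ''pl'' x)"], goal_cases)
  case (8 k \<sigma>')
  note im = unchanged_imem[OF 8(3)] and rm = unchanged_rmem[OF 8(3)]
  have w: "iwrites relax_row = {''z'', ''l'', ''pl''}" "rwrites relax_row = {''d''}" by (auto simp: relax_row_def)
  have "static \<sigma>'" by (rule static_unchanged[OF 8(3) st]) (simp_all add: w)
  moreover have "cur \<sigma>' = q" using q(1) rm[of "''sol''"] by (simp add: w cur_def fun_eq_iff)
  ultimately show ?case
    by (rule ensures_conseq[OF ensures_relax_row[OF _ _ q(2) i 8(2) 8(1) _ p(2)]])
      (use 8(4) p(1) e in \<open>auto simp: im rm w less_Suc_eq\<close>)
qed (use st B(2) in \<open>auto simp: static_def relax_row_def\<close>)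

lemma ensures_relax_cols:
  assumes st: "static \<sigma>" and q: "feas q" and i: "i < r"
    and p: "imem \<sigma> ''p'' 0 = p" "p < r"
    and d: "\<forall>j<r. rmem \<sigma> ''d'' j = rowv q i p j"
  shows "ensures G B relax_cols (\<lambda>\<sigma>'. (\<forall>l<s. rmem \<sigma>' ''e'' l = colv q i (Suc p) l) \<and>
    (\<forall>l<s. col_pred q i (Suc p) l (imem \<sigma>' ''pm'' (Suc p * s + l))) \<and>
    (\<forall>x<Suc p * s. imem \<sigma>' ''pm'' x = imem \<sigma> ''pm'' x)) \<sigma>"
  unfolding relax_cols_def
proof (rule ensures_For[where n = s and Inv = "\<lambda>k \<sigma>'. (\<forall>l<k. rmem \<sigma>' ''e'' l = colv q i (Suc p) l) \<and>
    (\<forall>l<k. col_pred q i (Suc p) l (imem \<sigma>' ''pm'' (Suc p * s + l))) \<and>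
    (\<forall>x<Suc p * s. imem \<sigma>' ''pm'' x = imem \<sigma> ''pm'' x)"], goal_cases)
  case (8 k \<sigma>')
  note im = unchanged_imem[OF 8(3)] and rm = unchanged_rmem[OF 8(3)]
  have w: "iwrites relax_col = {''j'', ''pm''}" "rwrites relax_col = {''e''}" by (auto simp: relax_col_def)
  have "static \<sigma>'" by (rule static_unchanged[OF 8(3) st]) (simp_all add: w)
  then show ?case
    by (rule ensures_conseq[OF ensures_relax_col[OF _ q i 8(2) 8(1) _ p(2)]])
      (use 8(4) p(1) d in \<open>auto simp: im rm w less_Suc_eq\<close>)
qed (use st B(2) in \<open>auto simp: static_def relax_col_def\<close>)

text \<open>After \<open>k\<close> iterations the layers from \<open>Suc p - k\<close> on are
  recorded, and \<open>j\<close> is the row in which the part still to be traced ends.\<close>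

lemma ensures_trace:
  assumes st: "static \<sigma>"
    and i: "imem \<sigma> ''i'' 0 = i" "i < r" and p: "imem \<sigma> ''p'' 0 = p" "p < r"
    and rows: "\<And>n j. n \<le> p \<Longrightarrow> j < r \<Longrightarrow> row_pred q i n j (imem \<sigma> ''pl'' (n * r + j))"
    and cols: "\<And>n l. n \<le> p \<Longrightarrow> l < s \<Longrightarrow> col_pred q i n l (imem \<sigma> ''pm'' (n * s + l))"
  shows "ensures G B trace (\<lambda>\<sigma>'. imem \<sigma>' ''bp'' 0 = Suc p \<and> imem \<sigma>' ''cr'' (Suc p) = i \<and>
    (\<forall>n\<le>p. row_pred q i n (imem \<sigma>' ''cr'' (Suc n)) (imem \<sigma>' ''cl'' n) \<and> col_pred q i n (imem \<sigma>' ''cl'' n) (imem \<sigma>' ''cr'' n))) \<sigma>"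
  unfolding trace_def
proof (intro ensures_Seq ensures_ISet, rule ensures_For[where n = "Suc p" and Inv = "\<lambda>k \<sigma>'. imem \<sigma>' ''cr'' (Suc p) = i \<and>
    imem \<sigma>' ''j'' 0 = imem \<sigma>' ''cr'' (Suc p - k) \<and> imem \<sigma>' ''j'' 0 < r \<and>
    (\<forall>n\<le>p. Suc p - k \<le> n \<longrightarrow> row_pred q i n (imem \<sigma>' ''cr'' (Suc n)) (imem \<sigma>' ''cl'' n) \<and> col_pred q i n (imem \<sigma>' ''cl'' n) (imem \<sigma>' ''cr'' n))"], goal_cases)
  case (8 k \<sigma>')
  have im: "imem \<sigma>' x = imem \<sigma> x" if "x \<noteq> ''j''" "x \<noteq> ''l''" "x \<noteq> ''bp''" "x \<noteq> ''cl''" "x \<noteq> ''cr''" "x \<noteq> ''n''" for x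
    using that 8(3) by (simp add: unchanged_def)
  define m where "m = p - k"
  have m: "Suc p - k = Suc m" "p - k = m" "m \<le> p" "Suc p - Suc k = m" using 8(1) by (auto simp: m_def)
  define j where "j = imem \<sigma>' ''j'' 0"
  have j: "imem \<sigma>' ''cr'' (Suc m) = j" "j < r" using 8(4) by (auto simp: m j_def)
  define l where "l = imem \<sigma> ''pl'' (m * r + j)"
  define j' where "j' = imem \<sigma> ''pm'' (m * s + l)"
  have l: "row_pred q i m j l" unfolding l_def by (rule rows) (use m j in auto)
  then have ls: "l < s" by (simp add: row_pred_def)
  have j': "col_pred q i m l j'" unfolding j'_def by (rule cols) (use m ls in auto)
  have "j' < r" using j' by (simp add: col_pred_def)
  have vars: "imem \<sigma>' ''p'' 0 = p" "imem \<sigma>' ''g'' m = m * r" "imem \<sigma>' ''o'' m = m * s" "imem \<sigma>' ''pl'' (m * r + j) = l"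
      "imem \<sigma>' ''pm'' (m * s + l) = j'"
    using p m by (simp_all add: im staticD[OF st] l_def j'_def)
  show ?case
  proof (intro ensures_Seq ensures_ISet, goal_cases)
    case 1
    have "row_pred q i n (imem \<sigma>' ''cr'' (Suc n)) (imem \<sigma>' ''cl'' n) \<and> col_pred q i n (imem \<sigma>' ''cl'' n) (imem \<sigma>' ''cr'' n)"
      if "n \<le> p" "m < n" for n using 8(4) that by (simp add: m)
    note old = this
    have "\<forall>n\<le>p. m \<le> n \<longrightarrow> row_pred q i n (((imem \<sigma>' ''cr'')(m := j')) (Suc n)) (((imem \<sigma>' ''cl'')(m := l)) n) \<and>
        col_pred q i n (((imem \<sigma>' ''cl'')(m := l)) n) (((imem \<sigma>' ''cr'')(m := j')) n)"
    proof (intro allI impI)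
      fix n assume "n \<le> p" "m \<le> n"
      then show "row_pred q i n (((imem \<sigma>' ''cr'')(m := j')) (Suc n)) (((imem \<sigma>' ''cl'')(m := l)) n) \<and>
          col_pred q i n (((imem \<sigma>' ''cl'')(m := l)) n) (((imem \<sigma>' ''cr'')(m := j')) n)"
        using old[of n] l j' j(1) by (cases "n = m") simp_all
    qed
    moreover have "Suc p \<noteq> m" using m by simp
    ultimately show ?case using conjunct1[OF 8(4)] \<open>j' < r\<close> by (simp add: 8(2) vars m j_def[symmetric])
  qed
next
  case (9 \<sigma>')
  then show ?case using unchanged_imem[OF 9(2), of "''bp''"] p by simp
qed (use i p st B(2) in \<open>auto simp: static_def\<close>)
end

section \<open>Augmentation along the recorded cycle and the outer loop\<close>

definition augment :: com where
  "augment =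
     rassign ''h'' (RGet ''sol'' (cell (IGet ''cr'' (INum 1)) (IGet ''cl'' (INum 0)))) ;;
     For ''n'' ''bp''
       (Cond (RLess (RGet ''sol'' (cell (IGet ''cr'' (IAdd (Var ''n'') (INum 1))) (IGet ''cl'' (Var ''n'')))) (RVar ''h''))
         (rassign ''h'' (RGet ''sol'' (cell (IGet ''cr'' (IAdd (Var ''n'') (INum 1))) (IGet ''cl'' (Var ''n''))))) Skip) ;;
     For ''n'' ''bp''
       (RSet ''sol'' (cell (IGet ''cr'' (Var ''n'')) (IGet ''cl'' (Var ''n'')))
          (RAdd (RGet ''sol'' (cell (IGet ''cr'' (Var ''n'')) (IGet ''cl'' (Var ''n'')))) (RVar ''h'')) ;;
        RSet ''sol'' (cell (IGet ''cr'' (IAdd (Var ''n'') (INum 1))) (IGet ''cl'' (Var ''n'')))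
          (RSub (RGet ''sol'' (cell (IGet ''cr'' (IAdd (Var ''n'') (INum 1))) (IGet ''cl'' (Var ''n'')))) (RVar ''h'')))"

definition main_loop :: com where
  "main_loop = assign ''go'' (INum 1) ;;
     Loop (ILess (INum 0) (Var ''go''))
       (scan ;; Cond (RLess (RVar ''b'') (RNum 0)) augment (assign ''go'' (INum 0)))"

section \<open>The scan finds a simple cycle of least mean\<close>

context transport_machine
begin

text \<open>The strictness in the last clause is the one that \<open>min_mean_cycleI\<close> turns
  into simplicity of the cycle.\<close>

definition shortest :: "(nat \<Rightarrow> nat \<Rightarrow> real) \<Rightarrow> real \<Rightarrow> (nat \<Rightarrow> nat) \<Rightarrow> (nat \<Rightarrow> nat) \<Rightarrow> nat \<Rightarrow> bool" where
  "shortest q b f g m \<longleftrightarrow> 0 < m \<and> m \<le> r \<and> walk q f g m \<and> f m = f 0 \<and> weight f g m = b * m \<and>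
     (\<forall>f' g' p'. 0 < p' \<longrightarrow> p' < m \<longrightarrow> walk q f' g' p' \<longrightarrow> f' 0 = f 0 \<longrightarrow> f' p' = f 0 \<longrightarrow> b * p' < weight f' g' p')"

text \<open>\<open>X\<close> collects the inspected pairs of source row and layer. Layer
  \<open>p\<close> belongs to closed walks of length \<open>p + 1\<close>, whence the factor
  \<open>1 + real p\<close>. As the search starts from mean 0, only negative cycles are
  recorded.\<close>

definition best :: "(nat \<Rightarrow> nat \<Rightarrow> real) \<Rightarrow> state \<Rightarrow> (nat \<times> nat) set \<Rightarrow> bool" where
  "best q \<sigma> X \<longleftrightarrow> rmem \<sigma> ''b'' 0 \<le> 0 \<and>
     (rmem \<sigma> ''b'' 0 < 0 \<longrightarrow> shortest q (rmem \<sigma> ''b'' 0) (imem \<sigma> ''cr'') (imem \<sigma> ''cl'') (imem \<sigma> ''bp'' 0)) \<and>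
     (\<forall>(i, p) \<in> X. rmem \<sigma> ''b'' 0 * (1 + real p) \<le> rowv q i p i)"

lemma best_unchanged:
  assumes "unchanged c \<sigma> \<sigma>'" "''cr'' \<notin> iwrites c" "''cl'' \<notin> iwrites c" "''bp'' \<notin> iwrites c" "''b'' \<notin> rwrites c"
  shows "best q \<sigma>' X = best q \<sigma> X"
  unfolding best_def by (simp add: unchanged_imem[OF assms(1)] unchanged_rmem[OF assms(1)] assms(2-))

text \<open>A replacement has a mean strictly below the old one and thus below those of all pairs in
  \<open>X\<close>. By \<open>seen\<close>, these include all shorter lengths from the same source,
  so the traced walk is \<open>shortest\<close>.\<close>

lemma ensures_update:
  assumes st: "static \<sigma>" and q: "feas q"
    and i: "imem \<sigma> ''i'' 0 = i" "i < r" and p: "imem \<sigma> ''p'' 0 = p" "p < r"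
    and d: "rmem \<sigma> ''d'' i = rowv q i p i" and P: "rmem \<sigma> ''P'' 0 = 1 + real p"
    and rows: "\<And>n j. n \<le> p \<Longrightarrow> j < r \<Longrightarrow> row_pred q i n j (imem \<sigma> ''pl'' (n * r + j))"
    and cols: "\<And>n l. n \<le> p \<Longrightarrow> l < s \<Longrightarrow> col_pred q i n l (imem \<sigma> ''pm'' (n * s + l))"
    and best: "best q \<sigma> X" and seen: "\<And>n. n < p \<Longrightarrow> (i, n) \<in> X"
  shows "ensures G B update (\<lambda>\<sigma>'. best q \<sigma>' (insert (i, p) X)) \<sigma>"
  unfolding update_def
proof (intro ensures_Cond ensures_Seq ensures_RSet ensures_Skip, goal_cases)
  case 1
  then show ?case using good_values(3)[OF q i(2) p(2) i(2) s_pos] by (simp add: i d P)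
next
  case 2
  let ?b = "rowv q i p i / (1 + real p)"
  have less: "?b < rmem \<sigma> ''b'' 0" using 2 by (simp add: i d P)
  let ?\<sigma> = "rset \<sigma> ''b'' 0 ?b"
  have eq: "rset \<sigma> ''b'' (ival (INum 0) \<sigma>) (rval (RDiv (RGet ''d'' (Var ''i'')) (RVar ''P'')) \<sigma>) = ?\<sigma>"
    by (simp add: i d P)
  have st': "static ?\<sigma>" using st by (simp add: static_def)
  show ?case unfolding eq
  proof (rule ensures_conseq[OF ensures_trace[OF st', where q = q and i = i and p = p]])
    fix \<sigma>' assume u: "unchanged trace ?\<sigma> \<sigma>'" and
      t: "imem \<sigma>' ''bp'' 0 = Suc p \<and> imem \<sigma>' ''cr'' (Suc p) = i \<and>
        (\<forall>n\<le>p. row_pred q i n (imem \<sigma>' ''cr'' (Suc n)) (imem \<sigma>' ''cl'' n) \<and> col_pred q i n (imem \<sigma>' ''cl'' n) (imem \<sigma>' ''cr'' n))"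
    have b: "rmem \<sigma>' ''b'' 0 = ?b" using unchanged_rmem[OF u, of "''b''"] by (simp add: trace_def)
    let ?f = "imem \<sigma>' ''cr''" and ?g = "imem \<sigma>' ''cl''"
    have tw: "walk q ?f ?g (Suc p)" "?f 0 = i" "weight ?f ?g (Suc p) = rowv q i p i" "?f (Suc p) = i"
      using traced_walk[where q = q and i = i and p = p and f = ?f and g = ?g] t i by auto
    have b0: "?b < 0" using less best by (auto simp: best_def)
    have ge: "?b * (1 + real n) < rowv q k n k" if "(k, n) \<in> X" for k n
    proof -
      have "?b * (1 + real n) < rmem \<sigma> ''b'' 0 * (1 + real n)" using less by (intro mult_strict_right_mono) auto
      also have "\<dots> \<le> rowv q k n k" using best that by (auto simp: best_def)
      finally show ?thesis .
    qed
    have "shortest q ?b ?f ?g (Suc p)"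
      unfolding shortest_def
    proof (intro conjI allI impI)
      fix f' g' p' assume w: "0 < p'" "p' < Suc p" "walk q f' g' p'" "f' 0 = ?f 0" "f' p' = ?f 0"
      then obtain n where n: "p' = Suc n" by (cases p') auto
      have "?b * (1 + real n) < rowv q i n i" using ge seen n w by auto
      also have "\<dots> \<le> weight f' g' p'" using rowv_le_weight[of q f' g' n i] w n tw by auto
      finally show "?b * real p' < weight f' g' p'" using n by simp
    qed (use tw p in auto)
    then show "best q \<sigma>' (insert (i, p) X)"
      using b0 ge t by (auto simp: best_def b less_imp_le)
  qed (use i p rows cols in auto)
next
  case 3
  then have "rmem \<sigma> ''b'' 0 \<le> rowv q i p i / (1 + real p)" by (simp add: i d P)
  then have "rmem \<sigma> ''b'' 0 * (1 + real p) \<le> rowv q i p i" by (simp add: pos_le_divide_eq)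
  then show ?case using best by (auto simp: best_def)
qed

lemma ensures_search:
  assumes st: "static \<sigma>" and q: "cur \<sigma> = q" "feas q"
    and i: "imem \<sigma> ''i'' 0 = i" "i < r" and best: "best q \<sigma> X"
  shows "ensures G B search (\<lambda>\<sigma>'. best q \<sigma>' (X \<union> {i} \<times> {..<r})) \<sigma>"
  unfolding search_def
proof (intro ensures_Seq, rule ensures_For[where n = s and Inv = "\<lambda>k \<sigma>'. \<forall>l<k. rmem \<sigma>' ''e'' l = t i l \<and> imem \<sigma>' ''pm'' l = i"], goal_cases)
  case (8 k \<sigma>')
  have im: "imem \<sigma>' x = imem \<sigma> x" if "x \<noteq> ''l''" "x \<noteq> ''pm''" for x
    using that 8(3) by (simp add: unchanged_def)
  have rm: "rmem \<sigma>' x = rmem \<sigma> x" if "x \<noteq> ''e''" for x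
    using that 8(3) by (simp add: unchanged_def)
  have vars: "imem \<sigma>' ''o'' i = i * s" "imem \<sigma>' ''o'' 0 = 0" "imem \<sigma>' ''i'' 0 = i" "rmem \<sigma>' ''cost'' (i * s + k) = t i k"
    using i 8(1) by (simp_all add: im rm staticD[OF st])
  have "G (t i k)"
  proof (rule goodI1)
    have "1 * C \<le> (4 * r + 4) * C" using C by (intro mult_right_mono) auto
    then show "\<bar>t i k\<bar> \<le> (4 * r + 4) * C" using tZ[OF i(2) 8(1)] by linarith
  qed (use tZ[OF i(2) 8(1)] in simp)
  then show ?case
    by (intro ensures_Seq ensures_RSet ensures_ISet) (use 8(4) in \<open>auto simp: vars 8(2) less_Suc_eq\<close>)
next
  case (9 \<sigma>1)
  have im1: "imem \<sigma>1 x = imem \<sigma> x" if "x \<noteq> ''l''" "x \<noteq> ''pm''" for x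
    using that 9(2) by (simp add: unchanged_def)
  have rm1: "rmem \<sigma>1 x = rmem \<sigma> x" if "x \<noteq> ''e''" for x
    using that 9(2) by (simp add: unchanged_def)
  have w: "iwrites relax_rows = {''j'', ''z'', ''l'', ''pl''}" "rwrites relax_rows = {''d''}"
    "iwrites relax_cols = {''l'', ''j'', ''pm''}" "rwrites relax_cols = {''e''}"
    "iwrites update = {''bp'', ''cr'', ''cl'', ''j'', ''l'', ''n''}" "rwrites update = {''b''}"
    by (auto simp: relax_rows_def relax_row_def relax_cols_def relax_col_def update_def trace_def)
  show ?case
  proof (intro ensures_Seq ensures_RSet, goal_cases)
    case 1 show ?case using good_of_nat[of 0] by simp
  next
    case 2
    show ?case
    proof (rule ensures_For[where n = r and Inv = "\<lambda>k \<sigma>'. rmem \<sigma>' ''P'' 0 = real k \<and>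
        (\<forall>l<s. rmem \<sigma>' ''e'' l = colv q i k l) \<and>
        (\<forall>n<k. \<forall>j<r. row_pred q i n j (imem \<sigma>' ''pl'' (n * r + j))) \<and>
        (\<forall>n\<le>k. \<forall>l<s. col_pred q i n l (imem \<sigma>' ''pm'' (n * s + l))) \<and> best q \<sigma>' (X \<union> {i} \<times> {..<k})"], goal_cases)
      case (6 k \<sigma>' v) then show ?case by (simp add: best_def)
    next
      case 7
      have "best q \<sigma>1 X" using best by (simp add: best_def im1 rm1)
      then show ?case using 9(3) i by (simp add: col_pred_def best_def)
    next
      case (8 k \<sigma>2)
      have k: "k < r" "imem \<sigma>2 ''p'' 0 = k" using 8 by auto
      have im2: "imem \<sigma>2 x = imem \<sigma> x" if "x \<notin> {''l'', ''pm'', ''p'', ''j'', ''z'', ''pl'', ''bp'', ''cr'', ''cl'', ''n''}" for x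
        using that 8(3) im1 by (simp add: unchanged_def w)
      have rm2: "rmem \<sigma>2 x = rmem \<sigma> x" if "x \<notin> {''e'', ''P'', ''d'', ''b''}" for x
        using that 8(3) rm1 by (simp add: unchanged_def w)
      have e2: "\<forall>l<s. rmem \<sigma>2 ''e'' l = colv q i k l" and
        pl2: "\<And>n j. n < k \<Longrightarrow> j < r \<Longrightarrow> row_pred q i n j (imem \<sigma>2 ''pl'' (n * r + j))" and
        pm2: "\<And>n l. n \<le> k \<Longrightarrow> l < s \<Longrightarrow> col_pred q i n l (imem \<sigma>2 ''pm'' (n * s + l))" and
        b2: "best q \<sigma>2 (X \<union> {i} \<times> {..<k})" and P2: "rmem \<sigma>2 ''P'' 0 = real k"
        using 8(4) by auto
      let ?\<sigma>3 = "rset \<sigma>2 ''P'' 0 (1 + real k)"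
      have st3: "static ?\<sigma>3" using st by (simp add: static_def im2 rm2)
      have q3: "cur ?\<sigma>3 = q" using q(1) by (auto simp: cur_def rm2 fun_eq_iff)
      show ?case
      proof (intro ensures_Seq ensures_RSet, goal_cases)
        case 1 show ?case using good_of_nat[of "Suc k"] k by (simp add: P2)
      next
        case 2
        have eq: "rset \<sigma>2 ''P'' (ival (INum 0) \<sigma>2) (rval (RAdd (RNum 1) (RVar ''P'')) \<sigma>2) = ?\<sigma>3" by (simp add: P2)
        show ?case unfolding eq
        proof (rule ensures_conseq[OF ensures_relax_rows[OF st3 q3 q(2) i(2), where p = k]], goal_cases)
          case (4 \<sigma>4)
          note r4 = 4(1) and u4 = 4(2)
          have st4: "static \<sigma>4" by (rule static_unchanged[OF u4 st3]) (simp_all add: w)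
          have b4: "best q \<sigma>4 (X \<union> {i} \<times> {..<k})"
            unfolding best_unchanged[OF u4, unfolded w, simplified] using b2 by (simp add: best_def)
          have im4: "imem \<sigma>4 ''p'' 0 = k" "imem \<sigma>4 ''i'' 0 = i" "imem \<sigma>4 ''pm'' = imem \<sigma>2 ''pm''"
            using unchanged_imem[OF u4] k i by (simp_all add: w im2)
          have rm4: "rmem \<sigma>4 ''P'' 0 = 1 + real k" "rmem \<sigma>4 ''e'' = rmem \<sigma>2 ''e''"
            using unchanged_rmem[OF u4] by (simp_all add: w)
          have pl4: "row_pred q i n j (imem \<sigma>4 ''pl'' (n * r + j))" if "n \<le> k" "j < r" for n j
          proof (cases "n = k")
            case False
            then have "Suc n \<le> k" using that by simp
            then have "Suc n * r \<le> k * r" by (rule mult_le_mono1)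
            then have "n * r + j < k * r" using that by simp
            then show ?thesis using r4 pl2 that False by simp
          qed (use r4 that in simp)
          have rest: "ensures G B relax_cols (\<lambda>\<sigma>'. rmem \<sigma>' ''P'' 0 = real (Suc k) \<and>
              (\<forall>l<s. rmem \<sigma>' ''e'' l = colv q i (Suc k) l) \<and>
              (\<forall>n<Suc k. \<forall>j<r. row_pred q i n j (imem \<sigma>' ''pl'' (n * r + j))) \<and>
              (\<forall>n\<le>Suc k. \<forall>l<s. col_pred q i n l (imem \<sigma>' ''pm'' (n * s + l))) \<and> best q \<sigma>' (X \<union> {i} \<times> {..<Suc k})) \<sigma>5"
            if u5: "unchanged update \<sigma>4 \<sigma>5" and b5: "best q \<sigma>5 (insert (i, k) (X \<union> {i} \<times> {..<k}))" for \<sigma>5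
          proof -
            have st5: "static \<sigma>5" by (rule static_unchanged[OF u5 st4]) (simp_all add: w)
            have im5: "imem \<sigma>5 ''p'' 0 = k" "imem \<sigma>5 ''pm'' = imem \<sigma>2 ''pm''" "imem \<sigma>5 ''pl'' = imem \<sigma>4 ''pl''"
              using unchanged_imem[OF u5] im4 by (simp_all add: w)
            have rm5: "rmem \<sigma>5 ''P'' 0 = 1 + real k" "rmem \<sigma>5 ''d'' = rmem \<sigma>4 ''d''"
              using unchanged_rmem[OF u5] rm4 by (simp_all add: w)
            have X: "insert (i, k) (X \<union> {i} \<times> {..<k}) = X \<union> {i} \<times> {..<Suc k}" by auto
            show ?thesis
            proof (rule ensures_conseq[OF ensures_relax_cols[OF st5 q(2) i(2) im5(1) k(1)]])
              fix \<sigma>6 assume u6: "unchanged relax_cols \<sigma>5 \<sigma>6" and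
                c6: "(\<forall>l<s. rmem \<sigma>6 ''e'' l = colv q i (Suc k) l) \<and>
                  (\<forall>l<s. col_pred q i (Suc k) l (imem \<sigma>6 ''pm'' (Suc k * s + l))) \<and>
                  (\<forall>x<Suc k * s. imem \<sigma>6 ''pm'' x = imem \<sigma>5 ''pm'' x)"
              have "best q \<sigma>6 (X \<union> {i} \<times> {..<Suc k})"
                unfolding best_unchanged[OF u6, unfolded w, simplified] using b5 X by simp
              moreover have "rmem \<sigma>6 ''P'' 0 = real (Suc k)" using unchanged_rmem[OF u6] rm5 by (simp add: w)
              moreover have "imem \<sigma>6 ''pl'' = imem \<sigma>4 ''pl''" using unchanged_imem[OF u6] im5 by (simp add: w)
              moreover have "col_pred q i n l (imem \<sigma>6 ''pm'' (n * s + l))" if "n \<le> Suc k" "l < s" for n l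
              proof (cases "n = Suc k")
                case False
                then have "Suc n \<le> Suc k" using that by simp
                then have "Suc n * s \<le> Suc k * s" by (rule mult_le_mono1)
                moreover have "n * s + l < Suc n * s" using that by simp
                ultimately have "n * s + l < Suc k * s" by linarith
                then have "imem \<sigma>6 ''pm'' (n * s + l) = imem \<sigma>2 ''pm'' (n * s + l)" using c6 im5(2) by simp
                then show ?thesis using pm2[of n l] that False by simp
              qed (use c6 that in simp)
              ultimately show "rmem \<sigma>6 ''P'' 0 = real (Suc k) \<and>
                (\<forall>l<s. rmem \<sigma>6 ''e'' l = colv q i (Suc k) l) \<and>
                (\<forall>n<Suc k. \<forall>j<r. row_pred q i n j (imem \<sigma>6 ''pl'' (n * r + j))) \<and>
                (\<forall>n\<le>Suc k. \<forall>l<s. col_pred q i n l (imem \<sigma>6 ''pm'' (n * s + l))) \<and> best q \<sigma>6 (X \<union> {i} \<times> {..<Suc k})"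
                using c6 pl4 by simp
            qed (use r4 rm5 in simp)
          qed
          have d4: "rmem \<sigma>4 ''d'' i = rowv q i k i" using r4 i by simp
          have pm4: "col_pred q i n l (imem \<sigma>4 ''pm'' (n * s + l))" if "n \<le> k" "l < s" for n l
            using pm2[OF that] by (simp add: im4)
          show ?case
          proof (rule ensures_Seq, rule ensures_conseq[OF ensures_update[where q = q and i = i and p = k and X = "X \<union> {i} \<times> {..<k}"]])
            fix \<sigma>5 assume "best q \<sigma>5 (insert (i, k) (X \<union> {i} \<times> {..<k}))" "unchanged update \<sigma>4 \<sigma>5"
            then show "ensures G B relax_cols (\<lambda>\<sigma>'. rmem \<sigma>' ''P'' 0 = real (Suc k) \<and>
              (\<forall>l<s. rmem \<sigma>' ''e'' l = colv q i (Suc k) l) \<and>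
              (\<forall>n<Suc k. \<forall>j<r. row_pred q i n j (imem \<sigma>' ''pl'' (n * r + j))) \<and>
              (\<forall>n\<le>Suc k. \<forall>l<s. col_pred q i n l (imem \<sigma>' ''pm'' (n * s + l))) \<and> best q \<sigma>' (X \<union> {i} \<times> {..<Suc k})) \<sigma>5"
              by (intro rest)
          qed (use st4 q(2) im4 i(2) k(1) rm4(1) pl4 b4 d4 pm4 in auto)
        qed (use k e2 in auto)
      qed
    next
      case (9 \<sigma>')
      then show ?case by simp
    qed (use st B(2) in \<open>auto simp: static_def im1 w\<close>)
  qed
qed (use st B(2) in \<open>auto simp: static_def\<close>)

lemma ensures_scan:
  assumes st: "static \<sigma>" and q: "cur \<sigma> = q" "feas q"
  shows "ensures G B scan (\<lambda>\<sigma>'. best q \<sigma>' ({..<r} \<times> {..<r})) \<sigma>"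
  unfolding scan_def
proof (intro ensures_Seq ensures_RSet, goal_cases)
  case 1 show ?case using good_of_nat[of 0] by simp
next
  case 2
  have w: "iwrites search = {''l'', ''pm'', ''p'', ''j'', ''z'', ''pl'', ''bp'', ''cr'', ''cl'', ''n''}"
    "rwrites search = {''e'', ''P'', ''d'', ''b''}"
    by (auto simp: search_def relax_rows_def relax_row_def relax_cols_def relax_col_def update_def trace_def)
  show ?case
  proof (rule ensures_For[where n = r and Inv = "\<lambda>k \<sigma>'. best q \<sigma>' ({..<k} \<times> {..<r})"], goal_cases)
    case (8 k \<sigma>')
    have "static (rset \<sigma> ''b'' 0 0)" using st by (simp add: static_def)
    then have st': "static \<sigma>'" by (intro static_unchanged[OF 8(3)]) (simp_all add: w)
    have q': "cur \<sigma>' = q" using q(1) unchanged_rmem[OF 8(3), of "''sol''"] by (simp add: w cur_def fun_eq_iff)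
    have X: "{..<k} \<times> {..<r} \<union> {k} \<times> {..<r} = {..<Suc k} \<times> {..<r}" by auto
    show ?case using ensures_search[OF st' q' q(2) 8(2,1,4)] by (simp only: X)
  qed (use st B(2) in \<open>auto simp: static_def best_def w\<close>)
qed

text \<open>All sources and all lengths up to \<open>r\<close> having been inspected, the recorded
  mean bounds every short closed walk from below, which suffices for potentials. A recorded mean of
  0 thus certifies optimality.\<close>

lemma best_near_opt:
  assumes q: "feas q" and b: "best q \<sigma> ({..<r} \<times> {..<r})"
  shows "rmem \<sigma> ''b'' 0 < 0 \<Longrightarrow>
      min_mean_cycle q (- rmem \<sigma> ''b'' 0 / 2) (imem \<sigma> ''cr'') (imem \<sigma> ''cl'') (imem \<sigma> ''bp'' 0)"
    "\<not> rmem \<sigma> ''b'' 0 < 0 \<Longrightarrow> \<exists>u v. near_opt q 0 u v"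
proof -
  have all: "rmem \<sigma> ''b'' 0 * p \<le> weight f g p" if w: "0 < p" "p \<le> r" "walk q f g p" "f p = f 0" for f g p
  proof -
    obtain n where n: "p = Suc n" using w by (cases p) auto
    have "f 0 < r" using w by (auto simp: walk_def)
    then have "rmem \<sigma> ''b'' 0 * (1 + real n) \<le> rowv q (f 0) n (f 0)" using b n w by (auto simp: best_def)
    also have "\<dots> \<le> weight f g p" using rowv_le_weight[of q f g n "f 0"] w n by simp
    finally show ?thesis using n by simp
  qed
  show "\<exists>u v. near_opt q 0 u v" if "\<not> rmem \<sigma> ''b'' 0 < 0"
  proof -
    have "rmem \<sigma> ''b'' 0 = 0" using that b by (simp add: best_def)
    then show ?thesis using all by (intro near_opt_exists[OF q]) auto
  qed
  show "min_mean_cycle q (- rmem \<sigma> ''b'' 0 / 2) (imem \<sigma> ''cr'') (imem \<sigma> ''cl'') (imem \<sigma> ''bp'' 0)" if neg: "rmem \<sigma> ''b'' 0 < 0"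
  proof -
    have "shortest q (rmem \<sigma> ''b'' 0) (imem \<sigma> ''cr'') (imem \<sigma> ''cl'') (imem \<sigma> ''bp'' 0)"
      using neg b by (simp add: best_def)
    then show ?thesis using all neg unfolding shortest_def by (intro min_mean_cycleI[OF q]) auto
  qed
qed

section \<open>Exactness and range of flows during an augmentation\<close>

definition lattice :: "(nat \<Rightarrow> nat \<Rightarrow> real) \<Rightarrow> bool" where
  "lattice q \<longleftrightarrow> (\<forall>k<r. \<forall>l<s. q k l * M\<^sup>2 \<in> Z)"

lemma feas_le_1: "feas q \<Longrightarrow> k < r \<Longrightarrow> l < s \<Longrightarrow> q k l \<le> 1"
proof -
  assume q: "feas q" "k < r" "l < s"
  have "q k l \<le> (\<Sum>l<s. q k l)" using q by (intro member_le_sum) (auto simp: feas_def)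
  also have "\<dots> = a k" using q by (simp add: feas_def)
  also have "\<dots> \<le> (\<Sum>k<r. a k)" using q by (intro member_le_sum) (auto intro: less_imp_le a_pos)
  finally show ?thesis using sums by simp
qed

text \<open>A crude bound for partial augmentations along arbitrary \<open>f\<close> and
  \<open>g\<close>: each of at most \<open>r\<close> steps changes a cell by at most
  \<open>\<theta> \<le> 1\<close>, and always by an integer multiple of
  \<open>\<theta>\<close>.\<close>

lemma push_bounds:
  assumes q: "feas q" "lattice q" and \<theta>: "0 \<le> \<theta>" "\<theta> \<le> 1" "\<theta> * M\<^sup>2 \<in> Z" and n: "n \<le> r" and xy: "x < r" "y < s"
  shows "\<bar>push q f g \<theta> n x y\<bar> \<le> 1 + real r" "push q f g \<theta> n x y * M\<^sup>2 \<in> Z"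
proof -
  let ?S = "\<Sum>m<n. of_bool (f m = x \<and> g m = y) - of_bool (f (Suc m) = x \<and> g m = y) :: real"
  have "\<bar>?S\<bar> \<le> (\<Sum>m<n. \<bar>of_bool (f m = x \<and> g m = y) - of_bool (f (Suc m) = x \<and> g m = y)\<bar>)" by (rule sum_abs)
  also have "\<dots> \<le> (\<Sum>m<n. 1)" by (intro sum_mono) (auto simp: of_bool_def)
  finally have "\<bar>?S\<bar> \<le> real r" using n by simp
  then have "\<bar>\<theta> * ?S\<bar> \<le> 1 * real r" unfolding abs_mult using \<theta> by (intro mult_mono) auto
  moreover have "0 \<le> q x y" "q x y \<le> 1" using q xy feas_le_1 by (auto simp: feas_def)
  ultimately show "\<bar>push q f g \<theta> n x y\<bar> \<le> 1 + real r" unfolding push_def by linarith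
  have ob: "of_bool P \<in> Z" for P using of_int_Z[of 0] of_int_Z[of 1] by (cases P) auto
  have "?S \<in> Z" by (intro sum_Z) (use Z ob in blast)
  then have "q x y * M\<^sup>2 + \<theta> * M\<^sup>2 * ?S \<in> Z" using q(2) xy \<theta>(3) Z unfolding lattice_def by blast
  then show "push q f g \<theta> n x y * M\<^sup>2 \<in> Z" by (simp add: push_def algebra_simps)
qed

lemma cell_eq_iff: "l < s \<Longrightarrow> l' < s \<Longrightarrow> k * s + l = k' * s + l' \<longleftrightarrow> k = k' \<and> l = l'" for k k' l l' :: nat
proof
  assume *: "l < s" "l' < s" "k * s + l = k' * s + l'"
  have "k = (k * s + l) div s" using *(1) by simp
  also have "\<dots> = k'" using *(2) by (simp add: *(3))
  finally show "k = k' \<and> l = l'" using *(3) by simp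
qed simp

lemma ensures_augment:
  assumes st: "static \<sigma>" and q: "cur \<sigma> = q" "feas q" "lattice q"
    and f: "imem \<sigma> ''cr'' = f" and g: "imem \<sigma> ''cl'' = g" and m: "imem \<sigma> ''bp'' 0 = m" "0 < m" "m \<le> r"
    and w: "walk q f g m"
  shows "ensures G B augment (\<lambda>\<sigma>'. \<forall>k<r. \<forall>l<s. cur \<sigma>' k l = push q f g (bottleneck q f g m) m k l) \<sigma>"
proof -
  have fg: "f n < r" "f (Suc n) < r" "g n < s" "0 < q (f (Suc n)) (g n)" if "n < m" for n
    using w that by (auto simp: walk_def)
  have sol: "rmem \<sigma> ''sol'' (k * s + l) = q k l" for k l using q(1) by (auto simp: cur_def)
  have Gq: "G (q k l)" if "k < r" "l < s" for k l
  proof (rule goodI2)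
    show "q k l * M\<^sup>2 \<in> Z" using q(3) that by (simp add: lattice_def)
    show "\<bar>q k l\<bar> \<le> 4 * r + 4" using feas_le_1[OF q(2) that] q(2) that by (auto simp: feas_def)
  qed
  define \<theta> where "\<theta> = bottleneck q f g m"
  have "\<theta> \<in> (\<lambda>n. q (f (Suc n)) (g n)) ` {..<m}"
    unfolding \<theta>_def bottleneck_def by (rule Min_in) (use m in auto)
  then obtain n0 where n0: "n0 < m" "\<theta> = q (f (Suc n0)) (g n0)" by auto
  have \<theta>: "0 \<le> \<theta>" "\<theta> \<le> 1" "\<theta> * M\<^sup>2 \<in> Z"
    using n0 fg[OF n0(1)] feas_le_1[OF q(2)] q(3) by (auto simp: lattice_def)
  show ?thesis unfolding augment_def
  proof (intro ensures_Seq ensures_RSet, goal_cases)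
    case 1
    then show ?case using Gq[of "f (Suc 0)" "g 0"] fg[OF m(2)] staticD(4)[OF st, of "f (Suc 0)"] by (simp add: f g sol)
  next
    case 2
    have h0: "rset \<sigma> ''h'' (ival (INum 0) \<sigma>) (rval (RGet ''sol'' (cell (IGet ''cr'' (INum 1)) (IGet ''cl'' (INum 0)))) \<sigma>)
        = rset \<sigma> ''h'' 0 (q (f (Suc 0)) (g 0))"
      using fg[OF m(2)] staticD(4)[OF st, of "f (Suc 0)"] by (simp add: f g sol)
    show ?case unfolding h0
    proof (rule ensures_For[where n = m and Inv = "\<lambda>k \<sigma>'. rmem \<sigma>' ''h'' 0 \<in> (\<lambda>n. q (f (Suc n)) (g n)) ` {..<m} \<and>
        (\<forall>n<k. rmem \<sigma>' ''h'' 0 \<le> q (f (Suc n)) (g n))"], goal_cases)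
      case (8 k \<sigma>')
      have im: "imem \<sigma>' x = imem \<sigma> x" if "x \<noteq> ''n''" for x
        using that 8(3) by (simp add: unchanged_def)
      have rm: "rmem \<sigma>' x = rmem \<sigma> x" if "x \<noteq> ''h''" for x
        using that 8(3) by (simp add: unchanged_def)
      have vars: "imem \<sigma>' ''cr'' = f" "imem \<sigma>' ''cl'' = g" "imem \<sigma>' ''o'' (f (Suc k)) = f (Suc k) * s"
          "\<And>k l. rmem \<sigma>' ''sol'' (k * s + l) = q k l"
        using fg[OF 8(1)] by (simp_all add: im rm f g sol staticD[OF st])
      show ?case
      proof (intro ensures_Cond ensures_RSet ensures_Skip, goal_cases)
        case 1
        then show ?case using Gq[OF fg(2,3)[OF 8(1)]] by (simp add: vars 8(2))
      next
        case 2
        then have "q (f (Suc k)) (g k) < rmem \<sigma>' ''h'' 0" by (simp add: vars 8(2))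
        then have "\<forall>n<Suc k. q (f (Suc k)) (g k) \<le> q (f (Suc n)) (g n)" using 8(4) by (force simp: less_Suc_eq)
        then show ?case using 8(1) by (auto simp: vars 8(2))
      next
        case 3
        then have "rmem \<sigma>' ''h'' 0 \<le> q (f (Suc k)) (g k)" by (simp add: vars 8(2))
        then show ?case using 8(4) by (auto simp: less_Suc_eq)
      qed
    next
      case (9 \<sigma>1)
      have im1: "imem \<sigma>1 x = imem \<sigma> x" if "x \<noteq> ''n''" for x
        using that 9(2) by (simp add: unchanged_def)
      have rm1: "rmem \<sigma>1 x = rmem \<sigma> x" if "x \<noteq> ''h''" for x
        using that 9(2) by (simp add: unchanged_def)
      have h: "rmem \<sigma>1 ''h'' 0 = \<theta>"
        unfolding \<theta>_def bottleneck_def by (rule Min_eqI[symmetric]) (use 9(3) in auto)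
      show ?case
      \<comment> \<open>The step count in \<open>push\<close> makes it a loop invariant: after
        \<open>k\<close> iterations exactly the first \<open>k\<close> pairs have been
        processed.\<close>
      proof (rule ensures_For[where n = m and Inv = "\<lambda>k \<sigma>'. \<forall>x<r. \<forall>y<s. cur \<sigma>' x y = push q f g \<theta> k x y"], goal_cases)
        case 7
        then show ?case using sol by (simp add: push_def cur_def rm1)
      next
        case (8 k \<sigma>')
        have im: "imem \<sigma>' x = imem \<sigma> x" if "x \<noteq> ''n''" for x
          using that 8(3) im1 by (simp add: unchanged_def)
        have rm: "rmem \<sigma>' x = rmem \<sigma>1 x" if "x \<noteq> ''sol''" for x
          using that 8(3) by (simp add: unchanged_def)
        let ?x = "f k" and ?x' = "f (Suc k)" and ?y = "g k"
        note xy = fg(1-3)[OF 8(1)]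
        have vars: "imem \<sigma>' ''cr'' = f" "imem \<sigma>' ''cl'' = g" "imem \<sigma>' ''o'' ?x = ?x * s" "imem \<sigma>' ''o'' ?x' = ?x' * s"
            "rmem \<sigma>' ''h'' 0 = \<theta>"
          using xy by (simp_all add: im rm f g h staticD[OF st])
        have cur: "rmem \<sigma>' ''sol'' (x * s + y) = push q f g \<theta> k x y" if "x < r" "y < s" for x y
          using 8(4) that by (simp add: cur_def)
        have km: "k \<le> r" "Suc k \<le> r" using 8(1) m by auto
        have pS: "push q f g \<theta> (Suc k) x y = push q f g \<theta> k x y + (if x = ?x \<and> y = ?y then \<theta> else 0) - (if x = ?x' \<and> y = ?y then \<theta> else 0)" for x y
          by (auto simp: push_def algebra_simps)
        show ?case
        proof (intro ensures_Seq ensures_RSet, goal_cases)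
          case 1
          have "G (push q f g \<theta> k ?x ?y + \<theta>)"
          proof (rule goodI2)
            show "(push q f g \<theta> k ?x ?y + \<theta>) * M\<^sup>2 \<in> Z"
              using push_bounds(2)[OF q(2,3) \<theta> km(1) xy(1,3)] \<theta>(3) Z by (simp add: distrib_right)
            show "\<bar>push q f g \<theta> k ?x ?y + \<theta>\<bar> \<le> 4 * r + 4"
              using push_bounds(1)[OF q(2,3) \<theta> km(1) xy(1,3), of f g] \<theta> by simp
          qed
          then show ?case using cur xy by (simp add: vars 8(2))
        next
          case 2
          have "G (push q f g \<theta> (Suc k) ?x' ?y)"
          proof (rule goodI2)
            show "push q f g \<theta> (Suc k) ?x' ?y * M\<^sup>2 \<in> Z"
              using push_bounds(2)[OF q(2,3) \<theta> km(2) xy(2,3)] .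
            show "\<bar>push q f g \<theta> (Suc k) ?x' ?y\<bar> \<le> 4 * r + 4"
              using push_bounds(1)[OF q(2,3) \<theta> km(2) xy(2,3), of f g] by simp
          qed
          \<comment> \<open>If the walk stays in its row, both writes hit the same cell and cancel,
            so this case is separated.\<close>
          then show ?case using cur xy by (cases "?x' = ?x") (simp_all add: vars 8(2) pS cell_eq_iff)
        next
          case 3
          show ?case
          proof (intro allI impI)
            fix x y assume "x < r" "y < s"
            then show "cur (rset (rset \<sigma>' ''sol'' (ival (cell (IGet ''cr'' (Var ''n'')) (IGet ''cl'' (Var ''n''))) \<sigma>')
                (rval (RAdd (RGet ''sol'' (cell (IGet ''cr'' (Var ''n'')) (IGet ''cl'' (Var ''n'')))) (RVar ''h'')) \<sigma>')) ''sol''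
                (ival (cell (IGet ''cr'' (IAdd (Var ''n'') (INum 1))) (IGet ''cl'' (Var ''n'')))
                  (rset \<sigma>' ''sol'' (ival (cell (IGet ''cr'' (Var ''n'')) (IGet ''cl'' (Var ''n''))) \<sigma>')
                (rval (RAdd (RGet ''sol'' (cell (IGet ''cr'' (Var ''n'')) (IGet ''cl'' (Var ''n'')))) (RVar ''h'')) \<sigma>')))
                (rval (RSub (RGet ''sol'' (cell (IGet ''cr'' (IAdd (Var ''n'') (INum 1))) (IGet ''cl'' (Var ''n'')))) (RVar ''h''))
                  (rset \<sigma>' ''sol'' (ival (cell (IGet ''cr'' (Var ''n'')) (IGet ''cl'' (Var ''n''))) \<sigma>')
                (rval (RAdd (RGet ''sol'' (cell (IGet ''cr'' (Var ''n'')) (IGet ''cl'' (Var ''n'')))) (RVar ''h'')) \<sigma>')))) x y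
              = push q f g \<theta> (Suc k) x y"
              using cur xy by (auto simp: vars 8(2) pS cur_def cell_eq_iff)
          qed
        qed
      next
        case (9 \<sigma>')
        then show ?case by (simp add: \<theta>_def)
      qed (use m B(2) in \<open>auto simp: im1 cur_def\<close>)
    qed (use m B(2) in auto)
  qed
qed

text \<open>The bottleneck is itself an entry of \<open>q\<close> and is added with integer
  coefficients, so denominators do not grow, however many cycles are cancelled.\<close>

lemma push_lattice:
  assumes "feas q" "lattice q" "min_mean_cycle q \<epsilon> f g m" "m \<le> r"
    and "\<forall>k<r. \<forall>l<s. q' k l = push q f g (bottleneck q f g m) m k l"
  shows "lattice q'"
proof -
  have w: "walk q f g m" "0 < m" using assms(3) by (auto simp: min_mean_cycle_def)
  have "bottleneck q f g m \<in> (\<lambda>n. q (f (Suc n)) (g n)) ` {..<m}"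
    unfolding bottleneck_def by (rule Min_in) (use w in auto)
  then obtain n where n: "n < m" "bottleneck q f g m = q (f (Suc n)) (g n)" by auto
  have "f (Suc n) < r" "g n < s" "0 < q (f (Suc n)) (g n)" using w n by (auto simp: walk_def)
  then have "0 \<le> bottleneck q f g m" "bottleneck q f g m \<le> 1" "bottleneck q f g m * M\<^sup>2 \<in> Z"
    using n feas_le_1[OF assms(1)] assms(2) by (auto simp: lattice_def)
  from push_bounds(2)[OF assms(1,2) this assms(4)] show ?thesis using assms(5) by (simp add: lattice_def)
qed

text \<open>The history \<open>Q\<close>, \<open>E\<close> of cancellations exists only in the
  invariant; \<open>cancellations_bound\<close>, applied to it, bounds the number of
  iterations.\<close>

lemma ensures_main_loop:
  assumes st: "static \<sigma>" and q: "feas (cur \<sigma>)" "lattice (cur \<sigma>)"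
  shows "ensures G B main_loop
    (\<lambda>\<sigma>'. static \<sigma>' \<and> feas (cur \<sigma>') \<and> (\<exists>u v. near_opt (cur \<sigma>') 0 u v) \<and> lattice (cur \<sigma>')) \<sigma>"
  unfolding main_loop_def
proof (intro ensures_Seq ensures_ISet, rule ensures_Loop[where Inv = "\<lambda>j \<sigma>'. static \<sigma>' \<and> feas (cur \<sigma>') \<and> lattice (cur \<sigma>') \<and>
    (if imem \<sigma>' ''go'' 0 = 0 then \<exists>u v. near_opt (cur \<sigma>') 0 u v
     else \<exists>Q E. feas (Q 0) \<and> (\<forall>i<j. cancels (Q i) (E i) (Q (Suc i))) \<and> Q j = cur \<sigma>')"])
  fix j \<sigma>1
  assume Inv: "static \<sigma>1 \<and> feas (cur \<sigma>1) \<and> lattice (cur \<sigma>1) \<and>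
    (if imem \<sigma>1 ''go'' 0 = 0 then \<exists>u v. near_opt (cur \<sigma>1) 0 u v
     else \<exists>Q E. feas (Q 0) \<and> (\<forall>i<j. cancels (Q i) (E i) (Q (Suc i))) \<and> Q j = cur \<sigma>1)"
    and go: "bval (ILess (INum 0) (Var ''go'')) \<sigma>1"
  then obtain Q E where Q: "feas (Q 0)" "\<And>i. i < j \<Longrightarrow> cancels (Q i) (E i) (Q (Suc i))" "Q j = cur \<sigma>1" by auto
  have "j \<le> (r * s + 1) * (2 * r * (4 * r + 1) * (r * s + 1))" by (rule cancellations_bound[OF Q(1,2)])
  then have "j < B" using B(3) by linarith
  have w: "iwrites scan = {''i'', ''l'', ''pm'', ''p'', ''j'', ''z'', ''pl'', ''bp'', ''cr'', ''cl'', ''n''}"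
    "rwrites scan = {''e'', ''P'', ''d'', ''b''}"
    "iwrites augment = {''n''}" "rwrites augment = {''h'', ''sol''}"
    by (auto simp: scan_def search_def relax_rows_def relax_row_def relax_cols_def relax_col_def update_def trace_def augment_def)
  let ?Inv = "\<lambda>\<sigma>'. static \<sigma>' \<and> feas (cur \<sigma>') \<and> lattice (cur \<sigma>') \<and>
    (if imem \<sigma>' ''go'' 0 = 0 then \<exists>u v. near_opt (cur \<sigma>') 0 u v
     else \<exists>Q E. feas (Q 0) \<and> (\<forall>i<Suc j. cancels (Q i) (E i) (Q (Suc i))) \<and> Q (Suc j) = cur \<sigma>')"
  have "ensures G B (scan ;; Cond (RLess (RVar ''b'') (RNum 0)) augment (assign ''go'' (INum 0))) ?Inv \<sigma>1"
  proof (intro ensures_Seq, rule ensures_conseq[OF ensures_scan[where q = "cur \<sigma>1"]])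
    fix \<sigma>2 assume best: "best (cur \<sigma>1) \<sigma>2 ({..<r} \<times> {..<r})" and u: "unchanged scan \<sigma>1 \<sigma>2"
    have cur2: "cur \<sigma>2 = cur \<sigma>1" using unchanged_rmem[OF u, of "''sol''"] by (simp add: w cur_def fun_eq_iff)
    have st2: "static \<sigma>2" by (rule static_unchanged[OF u]) (use Inv in \<open>simp_all add: w\<close>)
    have f1: "feas (cur \<sigma>1)" "lattice (cur \<sigma>1)" using Inv by auto
    show "ensures G B (Cond (RLess (RVar ''b'') (RNum 0)) augment (assign ''go'' (INum 0))) ?Inv \<sigma>2"
    proof (intro ensures_Cond ensures_ISet)
      assume "\<not> bval (RLess (RVar ''b'') (RNum 0)) \<sigma>2"
      then have "\<exists>u v. near_opt (cur \<sigma>1) 0 u v" using best_near_opt(2)[OF f1(1) best] by simp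
      moreover have "cur (iset \<sigma>2 ''go'' 0 0) = cur \<sigma>1" using cur2 by (simp add: cur_def fun_eq_iff)
      ultimately show "?Inv (iset \<sigma>2 ''go'' (ival (INum 0) \<sigma>2) (ival (INum 0) \<sigma>2))"
        using f1 st2 by (simp add: static_def)
    next
      assume "bval (RLess (RVar ''b'') (RNum 0)) \<sigma>2"
      then have neg: "rmem \<sigma>2 ''b'' 0 < 0" by simp
      let ?f = "imem \<sigma>2 ''cr''" and ?g = "imem \<sigma>2 ''cl''" and ?m = "imem \<sigma>2 ''bp'' 0" and ?\<epsilon> = "- rmem \<sigma>2 ''b'' 0 / 2"
      note cyc = best_near_opt(1)[OF f1(1) best neg]
      have m: "0 < ?m" "?m \<le> r" "walk (cur \<sigma>1) ?f ?g ?m" using neg best by (auto simp: best_def shortest_def)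
      show "ensures G B augment ?Inv \<sigma>2"
      proof (rule ensures_conseq[OF ensures_augment[OF st2 cur2 f1 refl refl refl m]])
        fix \<sigma>3 assume q': "\<forall>k<r. \<forall>l<s. cur \<sigma>3 k l = push (cur \<sigma>1) ?f ?g (bottleneck (cur \<sigma>1) ?f ?g ?m) ?m k l"
          and u3: "unchanged augment \<sigma>2 \<sigma>3"
        have c: "cancels (cur \<sigma>1) ?\<epsilon> (cur \<sigma>3)" using cyc q' unfolding cancels_def by blast
        have st3: "static \<sigma>3" by (rule static_unchanged[OF u3 st2]) (simp_all add: w)
        have lat: "lattice (cur \<sigma>3)" by (rule push_lattice[OF f1 cyc m(2) q'])
        have go3: "imem \<sigma>3 ''go'' 0 \<noteq> 0"
          using go unchanged_imem[OF u3, of "''go''"] unchanged_imem[OF u, of "''go''"] by (simp add: w)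
        have "\<forall>i<Suc j. cancels ((Q(Suc j := cur \<sigma>3)) i) ((E(j := ?\<epsilon>)) i) ((Q(Suc j := cur \<sigma>3)) (Suc i))"
          using c Q by (auto simp: less_Suc_eq)
        then have "\<exists>Q E. feas (Q 0) \<and> (\<forall>i<Suc j. cancels (Q i) (E i) (Q (Suc i))) \<and> Q (Suc j) = cur \<sigma>3"
          using Q(1) by (intro exI[of _ "Q(Suc j := cur \<sigma>3)"] exI[of _ "E(j := ?\<epsilon>)"]) auto
        then show "?Inv \<sigma>3" using st3 cancels_feas[OF c f1(1)] lat go3 by simp
      qed
    qed
  qed (use Inv in auto)
  then show "j < B \<and> ensures G B (scan ;; Cond (RLess (RVar ''b'') (RNum 0)) augment (assign ''go'' (INum 0))) ?Inv \<sigma>1"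
    using \<open>j < B\<close> by simp
next
  fix j \<sigma>' assume "static \<sigma>' \<and> feas (cur \<sigma>') \<and> lattice (cur \<sigma>') \<and>
    (if imem \<sigma>' ''go'' 0 = 0 then \<exists>u v. near_opt (cur \<sigma>') 0 u v
     else \<exists>Q E. feas (Q 0) \<and> (\<forall>i<j. cancels (Q i) (E i) (Q (Suc i))) \<and> Q j = cur \<sigma>')"
    "\<not> bval (ILess (INum 0) (Var ''go'')) \<sigma>'"
  then show "static \<sigma>' \<and> feas (cur \<sigma>') \<and> (\<exists>u v. near_opt (cur \<sigma>') 0 u v) \<and> lattice (cur \<sigma>')" by simp
next
  let ?\<sigma> = "iset \<sigma> ''go'' (ival (INum 0) \<sigma>) (ival (INum 1) \<sigma>)"
  have "cur ?\<sigma> = cur \<sigma>" by (simp add: cur_def fun_eq_iff)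
  moreover have "static ?\<sigma>" using st by (simp add: static_def)
  ultimately show "static ?\<sigma> \<and> feas (cur ?\<sigma>) \<and> lattice (cur ?\<sigma>) \<and>
    (if imem ?\<sigma> ''go'' 0 = 0 then \<exists>u v. near_opt (cur ?\<sigma>) 0 u v
     else \<exists>Q E. feas (Q 0) \<and> (\<forall>i<0. cancels (Q i) (E i) (Q (Suc i))) \<and> Q 0 = cur ?\<sigma>)"
    using q by auto
qed
end

section \<open>Initialisation, evaluation of the objective and the complete program\<close>

definition setup_sizes :: com where
  "setup_sizes = assign ''S'' (INum 0) ;;
     For ''j'' ''cols'' (Cond (RLess (RNum 0) (RGet ''mat'' (Var ''j''))) (assign ''S'' (IAdd (Var ''S'') (INum 1))) Skip) ;;
     assign ''R'' (ISub (Var ''rows'') (Var ''S'')) ;;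
     assign ''x'' (INum 0) ;; assign ''y'' (INum 0) ;;
     For ''n'' ''rows'' (ISet ''o'' (Var ''n'') (Var ''x'') ;; ISet ''g'' (Var ''n'') (Var ''y'') ;;
       assign ''x'' (IAdd (Var ''x'') (Var ''S'')) ;; assign ''y'' (IAdd (Var ''y'') (Var ''R'')))"

definition setup_sol :: com where
  "setup_sol = For ''i'' ''R'' (For ''l'' ''S''
     (RSet ''sol'' (cell (Var ''i'') (Var ''l'')) (RMul (RGet ''rhs'' (Var ''i'')) (RGet ''rhs'' (IAdd (Var ''R'') (Var ''l''))))))"

definition finish :: com where
  "finish = rassign ''val'' (RVar ''const'') ;;
     For ''n'' ''cols'' (rassign ''val'' (RAdd (RVar ''val'') (RMul (RGet ''cost'' (Var ''n'')) (RGet ''sol'' (Var ''n'')))))"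

definition solve :: com where
  "solve = setup_sizes ;; setup_sol ;; main_loop ;; finish"

context transport_machine
begin

text \<open>Of the matrix only its first row is recorded, the one of the first supply constraint,
  whose ones occupy exactly the first \<open>s\<close> columns.\<close>

definition input :: "state \<Rightarrow> bool" where
  "input \<sigma> \<longleftrightarrow> imem \<sigma> ''rows'' 0 = r + s \<and> imem \<sigma> ''cols'' 0 = r * s \<and>
     (\<forall>j<r * s. rmem \<sigma> ''mat'' j = of_bool (j < s)) \<and>
     (\<forall>k<r. \<forall>l<s. rmem \<sigma> ''cost'' (k * s + l) = t k l) \<and> rmem \<sigma> ''const'' 0 = \<kappa> \<and>
     (\<forall>k<r. rmem \<sigma> ''rhs'' k = a k) \<and> (\<forall>l<s. rmem \<sigma> ''rhs'' (r + l) = e l)"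

text \<open>Counting the ones of the first matrix row recovers \<open>s\<close>, and
  \<open>r\<close> is the number of the remaining constraints; the multiples are tabulated by
  repeated addition.\<close>

lemma ensures_setup_sizes:
  assumes "input \<sigma>"
  shows "ensures G B setup_sizes static \<sigma>"
  unfolding setup_sizes_def
proof (intro ensures_Seq ensures_ISet, rule ensures_For[where n = "r * s" and Inv = "\<lambda>k \<sigma>'. imem \<sigma>' ''S'' 0 = min k s"], goal_cases)
  case (8 k \<sigma>')
  have "rmem \<sigma>' ''mat'' = rmem \<sigma> ''mat''"
    using 8(3) by (simp add: unchanged_def)
  then have mat: "rmem \<sigma>' ''mat'' k = of_bool (k < s)" using assms 8(1) by (simp add: input_def)
  show ?case by (intro ensures_Cond ensures_ISet ensures_Skip) (use 8(4) in \<open>auto simp: mat 8(2)\<close>)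
next
  case (9 \<sigma>1)
  have im1: "imem \<sigma>1 x = imem \<sigma> x" if "x \<noteq> ''S''" "x \<noteq> ''j''" for x
    using that 9(2) by (simp add: unchanged_def)
  have rm1: "rmem \<sigma>1 = rmem \<sigma>"
    using 9(2) by (simp add: unchanged_def fun_eq_iff)
  have S: "imem \<sigma>1 ''S'' 0 = s" using 9(3) r_pos by simp
  have rows: "imem \<sigma> ''rows'' 0 = r + s" using assms by (simp add: input_def)
  show ?case
  proof (intro ensures_Seq ensures_ISet, rule ensures_For[where n = "r + s" and Inv = "\<lambda>k \<sigma>'. imem \<sigma>' ''x'' 0 = k * s \<and> imem \<sigma>' ''y'' 0 = k * r \<and>
      (\<forall>n<k. imem \<sigma>' ''o'' n = n * s \<and> imem \<sigma>' ''g'' n = n * r)"], goal_cases)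
    case (8 k \<sigma>')
    have "imem \<sigma>' ''S'' = imem \<sigma>1 ''S''" "imem \<sigma>' ''R'' 0 = r"
      using 8(3) by (simp_all add: unchanged_def im1 rows S)
    then show ?case
      by (intro ensures_Seq ensures_ISet) (use 8(4) in \<open>auto simp: 8(2) S less_Suc_eq\<close>)
  next
    case (9 \<sigma>2)
    have "imem \<sigma>2 ''S'' 0 = s" "imem \<sigma>2 ''R'' 0 = r" "imem \<sigma>2 ''cols'' 0 = r * s"
      using 9(2) assms by (simp_all add: unchanged_def im1 rows S input_def)
    moreover have "rmem \<sigma>2 = rmem \<sigma>" using 9(2) by (simp add: unchanged_def fun_eq_iff rm1)
    ultimately show ?case using 9(3) assms by (simp add: static_def input_def)
  qed (use B(2) in \<open>auto simp: im1 rows\<close>)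
qed (use assms B(1) in \<open>auto simp: input_def\<close>)

lemma ensures_setup_sol:
  assumes st: "static \<sigma>" and rhs: "\<And>k. k < r \<Longrightarrow> rmem \<sigma> ''rhs'' k = a k" "\<And>l. l < s \<Longrightarrow> rmem \<sigma> ''rhs'' (r + l) = e l"
  shows "ensures G B setup_sol (\<lambda>\<sigma>'. \<forall>k<r. \<forall>l<s. cur \<sigma>' k l = a k * e l) \<sigma>"
  unfolding setup_sol_def
proof (rule ensures_For[where n = r and Inv = "\<lambda>k \<sigma>'. \<forall>x<k. \<forall>y<s. cur \<sigma>' x y = a x * e y"], goal_cases)
  case (8 k \<sigma>')
  show ?case
  proof (rule ensures_For[where n = s and Inv = "\<lambda>n \<sigma>2. (\<forall>x<k. \<forall>y<s. cur \<sigma>2 x y = a x * e y) \<and> (\<forall>y<n. cur \<sigma>2 k y = a k * e y)"], goal_cases)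
    case 1
    show ?case using 8(3) staticD(2)[OF st] by (simp add: unchanged_def)
  next
    case 7
    show ?case using 8(4) by simp
  next
    case (8 n \<sigma>2)
    note k = \<open>k < r\<close> \<open>imem \<sigma>' ''i'' 0 = k\<close>
    have i: "imem \<sigma>2 ''i'' 0 = k" using 8(3) k by (simp add: unchanged_def)
    have im: "imem \<sigma>2 ''R'' = imem \<sigma> ''R''" "imem \<sigma>2 ''o'' = imem \<sigma> ''o''" "rmem \<sigma>2 ''rhs'' = rmem \<sigma> ''rhs''"
      using 8(3) \<open>unchanged _ \<sigma> \<sigma>'\<close> by (simp_all add: unchanged_def)
    have vars: "imem \<sigma>2 ''o'' k = k * s" "imem \<sigma>2 ''R'' 0 = r" "rmem \<sigma>2 ''rhs'' k = a k" "rmem \<sigma>2 ''rhs'' (r + n) = e n"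
      using k 8(1) rhs by (simp_all add: im staticD[OF st])
    have ae: "0 \<le> a k" "a k \<le> 1" "0 \<le> e n" "e n \<le> 1"
      using sums member_le_sum[of k "{..<r}" a] member_le_sum[of n "{..<s}" e] a_pos e_pos k 8(1) by (auto intro: less_imp_le)
    have "G (a k * e n)"
    proof (rule goodI2)
      have "(a k * M) * (e n * M) \<in> Z" using aZ[OF k(1)] eZ[OF 8(1)] Z by blast
      then show "a k * e n * M\<^sup>2 \<in> Z" by (simp add: power2_eq_square algebra_simps)
      have "a k * e n \<le> 1 * 1" using ae by (intro mult_mono) auto
      then show "\<bar>a k * e n\<bar> \<le> 4 * r + 4" using ae by simp
    qed
    then show ?case
    proof (intro ensures_RSet, goal_cases)
      case 1 then show ?case by (simp add: i vars 8(2))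
    next
      case 2
      have "x * s + y \<noteq> k * s + n" if "x < k" "y < s" for x y
        using cell_eq_iff[OF that(2) 8(1), of x k] that by simp
      then show ?case using 8(4) by (auto simp: i vars 8(2) cur_def less_Suc_eq)
    qed
  next
    case (9 \<sigma>2) then show ?case by (simp add: less_Suc_eq)
  qed (use B(2) in \<open>auto simp: cur_def\<close>)
qed (use B(2) in \<open>auto simp: staticD[OF st] cur_def\<close>)

text \<open>Total mass 1 on both sides makes the product of the marginals a coupling, which serves
  as the initial flow.\<close>

lemma product_feas_lattice:
  assumes "\<forall>k<r. \<forall>l<s. q k l = a k * e l"
  shows "feas q" "lattice q"
proof -
  have "0 \<le> q k l" if "k < r" "l < s" for k l
    using assms a_pos e_pos that by (simp add: less_imp_le)
  moreover have "(\<Sum>l<s. q k l) = a k" if "k < r" for k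
    using assms that sums by (simp add: sum_distrib_left[symmetric])
  moreover have "(\<Sum>k<r. q k l) = e l" if "l < s" for l
    using assms that sums by (simp add: sum_distrib_right[symmetric])
  ultimately show "feas q" by (simp add: feas_def)
  have "(a k * M) * (e l * M) \<in> Z" if "k < r" "l < s" for k l
    using aZ[OF that(1)] eZ[OF that(2)] Z by blast
  then show "lattice q" using assms by (simp add: lattice_def power2_eq_square algebra_simps)
qed

text \<open>A term of the objective has denominator \<open>M ^ 3\<close>, one factor from the cost
  and two from the flow, and size at most \<open>C\<close> since flows are at most 1; the additive
  constant accounts for one more \<open>C\<close>.\<close>

lemma ensures_finish:
  assumes st: "static \<sigma>" and q: "feas (cur \<sigma>)" "lattice (cur \<sigma>)"
  shows "ensures G B finish (\<lambda>\<sigma>'. rmem \<sigma>' ''val'' 0 = \<kappa> + (\<Sum>n<r * s. t (n div s) (n mod s) * rmem \<sigma> ''sol'' n)) \<sigma>"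
proof -
  have bound: "\<bar>\<kappa> + (\<Sum>n<k. t (n div s) (n mod s) * rmem \<sigma> ''sol'' n)\<bar> \<le> (r * s + 4 * r + 4) * C"
    and mem: "(\<kappa> + (\<Sum>n<k. t (n div s) (n mod s) * rmem \<sigma> ''sol'' n)) * (real 1 * M ^ 3) \<in> Z" if k: "k \<le> r * s" for k
  proof -
    have n: "n div s < r" "n mod s < s" "rmem \<sigma> ''sol'' n = cur \<sigma> (n div s) (n mod s)" if "n < k" for n
      using that k s_pos by (auto simp: less_mult_imp_div_less cur_def)
    have "\<bar>t (n div s) (n mod s) * rmem \<sigma> ''sol'' n\<bar> \<le> C * 1" if "n < k" for n
      unfolding abs_mult using tZ[OF n(1,2)[OF that]] feas_le_1[OF q(1) n(1,2)[OF that]] q(1) n[OF that] C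
      by (intro mult_mono) (auto simp: feas_def)
    then have "(\<Sum>n<k. \<bar>t (n div s) (n mod s) * rmem \<sigma> ''sol'' n\<bar>) \<le> (\<Sum>n<k. C)" by (intro sum_mono) auto
    then have "\<bar>\<Sum>n<k. t (n div s) (n mod s) * rmem \<sigma> ''sol'' n\<bar> \<le> (\<Sum>n<k. C)"
      by (rule order_trans[OF sum_abs])
    then have "\<bar>\<Sum>n<k. t (n div s) (n mod s) * rmem \<sigma> ''sol'' n\<bar> \<le> k * C" by simp
    moreover have "real k * C + C \<le> (r * s + 4 * r + 4) * C"
    proof -
      have "real k \<le> real (r * s)" using k by (simp only: of_nat_le_iff)
      then have "(real k + 1) * C \<le> (r * s + 4 * r + 4) * C" using C by (intro mult_right_mono) auto
      then show ?thesis by (simp add: algebra_simps)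
    qed
    ultimately show "\<bar>\<kappa> + (\<Sum>n<k. t (n div s) (n mod s) * rmem \<sigma> ''sol'' n)\<bar> \<le> (r * s + 4 * r + 4) * C"
      using \<kappa>Z(2) by linarith
    have "t (n div s) (n mod s) * rmem \<sigma> ''sol'' n * M ^ 3 \<in> Z" if "n < k" for n
    proof -
      have "(t (n div s) (n mod s) * M) * (rmem \<sigma> ''sol'' n * M\<^sup>2) \<in> Z"
        using tZ[OF n(1,2)[OF that]] q(2) n[OF that] Z by (auto simp: lattice_def)
      then show ?thesis by (simp add: power2_eq_square power3_eq_cube algebra_simps)
    qed
    then have "(\<Sum>n<k. t (n div s) (n mod s) * rmem \<sigma> ''sol'' n * M ^ 3) \<in> Z" by (intro sum_Z) auto
    moreover have "\<kappa> * M * (M * M) \<in> Z" using \<kappa>Z(1) M(2) Z by blast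
    ultimately have "\<kappa> * M * (M * M) + (\<Sum>n<k. t (n div s) (n mod s) * rmem \<sigma> ''sol'' n * M ^ 3) \<in> Z" using Z by blast
    moreover have "\<kappa> * M * (M * M) = \<kappa> * M ^ 3" by (simp add: power3_eq_cube)
    ultimately show "(\<kappa> + (\<Sum>n<k. t (n div s) (n mod s) * rmem \<sigma> ''sol'' n)) * (real 1 * M ^ 3) \<in> Z"
      by (simp add: distrib_right sum_distrib_right)
  qed
  have G: "G (\<kappa> + (\<Sum>n<k. t (n div s) (n mod s) * rmem \<sigma> ''sol'' n))" if "k \<le> r * s" for k
    by (rule goodI[of 1]) (use bound[OF that] mem[OF that] r_pos in auto)
  show ?thesis unfolding finish_def
  proof (intro ensures_Seq ensures_RSet, goal_cases)
    case 1 then show ?case using G[of 0] staticD(7)[OF st] by simp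
  next
    case 2
    show ?case
    proof (rule ensures_For[where n = "r * s" and Inv = "\<lambda>k \<sigma>'. rmem \<sigma>' ''val'' 0 = \<kappa> + (\<Sum>n<k. t (n div s) (n mod s) * rmem \<sigma> ''sol'' n)"], goal_cases)
      case (8 k \<sigma>')
      have rm: "rmem \<sigma>' x = rmem \<sigma> x" if "x \<noteq> ''val''" for x
        using that 8(3) by (simp add: unchanged_def)
      have "k div s < r" "k mod s < s" using 8(1) s_pos by (auto simp: less_mult_imp_div_less)
      from staticD(6)[OF st this] have "rmem \<sigma> ''cost'' k = t (k div s) (k mod s)" by simp
      then show ?case
        by (intro ensures_RSet) (use 8(1,4) G[of "Suc k"] in \<open>simp_all add: 8(2) rm add.assoc\<close>)
    qed (use B(1) st in \<open>auto simp: static_def\<close>)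
  qed
qed

theorem ensures_solve:
  assumes inp: "input \<sigma>"
  shows "ensures G B solve (\<lambda>\<sigma>'. feas (cur \<sigma>') \<and> (\<exists>u v. near_opt (cur \<sigma>') 0 u v) \<and>
    rmem \<sigma>' ''val'' 0 = \<kappa> + (\<Sum>n<r * s. t (n div s) (n mod s) * rmem \<sigma>' ''sol'' n)) \<sigma>"
  unfolding solve_def
proof (rule ensures_Seq, rule ensures_conseq[OF ensures_setup_sizes[OF inp]], rule ensures_Seq)
  fix \<sigma>1 assume st1: "static \<sigma>1" and u1: "unchanged setup_sizes \<sigma> \<sigma>1"
  have "rmem \<sigma>1 = rmem \<sigma>" using u1 by (simp add: unchanged_def setup_sizes_def fun_eq_iff)
  then have rhs: "\<And>k. k < r \<Longrightarrow> rmem \<sigma>1 ''rhs'' k = a k" "\<And>l. l < s \<Longrightarrow> rmem \<sigma>1 ''rhs'' (r + l) = e l"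
    using inp by (simp_all add: input_def)
  let ?Q = "\<lambda>\<sigma>'. feas (cur \<sigma>') \<and> (\<exists>u v. near_opt (cur \<sigma>') 0 u v) \<and>
    rmem \<sigma>' ''val'' 0 = \<kappa> + (\<Sum>n<r * s. t (n div s) (n mod s) * rmem \<sigma>' ''sol'' n)"
  show "ensures G B setup_sol (ensures G B (main_loop ;; finish) ?Q) \<sigma>1"
  proof (rule ensures_conseq[OF ensures_setup_sol[OF st1 rhs]], assumption, assumption, rule ensures_Seq)
    fix \<sigma>2 assume p2: "\<forall>k<r. \<forall>l<s. cur \<sigma>2 k l = a k * e l" and u2: "unchanged setup_sol \<sigma>1 \<sigma>2"
    have st2: "static \<sigma>2" by (rule static_unchanged[OF u2 st1]) (simp_all add: setup_sol_def)
    show "ensures G B main_loop (ensures G B finish ?Q) \<sigma>2"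
    proof (rule ensures_conseq[OF ensures_main_loop[OF st2 product_feas_lattice[OF p2]]])
      fix \<sigma>3 assume *: "static \<sigma>3 \<and> feas (cur \<sigma>3) \<and> (\<exists>u v. near_opt (cur \<sigma>3) 0 u v) \<and> lattice (cur \<sigma>3)"
      then have **: "static \<sigma>3" "feas (cur \<sigma>3)" "lattice (cur \<sigma>3)" by auto
      show "ensures G B finish ?Q \<sigma>3"
      proof (rule ensures_conseq[OF ensures_finish[OF **]])
        fix \<sigma>4 assume v: "rmem \<sigma>4 ''val'' 0 = \<kappa> + (\<Sum>n<r * s. t (n div s) (n mod s) * rmem \<sigma>3 ''sol'' n)"
          and u4: "unchanged finish \<sigma>3 \<sigma>4"
        have s4: "rmem \<sigma>4 ''sol'' = rmem \<sigma>3 ''sol''" using u4 by (simp add: unchanged_def finish_def)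
        then have "cur \<sigma>4 = cur \<sigma>3" by (simp add: cur_def fun_eq_iff)
        then show "?Q \<sigma>4" using * v s4 by simp
      qed
    qed
  qed
qed
end

section \<open>Encoding lengths\<close>

lemma bits_of_rat:
  "bits (of_rat q) = 1 + floorlog 2 (nat \<bar>fst (quotient_of q)\<bar>) + floorlog 2 (nat (snd (quotient_of q)))"
proof -
  have "(THE p. of_rat q = (of_rat p :: real)) = q" by (rule the_equality) auto
  then show ?thesis by (simp add: bits_def split: prod.split)
qed

lemma floorlog_le: "n < 2 ^ k \<Longrightarrow> floorlog 2 n \<le> k"
  by (simp add: floorlog_le_iff)

lemma less_power_floorlog: "n < 2 ^ floorlog 2 n"
  using floorlog_le_iff[of 2 n "floorlog 2 n"] by auto

text \<open>Reduction to lowest terms only shrinks numerator and denominator, so any representation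
  as a fraction bounds the encoding length.\<close>

lemma bits_fraction_le:
  fixes x y :: int
  assumes z: "z * of_int y = (of_int x :: real)" and y: "0 < y" "y < 2 ^ \<beta>" and x: "\<bar>x\<bar> < 2 ^ \<alpha>"
  shows "z \<in> \<rat>" "bits z \<le> 1 + \<alpha> + \<beta>"
proof -
  have "z = of_int x / of_int y" using z y by (simp add: field_simps)
  then have zq: "z = of_rat (Fract x y)" using y by (simp add: of_rat_rat)
  then show "z \<in> \<rat>" by simp
  let ?g = "gcd x y"
  have g: "0 < ?g" using y by auto
  have q: "quotient_of (Fract x y) = (x div ?g, y div ?g)" using y by (simp add: quotient_of_Fract normalize_def Let_def)
  have div_le: "\<bar>w div ?g\<bar> \<le> \<bar>w\<bar>" if "?g dvd w" for w
  proof -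
    have "1 \<le> ?g" using g by linarith
    then have "\<bar>w div ?g\<bar> * 1 \<le> \<bar>w div ?g\<bar> * ?g" by (rule mult_left_mono) simp
    also have "\<dots> = \<bar>w div ?g * ?g\<bar>" by (simp only: abs_mult abs_of_pos[OF g])
    finally show ?thesis using that by simp
  qed
  have "nat \<bar>x div ?g\<bar> < 2 ^ \<alpha>" using x div_le[of x] by (simp add: nat_less_iff)
  moreover have "y div ?g \<le> y" using div_le[of y] y by simp
  then have "nat (y div ?g) < 2 ^ \<beta>" using y by (simp add: nat_less_iff)
  ultimately have "floorlog 2 (nat \<bar>x div ?g\<bar>) \<le> \<alpha>" "floorlog 2 (nat (y div ?g)) \<le> \<beta>"
    by (auto intro: floorlog_le)
  then show "bits z \<le> 1 + \<alpha> + \<beta>"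
    unfolding zq bits_of_rat q by simp
qed

lemma bits_pos: "1 \<le> bits z"
  by (simp add: bits_def split: prod.split)

text \<open>The product of all denominators will do: each is at most 2 to the power of the encoding
  length of its number, and exponents add up.\<close>

lemma common_denominator:
  assumes "set xs \<subseteq> \<rat>"
  shows "\<exists>M::int. 1 \<le> M \<and> M \<le> 2 ^ sum_list (map bits xs) \<and> (\<forall>z\<in>set xs. z * of_int M \<in> \<int> \<and> \<bar>z\<bar> \<le> 2 ^ sum_list (map bits xs))"
  using assms
proof (induction xs)
  case Nil
  then show ?case by (intro exI[of _ 1]) auto
next
  case (Cons z xs)
  let ?S = "sum_list (map bits xs)"
  obtain M :: int where M: "1 \<le> M" "M \<le> 2 ^ ?S" "\<And>z. z \<in> set xs \<Longrightarrow> z * of_int M \<in> \<int> \<and> \<bar>z\<bar> \<le> 2 ^ ?S"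
    using Cons by auto
  obtain q where q: "z = of_rat q" using Cons.prems by (auto elim: Rats_cases)
  obtain x y where xy: "quotient_of q = (x, y)" by force
  have y: "0 < y" using quotient_of_denom_pos[OF xy] .
  have z: "z = of_int x / of_int y" unfolding q quotient_of_div[OF xy] by (simp add: of_rat_divide)
  have b: "bits z = 1 + floorlog 2 (nat \<bar>x\<bar>) + floorlog 2 (nat y)" unfolding q bits_of_rat by (simp add: xy)
  have "nat \<bar>x\<bar> < 2 ^ floorlog 2 (nat \<bar>x\<bar>)" "nat y < 2 ^ floorlog 2 (nat y)" by (rule less_power_floorlog)+
  then have "\<bar>x\<bar> < 2 ^ floorlog 2 (nat \<bar>x\<bar>)" "y < 2 ^ floorlog 2 (nat y)" using y by (simp_all add: nat_less_iff)
  moreover have "(2::int) ^ floorlog 2 (nat \<bar>x\<bar>) \<le> 2 ^ bits z" "(2::int) ^ floorlog 2 (nat y) \<le> 2 ^ bits z"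
    unfolding b by (intro power_increasing; simp)+
  ultimately have xb: "\<bar>x\<bar> \<le> 2 ^ bits z" and yb: "y \<le> 2 ^ bits z" by linarith+
  have zb: "\<bar>z\<bar> \<le> 2 ^ bits z"
  proof -
    have "\<bar>z\<bar> \<le> \<bar>of_int x\<bar>" unfolding z using y by (simp add: abs_divide divide_le_eq mult_le_cancel_left1)
    also have "\<dots> = of_int \<bar>x\<bar>" by simp
    also have "\<dots> \<le> of_int (2 ^ bits z)" using xb by (simp only: of_int_le_iff)
    finally show ?thesis by simp
  qed
  have up: "(2::real) ^ ?S \<le> 2 ^ (bits z + ?S)" "(2::real) ^ bits z \<le> 2 ^ (bits z + ?S)"
    by (intro power_increasing; simp)+
  show ?case
  proof (intro exI[of _ "y * M"] conjI ballI)
    show "1 \<le> y * M" using y M(1) by (metis int_one_le_iff_zero_less mult_pos_pos)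
    have "y * M \<le> 2 ^ bits z * 2 ^ ?S" using y M yb by (intro mult_mono) auto
    then show "y * M \<le> 2 ^ sum_list (map bits (z # xs))" by (simp add: power_add)
  next
    fix w assume w: "w \<in> set (z # xs)"
    show "w * of_int (y * M) \<in> \<int>"
    proof (cases "w = z")
      case True
      have "w * of_int (y * M) = of_int (x * M)" using True z y by simp
      then show ?thesis by (metis Ints_of_int)
    next
      case False
      then have "w * of_int M * of_int y \<in> \<int>" by (intro Ints_mult[of "w * _"]) (use M(3) w in auto)
      then show ?thesis by (simp add: mult_ac)
    qed
    show "\<bar>w\<bar> \<le> 2 ^ sum_list (map bits (z # xs))"
    proof -
      have "\<bar>w\<bar> \<le> 2 ^ bits z \<or> \<bar>w\<bar> \<le> 2 ^ ?S" using w M(3)[of w] zb by auto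
      then have "\<bar>w\<bar> \<le> 2 ^ (bits z + ?S)" using up by linarith
      then show ?thesis by simp
    qed
  qed
qed

lemma length_le_bits: "length xs \<le> sum_list (map bits xs)"
proof (induction xs)
  case (Cons z xs)
  then show ?case using bits_pos[of z] by simp
qed simp

section \<open>Transportation problems in matrix form\<close>

text \<open>The concrete layout of the pricing program: supply rows precede demand rows, and column
  \<open>h\<close> is the cell \<open>(h div s, h mod s)\<close>, in lexicographic order.\<close>

definition transport_form :: "lp \<Rightarrow> nat \<Rightarrow> nat \<Rightarrow> (nat \<Rightarrow> real) \<Rightarrow> (nat \<Rightarrow> real) \<Rightarrow> bool" where
  "transport_form L r s a e \<longleftrightarrow> lp_mat L \<in> carrier_mat (r + s) (r * s) \<and>
     (\<forall>i<r + s. \<forall>h<r * s. lp_mat L $$ (i, h) = of_bool (if i < r then h div s = i else h mod s = i - r)) \<and>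
     dim_vec (lp_rhs L) = r + s \<and> (\<forall>k<r. lp_rhs L $ k = a k) \<and> (\<forall>l<s. lp_rhs L $ (r + l) = e l) \<and>
     dim_vec (lp_cost L) = r * s"

lemma sum_grid: "(\<Sum>h<r * s. f h) = (\<Sum>k<r. \<Sum>l<s. f (k * s + l))" for r s :: nat
proof (induction r)
  case (Suc r)
  have "(\<Sum>h<Suc r * s. f h) = sum f {0..<r * s} + sum f {r * s..<r * s + s}"
    unfolding lessThan_atLeast0 by (subst sum.atLeastLessThan_concat) (auto simp: add.commute)
  also have "sum f {r * s..<r * s + s} = (\<Sum>l<s. f (r * s + l))"
    using sum.shift_bounds_nat_ivl[of f 0 "r * s" s] by (simp add: lessThan_atLeast0 add.commute)
  finally show ?case using Suc by (simp add: lessThan_atLeast0)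
qed simp

lemma grid_less: "k < r \<Longrightarrow> l < s \<Longrightarrow> k * s + l < r * s" for k l r s :: nat
proof -
  assume "k < r" "l < s"
  then have "k * s + l < Suc k * s" by simp
  also have "\<dots> \<le> r * s" using \<open>k < r\<close> by (intro mult_le_mono1) simp
  finally show ?thesis .
qed

lemma transport_form_mult:
  assumes L: "transport_form L r s a e" and q: "q \<in> carrier_vec (r * s)"
  shows "k < r \<Longrightarrow> (lp_mat L *\<^sub>v q) $ k = (\<Sum>l<s. q $ (k * s + l))"
    "l < s \<Longrightarrow> (lp_mat L *\<^sub>v q) $ (r + l) = (\<Sum>k<r. q $ (k * s + l))"
    "lp_objective L q = (\<Sum>k<r. \<Sum>l<s. lp_cost L $ (k * s + l) * q $ (k * s + l)) + lp_const L"
proof -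
  have A: "lp_mat L \<in> carrier_mat (r + s) (r * s)" using L by (simp add: transport_form_def)
  have mult: "(lp_mat L *\<^sub>v q) $ i = (\<Sum>k<r. \<Sum>l<s. lp_mat L $$ (i, k * s + l) * q $ (k * s + l))" if "i < r + s" for i
  proof -
    have "(lp_mat L *\<^sub>v q) $ i = (\<Sum>h<r * s. lp_mat L $$ (i, h) * q $ h)"
      using A q that by (auto simp: scalar_prod_def lessThan_atLeast0 intro!: sum.cong)
    then show ?thesis by (simp add: sum_grid)
  qed
  have entry: "lp_mat L $$ (i, k * s + l) = of_bool (if i < r then k = i else l = i - r)" if "i < r + s" "k < r" "l < s" for i k l
    using L that grid_less[OF that(2,3)] by (simp add: transport_form_def)
  show "(lp_mat L *\<^sub>v q) $ k = (\<Sum>l<s. q $ (k * s + l))" if "k < r"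
  proof -
    have "(lp_mat L *\<^sub>v q) $ k = (\<Sum>k'<r. if k' = k then (\<Sum>l<s. q $ (k * s + l)) else 0)"
    proof (subst mult)
      show "(\<Sum>k'<r. \<Sum>l<s. lp_mat L $$ (k, k' * s + l) * q $ (k' * s + l)) = (\<Sum>k'<r. if k' = k then (\<Sum>l<s. q $ (k * s + l)) else 0)"
        using that by (intro sum.cong[OF refl]) (auto simp: entry intro: sum.cong)
    qed (use that in simp)
    then show ?thesis using that by simp
  qed
  show "(lp_mat L *\<^sub>v q) $ (r + l) = (\<Sum>k<r. q $ (k * s + l))" if "l < s"
  proof -
    have "(lp_mat L *\<^sub>v q) $ (r + l) = (\<Sum>k<r. \<Sum>l'<s. if l' = l then q $ (k * s + l) else 0)"
      using that by (subst mult) (auto simp: entry intro!: sum.cong)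
    then show ?thesis using that by simp
  qed
  show "lp_objective L q = (\<Sum>k<r. \<Sum>l<s. lp_cost L $ (k * s + l) * q $ (k * s + l)) + lp_const L"
    using q by (simp add: lp_objective_def scalar_prod_def lessThan_atLeast0[symmetric] sum_grid)
qed

lemma transport_form_transportation_problem:
  assumes L: "transport_form L r s a e" and a: "\<And>k. k < r \<Longrightarrow> 0 \<le> a k" and e: "\<And>l. l < s \<Longrightarrow> 0 \<le> e l"
    and sum: "(\<Sum>k<r. a k) = (\<Sum>l<s. e l)"
  shows "transportation_problem L"
proof -
  let ?\<phi> = "\<lambda>(k, l). k * s + l" and ?\<rho> = "case_sum (\<lambda>k. k) (\<lambda>l. r + l)"
  have A: "dim_row (lp_mat L) = r + s" "dim_col (lp_mat L) = r * s" using L by (auto simp: transport_form_def)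
  have mod: "h mod s < s" if "h < r * s" for h
    using that by (cases "s = 0") auto
  have "bij_betw ?\<phi> ({..<r} \<times> {..<s}) {..<r * s}"
    by (rule bij_betw_byWitness[where f' = "\<lambda>h. (h div s, h mod s)"])
      (auto simp: grid_less less_mult_imp_div_less mod)
  moreover have "bij_betw ?\<rho> ({..<r} <+> {..<s}) {..<r + s}"
    by (rule bij_betw_byWitness[where f' = "\<lambda>i. if i < r then Inl i else Inr (i - r)"]) auto
  ultimately show ?thesis
    unfolding transportation_problem_def A
    using L a e sum transport_form_mult[OF L]
    by (intro exI[of _ r] exI[of _ s] exI[of _ a] exI[of _ e] exI[of _ "\<lambda>k l. lp_cost L $ (k * s + l)"] exI[of _ "lp_const L"]
        exI[of _ ?\<phi>] exI[of _ ?\<rho>]) (simp add: transport_form_def)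
qed

text \<open>The first measure provides the supplies and the second the demands; since the lists
  enumerate exactly the supports, all masses are positive and add up to 1.\<close>

lemma barycenter_transport_form:
  assumes n: "2 \<le> n" and D: "barycenter_data n d P x lam"
  defines "a \<equiv> \<lambda>k. pmf (P 0) (x 0 ! k)" and "e \<equiv> \<lambda>l. pmf (P 1) (x 1 ! l)"
    and "r \<equiv> length (x 0)" and "s \<equiv> length (x 1)"
  shows "transport_form (pricing_lp n d P x lam y \<sigma>) r s a e" "0 < r" "0 < s"
    "k < r \<Longrightarrow> 0 < a k" "l < s \<Longrightarrow> 0 < e l" "(\<Sum>k<r. a k) = 1" "(\<Sum>l<s. e l) = 1"
proof -
  have x: "distinct (x i)" "set (x i) = set_pmf (P i)" if "i < 2" for i
    using D n that by (auto simp: barycenter_data_def)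
  have tot: "(\<Sum>k<length (x i). pmf (P i) (x i ! k)) = 1" if "i < 2" for i
  proof -
    have "(\<Sum>k<length (x i). pmf (P i) (x i ! k)) = sum (pmf (P i)) (set (x i))"
      by (rule sum.reindex_bij_betw[OF bij_betw_nth[OF x(1)[OF that] refl refl]])
    also have "\<dots> = 1" by (rule sum_pmf_eq_1[OF finite_set]) (simp add: x(2)[OF that])
    finally show ?thesis .
  qed
  have pos: "0 < pmf (P i) (x i ! k)" if "i < 2" "k < length (x i)" for i k
    using x(2)[OF that(1)] nth_mem[OF that(2)] by (simp add: pmf_positive_iff)
  have ne: "0 < length (x i)" if "i < 2" for i
    using x(2)[OF that] set_pmf_not_empty[of "P i"] by auto
  show "0 < r" "0 < s" "k < r \<Longrightarrow> 0 < a k" "l < s \<Longrightarrow> 0 < e l" "(\<Sum>k<r. a k) = 1" "(\<Sum>l<s. e l) = 1"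
    using ne pos tot by (auto simp: r_def s_def a_def e_def)
  have "[0..<2] = [0, 1::nat]" by (simp add: upt_rec)
  then have ids: "row_ids x 0 2 = map (Pair 0) [0..<r] @ map (Pair 1) [0..<s]" by (simp add: row_ids_def r_def s_def)
  have rows: "row_ids x 0 2 ! i = (if i < r then (0, i) else (1, i - r))" if "i < r + s" for i
    using that by (auto simp: ids nth_append)
  have cols: "col_ids x ! h = (h div s, h mod s)" if "h < r * s" for h
  proof -
    have "h div s < r" "h mod s < s" using that \<open>0 < s\<close> by (auto simp: less_mult_imp_div_less)
    then show ?thesis using that by (simp add: col_ids_def product_nth r_def s_def)
  qed
  have len: "length (row_ids x 0 2) = r + s" "length (col_ids x) = r * s"
    by (simp_all add: ids col_ids_def r_def s_def)
  show "transport_form (pricing_lp n d P x lam y \<sigma>) r s a e"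
    unfolding transport_form_def pricing_lp_def
    by (auto simp: pricing_mat_def constraint_rhs_def best_cost_def len rows cols a_def e_def)
qed

section \<open>Translation between memory contents and linear programs\<close>

lemma list_of_vec_mem: "i < dim_vec v \<Longrightarrow> v $ i \<in> set (list_of_vec v)"
  using nth_mem[of i "list_of_vec v"] by simp

context transport_machine
begin

lemma lp_input_input:
  assumes L: "transport_form L r s a e" and t: "\<And>k l. k < r \<Longrightarrow> l < s \<Longrightarrow> lp_cost L $ (k * s + l) = t k l"
    and \<kappa>: "lp_const L = \<kappa>"
  shows "input (lp_input L)" "all_good G (lp_input L)"
proof -
  let ?\<sigma> = "lp_input L"
  have dims: "dim_row (lp_mat L) = r + s" "dim_col (lp_mat L) = r * s" "dim_vec (lp_rhs L) = r + s" "dim_vec (lp_cost L) = r * s"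
    using L by (auto simp: transport_form_def)
  have rhs: "\<And>k. k < r \<Longrightarrow> lp_rhs L $ k = a k" "\<And>l. l < s \<Longrightarrow> lp_rhs L $ (r + l) = e l"
    using L by (auto simp: transport_form_def)
  have entry: "lp_mat L $$ (i, h) = of_bool (if i < r then h div s = i else h mod s = i - r)" if "i < r + s" "h < r * s" for i h
    using L that by (auto simp: transport_form_def)
  have im: "imem ?\<sigma> x i = (if x = ''rows'' \<and> i = 0 then r + s else if x = ''cols'' \<and> i = 0 then r * s else 0)" for x i
    by (simp add: lp_input_def Let_def dims)
  have rm: "rmem ?\<sigma> x i = (if x = ''mat'' \<and> i < (r + s) * (r * s) then lp_mat L $$ (i div (r * s), i mod (r * s))
      else if x = ''rhs'' \<and> i < r + s then lp_rhs L $ i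
      else if x = ''cost'' \<and> i < r * s then lp_cost L $ i
      else if x = ''const'' \<and> i = 0 then \<kappa> else 0)" for x i
    by (simp add: lp_input_def Let_def dims \<kappa>)
  have mat: "rmem ?\<sigma> ''mat'' j = of_bool (j < s)" if j: "j < r * s" for j
  proof -
    have "r * s \<le> (r + s) * (r * s)" using r_pos by (cases "r + s") auto
    with j have "j < (r + s) * (r * s)" by (rule less_le_trans)
    moreover have "j div s = 0 \<longleftrightarrow> j < s" using s_pos by (simp add: div_eq_0_iff)
    ultimately show ?thesis using j r_pos entry[of 0 j] by (simp add: rm)
  qed
  show "input ?\<sigma>"
    unfolding input_def using mat by (simp add: im rm grid_less t rhs)
  have G01: "G (of_bool b)" for b using good_of_nat[of 0] good_of_nat[of 1] r_pos by (cases b) auto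
  have "1 * C \<le> (4 * r + 4) * C" using C by (intro mult_right_mono) auto
  then have C1: "z \<le> (4 * r + 4) * C" if "z \<le> 1 \<or> z \<le> C" for z using C that by linarith
  have "G (rmem ?\<sigma> x i)" for x i
  proof -
    have "G (lp_mat L $$ (i div (r * s), i mod (r * s)))" if "i < (r + s) * (r * s)"
    proof -
      have "0 < r * s" using r_pos s_pos by simp
      then have "i div (r * s) < r + s" "i mod (r * s) < r * s" using that by (auto intro: less_mult_imp_div_less)
      then show ?thesis using G01 by (simp only: entry)
    qed
    moreover have "G (lp_rhs L $ i)" if "i < r + s"
    proof (cases "i < r")
      case True
      have "0 \<le> a i" "a i \<le> 1" using sums(1) member_le_sum[of i "{..<r}" a] a_pos True by (auto intro: less_imp_le)
      then show ?thesis using aZ[OF True] rhs(1)[OF True] by (intro goodI1 C1) auto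
    next
      case False
      then have l: "i - r < s" "r + (i - r) = i" using that by auto
      have "0 \<le> e (i - r)" "e (i - r) \<le> 1" using sums(2) member_le_sum[of "i - r" "{..<s}" e] e_pos l by (auto intro: less_imp_le)
      then show ?thesis using eZ[OF l(1)] rhs(2)[OF l(1)] l(2) by (intro goodI1 C1) auto
    qed
    moreover have "G (lp_cost L $ i)" if "i < r * s"
    proof -
      have i: "i div s < r" "i mod s < s" using that s_pos by (auto intro: less_mult_imp_div_less)
      then have "lp_cost L $ i = t (i div s) (i mod s)" using t[OF i] by simp
      then show ?thesis using tZ[OF i] by (intro goodI1 C1) auto
    qed
    moreover have "G \<kappa>" using \<kappa>Z by (intro goodI1 C1) auto
    moreover have "G 0" using G01[of False] by simp
    ultimately show ?thesis by (simp add: rm)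
  qed
  then show "all_good G ?\<sigma>" by (simp add: all_good_def)
qed

lemma optimal_of_near_opt:
  assumes L: "transport_form L r s a e" and t: "\<And>k l. k < r \<Longrightarrow> l < s \<Longrightarrow> lp_cost L $ (k * s + l) = t k l"
    and q: "feas (\<lambda>k l. x (k * s + l))" "near_opt (\<lambda>k l. x (k * s + l)) 0 u v"
  shows "lp_optimal L (vec (dim_col (lp_mat L)) x)"
    "lp_objective L (vec (dim_col (lp_mat L)) x) = (\<Sum>n<r * s. t (n div s) (n mod s) * x n) + lp_const L"
proof -
  have A: "dim_row (lp_mat L) = r + s" "dim_col (lp_mat L) = r * s" "dim_vec (lp_rhs L) = r + s"
    using L by (auto simp: transport_form_def)
  have rhs: "\<And>k. k < r \<Longrightarrow> lp_rhs L $ k = a k" "\<And>l. l < s \<Longrightarrow> lp_rhs L $ (r + l) = e l"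
    using L by (auto simp: transport_form_def)
  let ?q = "vec (r * s) x"
  have qc: "?q \<in> carrier_vec (r * s)" by simp
  note mult = transport_form_mult[OF L]
  have obj: "lp_objective L w = (\<Sum>k<r. \<Sum>l<s. t k l * w $ (k * s + l)) + lp_const L" if "w \<in> carrier_vec (r * s)" for w
    unfolding mult(3)[OF that] by (simp add: t)
  have qe: "?q $ (k * s + l) = x (k * s + l)" if "k < r" "l < s" for k l
    using grid_less[OF that] by simp
  have feasible: "?q \<in> lp_feasible L"
    unfolding lp_feasible_def A
  proof (intro CollectI conjI qc)
    show "lp_mat L *\<^sub>v ?q = lp_rhs L"
    proof (rule eq_vecI)
      fix i assume "i < dim_vec (lp_rhs L)"
      then have i: "i < r + s" using A by simp
      show "(lp_mat L *\<^sub>v ?q) $ i = lp_rhs L $ i"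
      proof (cases "i < r")
        case True
        have "(lp_mat L *\<^sub>v ?q) $ i = (\<Sum>l<s. x (i * s + l))"
          unfolding mult(1)[OF qc True] using qe[OF True] by (intro sum.cong) auto
        then show ?thesis using q(1) True rhs(1) by (simp add: feas_def)
      next
        case False
        then obtain l where l: "l < s" "i = r + l" using i by (metis add_less_cancel_left le_Suc_ex not_less)
        have "(lp_mat L *\<^sub>v ?q) $ (r + l) = (\<Sum>k<r. x (k * s + l))"
          unfolding mult(2)[OF qc l(1)] using qe[OF _ l(1)] by (intro sum.cong) auto
        then show ?thesis using q(1) l rhs(2)[OF l(1)] by (simp add: feas_def)
      qed
    qed (use A in simp)
    show "0\<^sub>v (r * s) \<le> ?q"
      unfolding less_eq_vec_def
    proof (intro conjI allI impI)
      fix i assume "i < dim_vec ?q"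
      then have i: "i < r * s" by simp
      then have "i div s < r" "i mod s < s" using s_pos by (auto intro: less_mult_imp_div_less)
      then have "0 \<le> x (i div s * s + i mod s)" using q(1) unfolding feas_def by blast
      then show "0\<^sub>v (r * s) $ i \<le> ?q $ i" using i by simp
    qed simp
  qed
  have "lp_objective L ?q \<le> lp_objective L w" if "w \<in> lp_feasible L" for w
  proof -
    have w: "w \<in> carrier_vec (r * s)" "lp_mat L *\<^sub>v w = lp_rhs L" "0\<^sub>v (r * s) \<le> w"
      using that by (auto simp: lp_feasible_def A)
    have "feas (\<lambda>k l. w $ (k * s + l))"
      unfolding feas_def
    proof (intro conjI allI impI)
      fix k l assume "k < r" "l < s"
      then show "0 \<le> w $ (k * s + l)" using w(1,3) grid_less[of k r l s] by (auto simp: less_eq_vec_def)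
    next
      fix k assume "k < r" then show "(\<Sum>l<s. w $ (k * s + l)) = a k" using mult(1)[OF w(1)] w(2) rhs by simp
    next
      fix l assume "l < s" then show "(\<Sum>k<r. w $ (k * s + l)) = e l" using mult(2)[OF w(1)] w(2) rhs by simp
    qed
    from zero_near_opt_optimal[OF q this] show ?thesis unfolding obj[OF w(1)] obj[OF qc] by (simp add: qe)
  qed
  then show "lp_optimal L (vec (dim_col (lp_mat L)) x)" using feasible by (simp add: lp_optimal_def A)
  show "lp_objective L (vec (dim_col (lp_mat L)) x) = (\<Sum>n<r * s. t (n div s) (n mod s) * x n) + lp_const L"
    unfolding A obj[OF qc] sum_grid by (simp add: qe)
qed

lemma solve_correct:
  assumes L: "transport_form L r s a e" and t: "\<And>k l. k < r \<Longrightarrow> l < s \<Longrightarrow> lp_cost L $ (k * s + l) = t k l"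
    and \<kappa>: "lp_const L = \<kappa>"
  shows "\<exists>m \<sigma>. m \<le> poly (steps solve) B \<and> run solve m (lp_input L) = (Skip, \<sigma>) \<and>
      (let q = vec (dim_col (lp_mat L)) (rmem \<sigma> ''sol'') in lp_optimal L q \<and> rmem \<sigma> ''val'' 0 = lp_objective L q)"
    and "all_good G (snd (run solve m (lp_input L)))"
proof -
  have *: "\<exists>n \<sigma>. n \<le> poly (steps solve) B \<and> run solve n (lp_input L) = (Skip, \<sigma>) \<and>
      (feas (cur \<sigma>) \<and> (\<exists>u v. near_opt (cur \<sigma>) 0 u v) \<and>
        rmem \<sigma> ''val'' 0 = \<kappa> + (\<Sum>n<r * s. t (n div s) (n mod s) * rmem \<sigma> ''sol'' n)) \<and>
      (\<forall>m. all_good G (snd (run solve m (lp_input L))))"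
    using ensures_solve[OF lp_input_input(1)[OF L t \<kappa>]] lp_input_input(2)[OF L t \<kappa>]
    unfolding ensures_def reaches_def by blast
  then show "all_good G (snd (run solve m (lp_input L)))" by blast
  obtain n \<sigma> u v where n: "n \<le> poly (steps solve) B" "run solve n (lp_input L) = (Skip, \<sigma>)"
      and opt: "feas (cur \<sigma>)" "near_opt (cur \<sigma>) 0 u v"
      and v: "rmem \<sigma> ''val'' 0 = \<kappa> + (\<Sum>n<r * s. t (n div s) (n mod s) * rmem \<sigma> ''sol'' n)"
    using * by blast
  have cur: "cur \<sigma> = (\<lambda>k l. rmem \<sigma> ''sol'' (k * s + l))" by (simp add: cur_def fun_eq_iff)
  show "\<exists>m \<sigma>. m \<le> poly (steps solve) B \<and> run solve m (lp_input L) = (Skip, \<sigma>) \<and>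
      (let q = vec (dim_col (lp_mat L)) (rmem \<sigma> ''sol'') in lp_optimal L q \<and> rmem \<sigma> ''val'' 0 = lp_objective L q)"
    using n optimal_of_near_opt[OF L t opt[unfolded cur]] v \<kappa> by (intro exI[of _ n] exI[of _ \<sigma>]) (simp add: Let_def)
qed

end

section \<open>Polynomial bounds in the size of the input\<close>

lemma lp_entries_transport_form:
  assumes L: "transport_form L r s a e"
  shows "r * s + r + s + 1 \<le> length (lp_entries L)"
    "k < r \<Longrightarrow> a k \<in> set (lp_entries L)" "l < s \<Longrightarrow> e l \<in> set (lp_entries L)"
    "h < r * s \<Longrightarrow> lp_cost L $ h \<in> set (lp_entries L)" "lp_const L \<in> set (lp_entries L)"
proof -
  have d: "dim_vec (lp_rhs L) = r + s" "dim_vec (lp_cost L) = r * s"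
    "\<And>k. k < r \<Longrightarrow> a k = lp_rhs L $ k" "\<And>l. l < s \<Longrightarrow> e l = lp_rhs L $ (r + l)"
    using L by (auto simp: transport_form_def)
  show "r * s + r + s + 1 \<le> length (lp_entries L)" by (simp add: lp_entries_def d)
  show "k < r \<Longrightarrow> a k \<in> set (lp_entries L)" "l < s \<Longrightarrow> e l \<in> set (lp_entries L)"
    using list_of_vec_mem[of _ "lp_rhs L"] by (auto simp: lp_entries_def d)
  show "h < r * s \<Longrightarrow> lp_cost L $ h \<in> set (lp_entries L)" "lp_const L \<in> set (lp_entries L)"
    using list_of_vec_mem[of _ "lp_cost L"] by (auto simp: lp_entries_def d)
qed

text \<open>The bound on the cancellations with \<open>r\<close> and \<open>r * s\<close> replaced
  by the number of input entries, plus a linear term that covers the counting loops and makes the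
  inequality strict.\<close>

definition iteration_bound :: "nat poly" where
  "iteration_bound = [:1, 1:] * ([:0, 2:] * [:1, 4:] * [:1, 1:]) + [:2, 1:]"

lemma iteration_bound:
  assumes "r * s + r + s + 1 \<le> N"
  shows "r * s \<le> poly iteration_bound N" "r + s \<le> poly iteration_bound N"
    "(r * s + 1) * (2 * r * (4 * r + 1) * (r * s + 1)) + 1 < poly iteration_bound N"
proof -
  have B: "poly iteration_bound N = (N + 1) * (2 * N * (4 * N + 1) * (N + 1)) + (N + 2)"
    by (simp add: iteration_bound_def algebra_simps)
  show "r * s \<le> poly iteration_bound N" "r + s \<le> poly iteration_bound N"
    unfolding B using assms by auto
  have "(r * s + 1) * (2 * r * (4 * r + 1) * (r * s + 1)) \<le> (N + 1) * (2 * N * (4 * N + 1) * (N + 1))"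
    using assms by (intro mult_le_mono) auto
  then show "(r * s + 1) * (2 * r * (4 * r + 1) * (r * s + 1)) + 1 < poly iteration_bound N"
    unfolding B by linarith
qed

definition pricing_form :: "lp \<Rightarrow> nat \<Rightarrow> nat \<Rightarrow> (nat \<Rightarrow> real) \<Rightarrow> (nat \<Rightarrow> real) \<Rightarrow> bool" where
  "pricing_form L r s a e \<longleftrightarrow> transport_form L r s a e \<and> 0 < r \<and> 0 < s \<and> (\<forall>k<r. 0 < a k) \<and> (\<forall>l<s. 0 < e l) \<and>
     (\<Sum>k<r. a k) = 1 \<and> (\<Sum>l<s. e l) = 1"

lemma solve_strongly_polynomial:
  assumes L: "pricing_form L r s a e"
  shows "\<exists>m \<sigma>. m \<le> poly (pcompose (steps solve) iteration_bound) (length (lp_entries L)) \<and>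
      run solve m (lp_input L) = (Skip, \<sigma>) \<and>
      (let q = vec (dim_col (lp_mat L)) (rmem \<sigma> ''sol'') in lp_optimal L q \<and> rmem \<sigma> ''val'' 0 = lp_objective L q)"
proof -
  define t where "t k l = lp_cost L $ (k * s + l)" for k l
  \<comment> \<open>Although \<open>C\<close> depends on the magnitudes of the data, the iteration
    bound does not, and hence neither does the running time.\<close>
  define C where "C = 1 + \<bar>lp_const L\<bar> + (\<Sum>k<r. \<Sum>l<s. \<bar>t k l\<bar>)"
  have form: "transport_form L r s a e" using L by (simp add: pricing_form_def)
  note B = iteration_bound[OF lp_entries_transport_form(1)[OF form]]
  have "\<bar>t k l\<bar> \<le> (\<Sum>k<r. \<Sum>l<s. \<bar>t k l\<bar>)" if "k < r" "l < s" for k l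
  proof -
    have "\<bar>t k l\<bar> \<le> (\<Sum>l<s. \<bar>t k l\<bar>)" using that by (intro member_le_sum) auto
    also have "\<dots> \<le> (\<Sum>k<r. \<Sum>l<s. \<bar>t k l\<bar>)"
      using that by (intro member_le_sum[of k "{..<r}" "\<lambda>k. \<Sum>l<s. \<bar>t k l\<bar>"]) (auto intro: sum_nonneg)
    finally show ?thesis .
  qed
  then have t: "\<bar>t k l\<bar> \<le> C" if "k < r" "l < s" for k l using that unfolding C_def by fastforce
  have C: "1 \<le> C" "\<bar>lp_const L\<bar> \<le> C" unfolding C_def by (auto intro!: sum_nonneg add_nonneg_nonneg)
  interpret transport_machine r s t a e "lp_const L" 1 C UNIV "\<lambda>_. True" "poly iteration_bound (length (lp_entries L))"
    by unfold_locales (use L B t C in \<open>auto simp: pricing_form_def\<close>)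
  show ?thesis using solve_correct(1)[OF form t_def[symmetric] refl] by (simp add: poly_pcompose)
qed

text \<open>Denominators \<open>m * M ^ 3\<close> are at most \<open>2 ^ (4 * S)\<close> and
  magnitudes at most \<open>4 * 2 ^ S * 2 ^ S\<close>, so numerators are at most
  \<open>2 ^ (6 * S + 2)\<close>. The strict exponents \<open>4 * S + 1\<close> and
  \<open>6 * S + 5\<close>, with 1 for the sign, add up to \<open>10 * S + 7\<close>.\<close>

lemma solve_bits:
  assumes L: "pricing_form L r s a e" and rat: "set (lp_entries L) \<subseteq> \<rat>"
  defines "S \<equiv> sum_list (map bits (lp_entries L))"
  shows "rmem (snd (run solve m (lp_input L))) x i \<in> \<rat> \<and>
    bits (rmem (snd (run solve m (lp_input L))) x i) \<le> poly [:7, 10:] S"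
proof -
  define t where "t k l = lp_cost L $ (k * s + l)" for k l
  let ?N = "length (lp_entries L)"
  have form: "transport_form L r s a e" using L by (simp add: pricing_form_def)
  note B = iteration_bound[OF lp_entries_transport_form(1)[OF form]]
  note mem = lp_entries_transport_form(2-)[OF form]
  obtain M :: int where M: "1 \<le> M" "M \<le> 2 ^ S"
      "\<And>z. z \<in> set (lp_entries L) \<Longrightarrow> z * of_int M \<in> \<int> \<and> \<bar>z\<bar> \<le> 2 ^ S"
    using common_denominator[OF rat] unfolding S_def by blast
  define G where "G z \<longleftrightarrow> z \<in> \<rat> \<and> bits z \<le> poly [:7, 10:] S" for z
  have NS: "?N \<le> S" unfolding S_def by (rule length_le_bits)
  have N: "r * s + r + s + 1 \<le> S" using lp_entries_transport_form(1)[OF form] NS by linarith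
  have S2: "S < 2 ^ S" by simp
  have good: "G z" if m: "1 \<le> m" "m \<le> r" and z: "z * (real m * of_int M ^ 3) \<in> \<int>"
      and zb: "\<bar>z\<bar> \<le> real (r * s + 4 * r + 4) * 2 ^ S" for m z
  proof -
    obtain X where X: "z * (real m * of_int M ^ 3) = of_int X" using z by (auto elim: Ints_cases)
    let ?Y = "int m * M ^ 3"
    have "int m \<le> 2 ^ S"
    proof -
      have "int m \<le> int (2 ^ S)" using m N S2 by linarith
      then show ?thesis by simp
    qed
    then have "?Y \<le> 2 ^ S * (2 ^ S) ^ 3" using M by (intro mult_mono power_mono) auto
    also have "\<dots> = 2 ^ (4 * S)" by (simp add: power_mult[symmetric] power_add[symmetric])
    finally have Y: "?Y \<le> 2 ^ (4 * S)" .
    have Y0: "0 < ?Y" using m M by simp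
    have "r * s + 4 * r + 4 \<le> 4 * S" using N by linarith
    then have "real (r * s + 4 * r + 4) \<le> real (4 * S)" by (simp only: of_nat_le_iff)
    also have "\<dots> \<le> 4 * 2 ^ S" using of_nat_less_two_power[of S, where 'a = real] by simp
    finally have "real (r * s + 4 * r + 4) * 2 ^ S \<le> (4 * 2 ^ S) * 2 ^ S" by (intro mult_right_mono) auto
    then have zb': "\<bar>z\<bar> \<le> 4 * 2 ^ S * 2 ^ S" using zb by linarith
    have "\<bar>of_int X\<bar> = \<bar>z\<bar> * of_int ?Y" unfolding X[symmetric] abs_mult using M by simp
    also have "\<dots> \<le> (4 * 2 ^ S * 2 ^ S) * 2 ^ (4 * S)"
    proof (intro mult_mono zb')
      have "of_int ?Y \<le> (of_int (2 ^ (4 * S)) :: real)" using Y by (simp only: of_int_le_iff)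
      then show "real_of_int ?Y \<le> 2 ^ (4 * S)" by simp
    qed (use M(1) in auto)
    also have "\<dots> = of_int (2 ^ (6 * S + 2))" by (simp add: power_add[symmetric])
    finally have "\<bar>X\<bar> \<le> 2 ^ (6 * S + 2)" by (simp only: of_int_abs[symmetric] of_int_le_iff)
    also have "\<dots> < 2 ^ (6 * S + 5)" by (intro power_strict_increasing) auto
    finally have Xb: "\<bar>X\<bar> < 2 ^ (6 * S + 5)" .
    have Yb: "?Y < 2 ^ (4 * S + 1)" using Y by (intro le_less_trans[OF Y] power_strict_increasing) auto
    have "z * of_int ?Y = of_int X" using X by simp
    from bits_fraction_le[OF this Y0 Yb Xb] show "G z" by (simp add: G_def)
  qed
  have cost: "t k l * of_int M \<in> \<int> \<and> \<bar>t k l\<bar> \<le> 2 ^ S" if "k < r" "l < s" for k l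
    unfolding t_def by (rule M(3)[OF mem(3)[OF grid_less[OF that]]])
  interpret transport_machine r s t a e "lp_const L" "of_int M" "2 ^ S" \<int> G "poly iteration_bound ?N"
    by unfold_locales (use L B cost M(3)[OF mem(1)] M(3)[OF mem(2)] M(3)[OF mem(4)] good in \<open>auto simp: pricing_form_def\<close>)
  show ?thesis using solve_correct(2)[OF form t_def[symmetric] refl] unfolding all_good_def G_def by blast
qed

theorem theorem1:
  shows "(\<forall>(n::nat) (d::nat) (P :: nat \<Rightarrow> real vec pmf) (x :: nat \<Rightarrow> real vec list) (lam :: nat \<Rightarrow> real)
            (ps :: real vec list) (y :: real vec) (\<sigma>::real).
            n \<ge> 3 \<longrightarrow> barycenter_data n d P x lam \<longrightarrow> master_dual n d P x lam ps y \<sigma> \<longrightarrow>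
            transportation_problem (pricing_lp n d P x lam y \<sigma>)) \<and>
         strongly_polynomially_solvable
           {pricing_lp n d P x lam y \<sigma> | (n::nat) (d::nat) (P :: nat \<Rightarrow> real vec pmf)
              (x :: nat \<Rightarrow> real vec list) (lam :: nat \<Rightarrow> real) (ps :: real vec list) (y :: real vec) (\<sigma>::real).
              n \<ge> 3 \<and> barycenter_data n d P x lam \<and> master_dual n d P x lam ps y \<sigma>}"
proof
  have form: "\<exists>r s a e. pricing_form (pricing_lp n d P x lam y \<sigma>) r s a e"
    if "n \<ge> 3" "barycenter_data n d P x lam" for n d P x lam y \<sigma>
  proof -
    have "2 \<le> n" using that by simp
    from barycenter_transport_form[OF this that(2)] show ?thesis unfolding pricing_form_def by blast
  qed
  have "transportation_problem (pricing_lp n d P x lam y \<sigma>)"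
    if n: "n \<ge> 3" and D: "barycenter_data n d P x lam" for n d P x lam y \<sigma>
  proof -
    obtain r s a e where "pricing_form (pricing_lp n d P x lam y \<sigma>) r s a e" using form[OF n D] by blast
    then show ?thesis unfolding pricing_form_def
      by (intro transport_form_transportation_problem[of _ r s a e]) (auto intro: less_imp_le)
  qed
  then show "\<forall>(n::nat) (d::nat) (P :: nat \<Rightarrow> real vec pmf) (x :: nat \<Rightarrow> real vec list) (lam :: nat \<Rightarrow> real)
      (ps :: real vec list) (y :: real vec) (\<sigma>::real).
      n \<ge> 3 \<longrightarrow> barycenter_data n d P x lam \<longrightarrow> master_dual n d P x lam ps y \<sigma> \<longrightarrow>
      transportation_problem (pricing_lp n d P x lam y \<sigma>)" by blast
  show "strongly_polynomially_solvable
     {pricing_lp n d P x lam y \<sigma> | (n::nat) (d::nat) (P :: nat \<Rightarrow> real vec pmf)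
        (x :: nat \<Rightarrow> real vec list) (lam :: nat \<Rightarrow> real) (ps :: real vec list) (y :: real vec) (\<sigma>::real).
        n \<ge> 3 \<and> barycenter_data n d P x lam \<and> master_dual n d P x lam ps y \<sigma>}" (is "strongly_polynomially_solvable ?\<L>")
    unfolding strongly_polynomially_solvable_def
  \<comment> \<open>The program and both polynomials are chosen before \<open>L\<close>; the time
    bound is the step count of the program composed with the iteration bound.\<close>
  proof (rule exI[of _ solve], rule exI[of _ "pcompose (steps solve) iteration_bound"], rule exI[of _ "[:7, 10:]"], intro ballI, goal_cases)
    case (1 L)
    then obtain r s a e where "pricing_form L r s a e" using form by blast
    from solve_strongly_polynomial[OF this] solve_bits[OF this] show ?case
      unfolding Let_def by blast
  qed
qed

end
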